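(* Let $T$, $E$ be complex vector spaces of respective dimensions $\dim T=n$, $\dim E=r$. Assume that $E$ is equipped with a hermitian structure $h$, and denote by $\mu$ the unitary invariant probability measure on the unit sphere $S(E)=\{u\in E\,;\ |u|_h=1\}$ of $E$. Let $0\le k\le p$ be integers. (a) If $\ell_1,\ldots,\ell_k\in E^*$ and $\theta_1,\ldots,\theta_{p-k}\ge_S0$ are strongly semi-positive hermitian tensors in $\mathrm{Herm}(T\otimes E)\simeq\Lambda^{1,1}_{\mathbb{R}}T^*\otimes_{\mathbb{R}}\mathrm{Herm}(E,E)$, then $$\int_{u\in S(E)}|\ell_1(u)|^2\cdots|\ell_k(u)|^2\,\langle\theta_1(u),u\rangle_h\wedge\ldots\wedge\langle\theta_{p-k}(u),u\rangle_h\,d\mu(u)$$ is $$\ge\frac{(r-1)!}{(p+r-1)!}\Big(\prod_{j=1}^k|\ell_j|^2\Big)\mathrm{Tr}_h\theta_1\wedge\ldots\wedge\mathrm{Tr}_h\theta_{p-k}\quad\text{and}\quad\le\frac{p!\,(r-1)!}{(p+r-1)!}\Big(\prod_{j=1}^k|\ell_j|^2\Big)\mathrm{Tr}_h\theta_1\wedge\ldots\wedge\mathrm{Tr}_h\theta_{p-k},$$ as pointwise strong inequalities of $(p-k,p-k)$-forms. (b) If $\theta\ge_G0$ in $\Lambda^{1,1}_{\mathbb{R}}T^*\otimes_{\mathbb{R}}\mathrm{Herm}(E,E)$ and $\ell_j\in E^*$, then $$\int_{u\in S(E)}|\ell_1(u)|^2\cdots|\ell_k(u)|^2\,\langle\theta(u),u\rangle_h^{p-k}\,d\mu(u)\le\frac{p!\,(r-1)!}{(p+r-1)!}\Big(\prod_{j=1}^k|\ell_j|^2\Big)(\mathrm{Tr}_h\theta)^{p-k}$$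 as a pointwise weak inequality of $(p-k,p-k)$-forms. In particular, the lower and upper bounds in (a) (for $\theta_1=\ldots=\theta_{p-k}=\Theta_{E,h}\ge_S0$) and the upper bound in (b) (for $\theta=\Theta_{E,h}\ge_G0$) apply when $(E,h)$ is a hermitian holomorphic vector bundle of rank $r$ on a complex $n$-dimensional manifold $X$ and one takes $\theta_j=\Theta_{E,h}$ to be the curvature tensor of $E$ (satisfying the corresponding semi-positivity assumption), so that $\mathrm{Tr}_h\theta_j=c_1(E,h)$ is the first Chern form of $(E,h)$.
   Context: A hermitian form $\theta$ on $T\otimes E$ is Griffiths semi-positive ($\theta\ge_G0$) if $\theta(\xi\otimes u,\xi\otimes u)\ge0$ for all $\xi\in T$, $u\in E$; it is strongly semi-positive ($\theta\ge_S0$) if there are finitely many $\alpha_j\in T^*$, $\psi_j\in E^*$ with $\theta(\tau,\tau)=\sum_j|(\alpha_j\otimes\psi_j)\cdot\tau|^2$ for all $\tau\in T\otimes E$. For $u\in E$, $\langle\theta(u),u\rangle_h$ denotes the real $(1,1)$-form on $T$ associated with the hermitian form $\xi\mapsto\theta(\xi\otimes u,\xi\otimes u)$, and $\mathrm{Tr}_h\theta=\sum_{\lambda}\langle\theta(e_\lambda),e_\lambda\rangle_h$ for any $h$-orthonormal basis $(e_\lambda)$ of $E$. $|\ell_j|$ is the dual norm. For real $(q,q)$-forms on $T$: $a\ge b$ strongly means that $a-b$ is a finite sum of forms $c\,i\beta_1\wedge\bar\beta_1\wedge\cdots\wedge i\beta_q\wedge\bar\beta_q$ with $c\ge 0$,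 $\beta_j\in T^*$; $a\ge b$ weakly means that $a-b$ restricts to a non negative volume form on every $q$-dimensional complex subspace of $T$. The curvature tensor is $\Theta_{E,h}=\frac{i}{2\pi}\nabla_h^2$, $\nabla_h$ being the Chern connection. *)

theory Defs
  imports "HOL-Probability.Probability_Measure"
begin

text \<open>
  Complex vector spaces are given by a scalar multiplication \<open>s :: complex \<Rightarrow> 'a \<Rightarrow> 'a\<close> on a
  type, as in the library locale \<^locale>\<open>vector_space\<close>. Sesquilinear forms are complex linear in
  the first and conjugate linear in the second argument.
\<close>

definition complex_space :: "(complex \<Rightarrow> 'a \<Rightarrow> 'a::ab_group_add) \<Rightarrow> nat \<Rightarrow> bool" where
  "complex_space s n \<longleftrightarrow> (\<exists>B. finite_dimensional_vector_space s B \<and> card B = n)"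

abbreviation complex_functional :: "(complex \<Rightarrow> 'a \<Rightarrow> 'a::ab_group_add) \<Rightarrow> ('a \<Rightarrow> complex) \<Rightarrow> bool" where
  "complex_functional s f \<equiv> Vector_Spaces.linear s (*) f"


section \<open>Hermitian structures\<close>

definition hermitian_form :: "(complex \<Rightarrow> 'a \<Rightarrow> 'a::ab_group_add) \<Rightarrow> ('a \<Rightarrow> 'a \<Rightarrow> complex) \<Rightarrow> bool" where
  "hermitian_form s h \<longleftrightarrow>
     (\<forall>v. complex_functional s (\<lambda>u. h u v)) \<and> (\<forall>u v. h v u = cnj (h u v))"

definition hermitian_structure :: "(complex \<Rightarrow> 'a \<Rightarrow> 'a::ab_group_add) \<Rightarrow> ('a \<Rightarrow> 'a \<Rightarrow> complex) \<Rightarrow> bool" where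
  "hermitian_structure s h \<longleftrightarrow> hermitian_form s h \<and> (\<forall>u. u \<noteq> 0 \<longrightarrow> Re (h u u) > 0)"

definition hnorm :: "('a \<Rightarrow> 'a \<Rightarrow> complex) \<Rightarrow> 'a \<Rightarrow> real" where
  "hnorm h u = sqrt (Re (h u u))"

definition unit_sphere :: "('a \<Rightarrow> 'a \<Rightarrow> complex) \<Rightarrow> 'a set" where
  "unit_sphere h = {u. hnorm h u = 1}"

definition dual_norm :: "('a \<Rightarrow> 'a \<Rightarrow> complex) \<Rightarrow> ('a \<Rightarrow> complex) \<Rightarrow> real" where
  "dual_norm h l = Sup {cmod (l u) |u. hnorm h u \<le> 1}"

definition orthonormal_basis ::
  "(complex \<Rightarrow> 'a \<Rightarrow> 'a::ab_group_add) \<Rightarrow> ('a \<Rightarrow> 'a \<Rightarrow> complex) \<Rightarrow> 'a set \<Rightarrow> bool" where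
  "orthonormal_basis s h B \<longleftrightarrow>
     finite_dimensional_vector_space s B \<and> (\<forall>e\<in>B. \<forall>f\<in>B. h e f = (if e = f then 1 else 0))"

definition h_open :: "('a \<Rightarrow> 'a \<Rightarrow> complex) \<Rightarrow> 'a::ab_group_add set \<Rightarrow> bool" where
  "h_open h U \<longleftrightarrow> (\<forall>u\<in>U. \<exists>\<epsilon>>0. \<forall>v. hnorm h (v - u) < \<epsilon> \<longrightarrow> v \<in> U)"

text \<open>Borel probability measures on the unit sphere that are invariant under the unitary group;
  an \<open>h\<close>-preserving linear endomorphism of a finite dimensional space is automatically bijective.\<close>

definition unitary_invariant_probability ::
  "(complex \<Rightarrow> 'a \<Rightarrow> 'a::ab_group_add) \<Rightarrow> ('a \<Rightarrow> 'a \<Rightarrow> complex) \<Rightarrow> 'a measure \<Rightarrow> bool" where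
  "unitary_invariant_probability s h \<mu> \<longleftrightarrow>
     prob_space \<mu> \<and> space \<mu> = unit_sphere h \<and>
     sets \<mu> = sigma_sets (unit_sphere h) {U \<inter> unit_sphere h |U. h_open h U} \<and>
     (\<forall>g. Vector_Spaces.linear s s g \<and> (\<forall>u v. h (g u) (g v) = h u v) \<longrightarrow>
        (\<forall>A\<in>sets \<mu>. emeasure \<mu> (g -` A \<inter> unit_sphere h) = emeasure \<mu> A))"


section \<open>Exterior forms\<close>

text \<open>
  A complex valued exterior form of degree \<open>d\<close> on the real vector space underlying \<open>'t\<close> is
  represented by the function that sends a sequence \<open>v\<close> of vectors to its value on
  \<open>v 0, \<dots>, v (d - 1)\<close>; the degree is passed separately.
\<close>

type_synonym 't form = "(nat \<Rightarrow> 't) \<Rightarrow> complex"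

definition wedge :: "nat \<Rightarrow> nat \<Rightarrow> 't form \<Rightarrow> 't form \<Rightarrow> 't form" where
  "wedge p q a b = (\<lambda>v. (\<Sum>\<sigma> | \<sigma> permutes {..<p + q}.
       of_int (sign \<sigma>) * a (\<lambda>i. v (\<sigma> i)) * b (\<lambda>i. v (\<sigma> (p + i)))) / (fact p * fact q))"

text \<open>Wedge product of a list of 2-forms.\<close>

primrec wedge_list :: "'t form list \<Rightarrow> 't form" where
  "wedge_list [] = (\<lambda>v. 1)"
| "wedge_list (w # ws) = wedge 2 (2 * length ws) w (wedge_list ws)"

text \<open>The elementary form $i\beta\wedge\bar\beta$.\<close>

definition i_wedge_conj :: "('t \<Rightarrow> complex) \<Rightarrow> 't form" where
  "i_wedge_conj \<beta> = (\<lambda>v. \<i> * wedge 1 1 (\<lambda>w. \<beta> (w 0)) (\<lambda>w. cnj (\<beta> (w 0))) v)"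

text \<open>The real (1,1)-form $i\sum H_{jk}\,dz_j\wedge d\bar z_k$ associated with a hermitian form
  $H=\sum H_{jk}\,dz_j\otimes d\bar z_k$; it is \<open>i_wedge_conj \<beta>\<close> when \<open>H \<xi> \<eta> = \<beta> \<xi> * cnj (\<beta> \<eta>)\<close>.\<close>

definition form_of_hermitian :: "('t \<Rightarrow> 't \<Rightarrow> complex) \<Rightarrow> 't form" where
  "form_of_hermitian H = (\<lambda>v. \<i> * (H (v 0) (v 1) - H (v 1) (v 0)))"

definition strong_ge ::
  "(complex \<Rightarrow> 't \<Rightarrow> 't::ab_group_add) \<Rightarrow> nat \<Rightarrow> 't form \<Rightarrow> 't form \<Rightarrow> bool" where
  "strong_ge s q a b \<longleftrightarrow>
     (\<exists>F :: (real \<times> ('t \<Rightarrow> complex) list) list.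
        (\<forall>(c, \<beta>s)\<in>set F. 0 \<le> c \<and> length \<beta>s = q \<and> (\<forall>\<beta>\<in>set \<beta>s. complex_functional s \<beta>)) \<and>
        (\<forall>v. a v - b v = (\<Sum>(c, \<beta>s)\<leftarrow>F. of_real c * wedge_list (map i_wedge_conj \<beta>s) v)))"

text \<open>The canonically oriented real frame \<open>e\<^sub>0, i e\<^sub>0, e\<^sub>1, i e\<^sub>1, \<dots>\<close> of a complex frame.\<close>

definition real_frame :: "(complex \<Rightarrow> 't \<Rightarrow> 't) \<Rightarrow> 't list \<Rightarrow> nat \<Rightarrow> 't" where
  "real_frame s es = (\<lambda>i. if even i then es ! (i div 2) else s \<i> (es ! (i div 2)))"

definition weak_ge ::
  "(complex \<Rightarrow> 't \<Rightarrow> 't::ab_group_add) \<Rightarrow> nat \<Rightarrow> 't form \<Rightarrow> 't form \<Rightarrow> bool" where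
  "weak_ge s q a b \<longleftrightarrow>
     (\<forall>S. module.subspace s S \<and> vector_space.dim s S = q \<longrightarrow>
        (\<forall>es. length es = q \<and> distinct es \<and> \<not> module.dependent s (set es) \<and>
              module.span s (set es) = S \<longrightarrow>
           a (real_frame s es) - b (real_frame s es) \<in> \<real>\<^sub>\<ge>\<^sub>0))"


section \<open>Hermitian forms on $T\otimes E$\<close>

text \<open>
  A hermitian form on $T\otimes E$ is given by its values
  \<open>\<theta> \<xi> u \<eta> v\<close> $=\theta(\xi\otimes u,\eta\otimes v)$ on simple tensors. A general element of
  $T\otimes E$ is given by a list of pairs \<open>(\<xi>, u)\<close>, standing for the sum of the tensors
  $\xi\otimes u$.
\<close>

definition hermitian_tensor ::
  "(complex \<Rightarrow> 't \<Rightarrow> 't::ab_group_add) \<Rightarrow> (complex \<Rightarrow> 'e \<Rightarrow> 'e::ab_group_add) \<Rightarrow>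
   ('t \<Rightarrow> 'e \<Rightarrow> 't \<Rightarrow> 'e \<Rightarrow> complex) \<Rightarrow> bool" where
  "hermitian_tensor sT sE \<theta> \<longleftrightarrow>
     (\<forall>u \<eta> v. complex_functional sT (\<lambda>\<xi>. \<theta> \<xi> u \<eta> v)) \<and>
     (\<forall>\<xi> \<eta> v. complex_functional sE (\<lambda>u. \<theta> \<xi> u \<eta> v)) \<and>
     (\<forall>\<xi> u \<eta> v. \<theta> \<eta> v \<xi> u = cnj (\<theta> \<xi> u \<eta> v))"

definition griffiths_semipositive :: "('t \<Rightarrow> 'e \<Rightarrow> 't \<Rightarrow> 'e \<Rightarrow> complex) \<Rightarrow> bool" where
  "griffiths_semipositive \<theta> \<longleftrightarrow> (\<forall>\<xi> u. \<theta> \<xi> u \<xi> u \<in> \<real>\<^sub>\<ge>\<^sub>0)"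

definition strongly_semipositive ::
  "(complex \<Rightarrow> 't \<Rightarrow> 't::ab_group_add) \<Rightarrow> (complex \<Rightarrow> 'e \<Rightarrow> 'e::ab_group_add) \<Rightarrow>
   ('t \<Rightarrow> 'e \<Rightarrow> 't \<Rightarrow> 'e \<Rightarrow> complex) \<Rightarrow> bool" where
  "strongly_semipositive sT sE \<theta> \<longleftrightarrow>
     (\<exists>F :: (('t \<Rightarrow> complex) \<times> ('e \<Rightarrow> complex)) list.
        (\<forall>(\<alpha>, \<psi>)\<in>set F. complex_functional sT \<alpha> \<and> complex_functional sE \<psi>) \<and>
        (\<forall>\<tau> :: ('t \<times> 'e) list.
           (\<Sum>(\<xi>, u)\<leftarrow>\<tau>. \<Sum>(\<eta>, v)\<leftarrow>\<tau>. \<theta> \<xi> u \<eta> v) =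
           of_real (\<Sum>(\<alpha>, \<psi>)\<leftarrow>F. (cmod (\<Sum>(\<xi>, u)\<leftarrow>\<tau>. \<alpha> \<xi> * \<psi> u))\<^sup>2)))"

text \<open>The form $\langle\theta(u),u\rangle_h$ and its trace over an orthonormal basis \<open>B\<close>.\<close>

definition contract :: "('t \<Rightarrow> 'e \<Rightarrow> 't \<Rightarrow> 'e \<Rightarrow> complex) \<Rightarrow> 'e \<Rightarrow> 't form" where
  "contract \<theta> u = form_of_hermitian (\<lambda>\<xi> \<eta>. \<theta> \<xi> u \<eta> u)"

definition h_trace :: "'e set \<Rightarrow> ('t \<Rightarrow> 'e \<Rightarrow> 't \<Rightarrow> 'e \<Rightarrow> complex) \<Rightarrow> 't form" where
  "h_trace B \<theta> = (\<lambda>v. \<Sum>e\<in>B. contract \<theta> e v)"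

text \<open>The form valued integral
  $\int|\ell_1(u)|^2\cdots|\ell_k(u)|^2\,\langle\theta_1(u),u\rangle_h\wedge\cdots\wedge
    \langle\theta_q(u),u\rangle_h\,d\mu(u)$, evaluated on tangent vectors.\<close>

definition sphere_integral ::
  "'e measure \<Rightarrow> ('e \<Rightarrow> complex) list \<Rightarrow> ('t \<Rightarrow> 'e \<Rightarrow> 't \<Rightarrow> 'e \<Rightarrow> complex) list \<Rightarrow> 't form" where
  "sphere_integral \<mu> ls \<theta>s = (\<lambda>v. \<integral>u. of_real (\<Prod>l\<leftarrow>ls. (cmod (l u))\<^sup>2) *
       wedge_list (map (\<lambda>\<theta>. contract \<theta> u) \<theta>s) v \<partial>\<mu>)"

text \<open>The form $c\,\prod_j|\ell_j|^2\;\omega_1\wedge\cdots\wedge\omega_q$.\<close>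

definition bound_form ::
  "real \<Rightarrow> ('e \<Rightarrow> 'e \<Rightarrow> complex) \<Rightarrow> ('e \<Rightarrow> complex) list \<Rightarrow> 't form list \<Rightarrow> 't form" where
  "bound_form c h ls ws = (\<lambda>v. of_real (c * (\<Prod>l\<leftarrow>ls. (dual_norm h l)\<^sup>2)) * wedge_list ws v)"


section \<open>Smooth and holomorphic functions of several variables\<close>

primrec Ck_on :: "nat \<Rightarrow> 'a::real_normed_vector set \<Rightarrow> ('a \<Rightarrow> 'b::real_normed_vector) \<Rightarrow> bool" where
  "Ck_on 0 U f \<longleftrightarrow> continuous_on U f"
| "Ck_on (Suc k) U f \<longleftrightarrow> (\<forall>z\<in>U. f differentiable (at z)) \<and>
     (\<forall>\<xi>. Ck_on k U (\<lambda>z. frechet_derivative f (at z) \<xi>))"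

definition smooth_on :: "'a::real_normed_vector set \<Rightarrow> ('a \<Rightarrow> 'b::real_normed_vector) \<Rightarrow> bool" where
  "smooth_on U f \<longleftrightarrow> (\<forall>k. Ck_on k U f)"

definition multi_holomorphic_on :: "(complex^'n) set \<Rightarrow> (complex^'n \<Rightarrow> complex) \<Rightarrow> bool" where
  "multi_holomorphic_on U f \<longleftrightarrow>
     (\<forall>z\<in>U. \<exists>D. (f has_derivative D) (at z) \<and> (\<forall>c \<xi>. D (c *s \<xi>) = c * D \<xi>))"


section \<open>Hermitian holomorphic vector bundles\<close>

text \<open>A complex manifold is a Hausdorff, second countable space \<open>X\<close> with a holomorphic atlas of charts
  \<open>(U, \<phi>)\<close>.\<close>

definition complex_manifold :: "'x topology \<Rightarrow> ('x set \<times> ('x \<Rightarrow> complex^'n)) set \<Rightarrow> bool" where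
  "complex_manifold X \<A> \<longleftrightarrow>
     Hausdorff_space X \<and> second_countable X \<and> (\<Union>(U, \<phi>)\<in>\<A>. U) = topspace X \<and>
     (\<forall>(U, \<phi>)\<in>\<A>. openin X U \<and> open (\<phi> ` U) \<and>
        homeomorphic_map (subtopology X U) (top_of_set (\<phi> ` U)) \<phi>) \<and>
     (\<forall>(U, \<phi>)\<in>\<A>. \<forall>(V, \<psi>)\<in>\<A>. \<forall>i.
        multi_holomorphic_on (\<phi> ` (U \<inter> V)) (\<lambda>z. \<psi> (inv_into U \<phi> z) $ i))"

text \<open>A holomorphic vector bundle is a set \<open>E\<close> over \<open>X\<close> with an atlas of trivialisations
  \<open>(V, \<tau>)\<close>, where \<open>\<tau> x\<close> is a bijection from $\mathbb{C}^r$ onto the fibre over \<open>x\<close>, such that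
  the transition matrices \<open>g\<close> are holomorphic. The vector space structure of the fibres and the
  topology of \<open>E\<close> are those transported by the trivialisations.\<close>

definition holomorphic_vector_bundle ::
  "'x topology \<Rightarrow> ('x set \<times> ('x \<Rightarrow> complex^'n)) set \<Rightarrow> 'e set \<Rightarrow> ('e \<Rightarrow> 'x) \<Rightarrow>
   ('x set \<times> ('x \<Rightarrow> complex^'r \<Rightarrow> 'e)) set \<Rightarrow> bool" where
  "holomorphic_vector_bundle X \<A> E \<pi> \<T> \<longleftrightarrow>
     complex_manifold X \<A> \<and> \<pi> ` E \<subseteq> topspace X \<and> (\<Union>(V, \<tau>)\<in>\<T>. V) = topspace X \<and>
     (\<forall>(V, \<tau>)\<in>\<T>. openin X V \<and> (\<forall>x\<in>V. bij_betw (\<tau> x) UNIV {e \<in> E. \<pi> e = x})) \<and>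
     (\<forall>(V, \<tau>)\<in>\<T>. \<forall>(V', \<tau>')\<in>\<T>. \<exists>g :: 'x \<Rightarrow> complex^'r^'r.
        (\<forall>x\<in>V \<inter> V'. \<forall>u. \<tau> x u = \<tau>' x (g x *v u)) \<and>
        (\<forall>(U, \<phi>)\<in>\<A>. \<forall>i j.
           multi_holomorphic_on (\<phi> ` (U \<inter> V \<inter> V')) (\<lambda>z. g (inv_into U \<phi> z) $ i $ j)))"

text \<open>The matrix of a metric \<open>h\<close> in the frame \<open>\<tau>\<close>, as a function of the local coordinate \<open>\<phi>\<close>.\<close>

definition local_metric ::
  "('e \<Rightarrow> 'e \<Rightarrow> complex) \<Rightarrow> 'x set \<Rightarrow> ('x \<Rightarrow> complex^'n) \<Rightarrow> ('x \<Rightarrow> complex^'r \<Rightarrow> 'e) \<Rightarrow>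
   complex^'n \<Rightarrow> complex^'r \<Rightarrow> complex^'r \<Rightarrow> complex" where
  "local_metric h U \<phi> \<tau> = (\<lambda>z u v. h (\<tau> (inv_into U \<phi> z) u) (\<tau> (inv_into U \<phi> z) v))"

definition hermitian_metric ::
  "('x set \<times> ('x \<Rightarrow> complex^'n)) set \<Rightarrow> ('x set \<times> ('x \<Rightarrow> complex^'r \<Rightarrow> 'e)) set \<Rightarrow>
   ('e \<Rightarrow> 'e \<Rightarrow> complex) \<Rightarrow> bool" where
  "hermitian_metric \<A> \<T> h \<longleftrightarrow>
     (\<forall>(U, \<phi>)\<in>\<A>. \<forall>(V, \<tau>)\<in>\<T>.
        (\<forall>z\<in>\<phi> ` (U \<inter> V). hermitian_structure (*s) (local_metric h U \<phi> \<tau> z)) \<and>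
        (\<forall>u v. smooth_on (\<phi> ` (U \<inter> V)) (\<lambda>z. local_metric h U \<phi> \<tau> z u v)))"


section \<open>The Chern connection and its curvature\<close>

text \<open>
  In a local coordinate and frame a connection is \<open>\<nabla> = d + A\<close> with a matrix valued 1-form
  \<open>A z \<xi>\<close> acting on \<open>complex^'r\<close>. The functions \<open>nabla0\<close> and \<open>nabla1\<close> are \<open>\<nabla>\<close> on sections and on
  bundle valued 1-forms.
\<close>

type_synonym ('n, 'r) connection_form = "complex^'n \<Rightarrow> complex^'n \<Rightarrow> complex^'r \<Rightarrow> complex^'r"

definition nabla0 ::
  "('n::finite, 'r::finite) connection_form \<Rightarrow> (complex^'n \<Rightarrow> complex^'r) \<Rightarrow>
   complex^'n \<Rightarrow> complex^'n \<Rightarrow> complex^'r" where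
  "nabla0 A s = (\<lambda>z \<xi>. frechet_derivative s (at z) \<xi> + A z \<xi> (s z))"

definition nabla1 ::
  "('n::finite, 'r::finite) connection_form \<Rightarrow> (complex^'n \<Rightarrow> complex^'n \<Rightarrow> complex^'r) \<Rightarrow>
   complex^'n \<Rightarrow> complex^'n \<Rightarrow> complex^'n \<Rightarrow> complex^'r" where
  "nabla1 A \<sigma> = (\<lambda>z \<xi> \<eta>.
     frechet_derivative (\<lambda>w. \<sigma> w \<eta>) (at z) \<xi> - frechet_derivative (\<lambda>w. \<sigma> w \<xi>) (at z) \<eta>
     + A z \<xi> (\<sigma> z \<eta>) - A z \<eta> (\<sigma> z \<xi>))"

text \<open>The Chern connection is compatible with the metric and its (0,1)-part is $\bar\partial$; both
  are conditions on all smooth local sections.\<close>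

definition chern_connection ::
  "(complex^'n) set \<Rightarrow> (complex^'n \<Rightarrow> complex^'r \<Rightarrow> complex^'r \<Rightarrow> complex) \<Rightarrow>
   ('n::finite, 'r::finite) connection_form \<Rightarrow> bool" where
  "chern_connection U H A \<longleftrightarrow>
     (\<forall>z\<in>U. \<forall>\<xi>. Vector_Spaces.linear (*s) (*s) (A z \<xi>)) \<and>
     (\<forall>z\<in>U. \<forall>u. linear (\<lambda>\<xi>. A z \<xi> u)) \<and>
     (\<forall>\<xi> u. smooth_on U (\<lambda>z. A z \<xi> u)) \<and>
     (\<forall>s t. smooth_on U s \<and> smooth_on U t \<longrightarrow>
        (\<forall>z\<in>U. \<forall>\<xi>. frechet_derivative (\<lambda>w. H w (s w) (t w)) (at z) \<xi> =
                   H z (nabla0 A s z \<xi>) (t z) + H z (s z) (nabla0 A t z \<xi>))) \<and>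
     (\<forall>s. smooth_on U s \<longrightarrow>
        (\<forall>z\<in>U. \<forall>\<xi>. (1 / 2) *s (nabla0 A s z \<xi> + \<i> *s nabla0 A s z (\<i> *s \<xi>)) =
                   (1 / 2) *s (frechet_derivative s (at z) \<xi> +
                               \<i> *s frechet_derivative s (at z) (\<i> *s \<xi>))))"

text \<open>$\Theta=\frac{i}{2\pi}\nabla^2$; as $\nabla^2$ is of order zero, it may be computed on the
  section with constant coefficients \<open>u\<close> in the frame.\<close>

definition curvature ::
  "('n::finite, 'r::finite) connection_form \<Rightarrow> complex^'n \<Rightarrow> complex^'n \<Rightarrow> complex^'n \<Rightarrow>
   complex^'r \<Rightarrow> complex^'r" where
  "curvature A z \<xi> \<eta> u =
     (\<i> / (2 * of_real pi)) *s nabla1 A (nabla0 A (\<lambda>_. u)) z \<xi> \<eta>"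

text \<open>The hermitian form on $T\otimes E$ of an endomorphism valued (1,1)-form \<open>\<Theta>\<close>: its value on
  $(\xi\otimes u,\eta\otimes v)$ is $-i\langle\Theta(\xi^{1,0},\overline{\eta^{1,0}})u,v\rangle_h$,
  so that $\langle\Theta(\xi,\eta)u,v\rangle_h
    =i(\theta(\xi\otimes u,\eta\otimes v)-\theta(\eta\otimes u,\xi\otimes v))$.\<close>

definition tensor_of_curvature ::
  "(complex^'r \<Rightarrow> complex^'r \<Rightarrow> complex) \<Rightarrow>
   (complex^'n \<Rightarrow> complex^'n \<Rightarrow> complex^'r \<Rightarrow> complex^'r) \<Rightarrow>
   complex^'n \<Rightarrow> complex^'r \<Rightarrow> complex^'n \<Rightarrow> complex^'r \<Rightarrow> complex" where
  "tensor_of_curvature h \<Theta> = (\<lambda>\<xi> u \<eta> v. (h (\<Theta> \<xi> (\<i> *s \<eta>) u) v - \<i> * h (\<Theta> \<xi> \<eta> u) v) / 2)"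

definition first_chern_form ::
  "(complex^'n \<Rightarrow> complex^'n \<Rightarrow> complex^'r \<Rightarrow> complex^'r) \<Rightarrow> (complex^'n) form" where
  "first_chern_form \<Theta> = (\<lambda>v. trace (matrix (\<Theta> (v 0) (v 1))))"

end

theory Submission
  imports Defs "Jordan_Normal_Form.Determinant"
begin

text \<open>
  Polynomials in the coordinates of \<open>u\<close> and their conjugates are integrated over the sphere by
  invariance alone. Differentiating the invariance under the reflections
  \<open>u \<mapsto> u + (\<zeta> - 1) h u w w\<close> at \<open>\<zeta> = 1\<close> and polarising in \<open>w\<close> gives a recursion for the moments,
  whose solution is the permanent
  $\int\prod_a\ell_a\prod_b\overline{m_b}\,d\mu=\frac{(r-1)!}{(p+r-1)!}\,
  \mathrm{per}\,(\langle\ell_a,m_b\rangle)$. Cauchy-Schwarz bounds it by $p!$ times the product of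
  the norms, and in the case \<open>m = \<ell>\<close> it is at least the product of the squared norms, because
  multiplication by a linear form is a creation operator. Part (a) follows by expanding the
  strongly semi-positive tensors.

  For part (b), restrict to a \<open>q\<close>-dimensional subspace and choose a basis \<open>f\<close> of it that is
  orthogonal for the trace. Hadamard's inequality bounds $\langle\theta(u),u\rangle^q$ by the product of
  the \<open>\<theta> f\<^sub>j u f\<^sub>j u\<close>, with equality for the trace, and each of these is a sum of squares of
  linear forms in \<open>u\<close>, so that the bound for products of linear forms applies.
\<close>

section \<open>Semi-positive hermitian forms\<close>

text \<open>The permanent is never formed: both bounds are inductions on the recursion \<open>(card
  A + r - 1) M(A, C) = \<Sum>b. <l_a0, m_b> M(A - {a0}, C - {b})\<close>. Dividing by
  \<open>r, r + 1, ..., p + r - 1\<close> produces \<open>(r - 1)! / (p + r - 1)!\<close>, and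
  \<open>p!\<close> counts the terms met on the way down. For \<open>m = l\<close> the term
  \<open>b = a0\<close> alone gives the lower bound; the other terms have no sign individually, and
  only their sum is nonnegative, which takes a second use of the recursion. Traces enter because the
  sum of |\<psi>(e)|^2 over an orthonormal basis is |\<psi>|^2, so that |\<alpha> \<otimes>
  \<psi>|^2 has trace |\<psi>|^2 times the elementary form of \<alpha>. A Griffiths semi-positive
  tensor need not be a sum of such squares; it is only a sum of squares in E for each fixed vector
  of T. Hadamard's inequality reduces (b) to that situation, and it works in one direction only. For
  bundles it remains to see that the Chern curvature is a hermitian tensor, which rests on the
  symmetry of the second derivatives of the metric.\<close>

lemma complex_functional_iff:
  assumes "vector_space s"
  shows "complex_functional s f \<longleftrightarrow> (\<forall>x y. f (x + y) = f x + f y) \<and> (\<forall>c x. f (s c x) = c * f x)"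
  using assms vector_space_over_itself.vector_space_axioms[where 'a = complex]
  by (simp add: Vector_Spaces.linear_iff)

lemma complex_functionalD:
  assumes "complex_functional s f"
  shows "f (x + y) = f x + f y" "f (s c x) = c * f x" "f 0 = 0" "f (x - y) = f x - f y"
    "f (- x) = - f x" "f (\<Sum>i\<in>I. g i) = (\<Sum>i\<in>I. f (g i))"
proof -
  interpret Vector_Spaces.linear s "(*)" f by fact
  show "f (x + y) = f x + f y" "f (s c x) = c * f x" "f 0 = 0" "f (x - y) = f x - f y"
    "f (- x) = - f x" "f (\<Sum>i\<in>I. g i) = (\<Sum>i\<in>I. f (g i))"
    by (auto simp: add scale zero diff neg sum)
qed

lemma hermitian_formD:
  assumes "hermitian_form s H"
  shows "H (x + y) z = H x z + H y z" "H (s c x) z = c * H x z" "H 0 z = 0" "H (x - y) z = H x z - H y z"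
    "H (\<Sum>i\<in>I. g i) z = (\<Sum>i\<in>I. H (g i) z)"
    "H z (x + y) = H z x + H z y" "H z (s c x) = cnj c * H z x" "H z 0 = 0" "H z (x - y) = H z x - H z y"
    "H z (\<Sum>i\<in>I. g i) = (\<Sum>i\<in>I. H z (g i))"
    "H x z = cnj (H z x)" "Im (H x x) = 0"
proof -
  have l: "complex_functional s (\<lambda>u. H u v)" and c: "H v u = cnj (H u v)" for u v
    using assms unfolding hermitian_form_def by blast+
  show left: "H (x + y) z = H x z + H y z" "H (s c x) z = c * H x z" "H 0 z = 0" "H (x - y) z = H x z - H y z"
    "H (\<Sum>i\<in>I. g i) z = (\<Sum>i\<in>I. H (g i) z)"
    using complex_functionalD[OF l[of z]] by auto
  show "H z (x + y) = H z x + H z y" "H z (s c x) = cnj c * H z x" "H z 0 = 0" "H z (x - y) = H z x - H z y"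
    "H z (\<Sum>i\<in>I. g i) = (\<Sum>i\<in>I. H z (g i))"
    unfolding c[of z] by (simp_all add: complex_functionalD[OF l[of z]])
  show "H x z = cnj (H z x)" by (rule c)
  show "Im (H x x) = 0"
    using c[of x x] by (simp add: complex_eq_iff)
qed

lemma hermitian_form_add:
  assumes "hermitian_form s H" "hermitian_form s K"
  shows "hermitian_form s (\<lambda>u v. H u v + K u v)"
proof -
  have vs: "vector_space s"
    using assms(1) unfolding hermitian_form_def Vector_Spaces.linear_def by blast
  have c: "H v u + K v u = cnj (H u v + K u v)" for u v
    using hermitian_formD(11)[OF assms(1), of v u] hermitian_formD(11)[OF assms(2), of v u] by simp
  show ?thesis
    unfolding hermitian_form_def complex_functional_iff[OF vs]
    by (intro conjI allI c)
      (simp_all add: hermitian_formD(1,2)[OF assms(1)] hermitian_formD(1,2)[OF assms(2)] algebra_simps)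
qed

lemma hermitian_form_diff:
  assumes "hermitian_form s H" "hermitian_form s K"
  shows "hermitian_form s (\<lambda>u v. H u v - K u v)"
proof -
  have vs: "vector_space s"
    using assms(1) unfolding hermitian_form_def Vector_Spaces.linear_def by blast
  have c: "H v u - K v u = cnj (H u v - K u v)" for u v
    using hermitian_formD(11)[OF assms(1), of v u] hermitian_formD(11)[OF assms(2), of v u] by simp
  show ?thesis
    unfolding hermitian_form_def complex_functional_iff[OF vs]
    by (intro conjI allI c)
      (simp_all add: hermitian_formD(1,2)[OF assms(1)] hermitian_formD(1,2)[OF assms(2)] algebra_simps)
qed

lemma hermitian_form_rank_one:
  assumes "complex_functional s \<beta>" "c \<in> \<real>"
  shows "hermitian_form s (\<lambda>u v. c * (\<beta> u * cnj (\<beta> v)))"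
proof -
  have vs: "vector_space s"
    using assms(1) unfolding Vector_Spaces.linear_def by blast
  have "cnj c = c" using assms(2) by (rule Reals_cnj_iff[THEN iffD1])
  then show ?thesis
    unfolding hermitian_form_def complex_functional_iff[OF vs]
    using complex_functionalD[OF assms(1)] by (auto simp: algebra_simps)
qed

lemma hermitian_form_sum_list:
  assumes "vector_space s" "\<And>x. x \<in> set xs \<Longrightarrow> hermitian_form s (H x)"
  shows "hermitian_form s (\<lambda>u v. \<Sum>x\<leftarrow>xs. H x u v)"
  using assms(2)
proof (induction xs)
  case Nil
  then show ?case
    by (simp add: hermitian_form_def complex_functional_iff[OF assms(1)])
next
  case (Cons x xs)
  then show ?case
    using hermitian_form_add[of s "H x" "\<lambda>u v. \<Sum>x\<leftarrow>xs. H x u v"] by simp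
qed

text \<open>Polarisation: replacing \<open>v\<close> by \<open>\<i> v\<close> separates \<open>S u v\<close> from \<open>S v u\<close>.\<close>

lemma sesquilinear_eq_zero:
  assumes "\<And>v. complex_functional s (\<lambda>u. S u v)" "\<And>u. complex_functional s (\<lambda>v. cnj (S u v))"
    and diag: "\<And>u. S u u = 0"
  shows "S u v = 0"
proof -
  note l = complex_functionalD[OF assms(1)] 
  have r: "S x (y + z) = S x y + S x z" "S x (s c y) = cnj c * S x y" for x y z c
    using complex_functionalD(1,2)[OF assms(2)[of x]]
    by (metis complex_cnj_add complex_cnj_cnj, metis complex_cnj_mult complex_cnj_cnj)
  have "S (u + v) (u + v) = S u u + S v v + (S u v + S v u)"
    by (simp add: l r)
  then have 1: "S u v + S v u = 0"
    by (simp add: diag)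
  have "S (u + s \<i> v) (u + s \<i> v) = S u u + S v v + (- \<i> * S u v + \<i> * S v u)"
    by (simp add: l r algebra_simps)
  then have "- \<i> * S u v + \<i> * S v u = 0"
    by (simp add: diag)
  then have "S v u = S u v"
    by (simp add: algebra_simps)
  with 1 show ?thesis by simp
qed

lemma hermitian_form_eqI:
  assumes "hermitian_form s H" "hermitian_form s K" "\<And>u. H u u = K u u"
  shows "H u v = K u v"
proof -
  have D: "hermitian_form s (\<lambda>u v. H u v - K u v)"
    by (rule hermitian_form_diff[OF assms(1,2)])
  have "H u v - K u v = 0"
  proof (rule sesquilinear_eq_zero[where s = s and S = "\<lambda>u v. H u v - K u v"])
    show "complex_functional s (\<lambda>u. H u v - K u v)" for v
      using D unfolding hermitian_form_def by blast
    have "(\<lambda>v. cnj (H u v - K u v)) = (\<lambda>v. H v u - K v u)" for u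
      using D unfolding hermitian_form_def by auto
    then show "complex_functional s (\<lambda>v. cnj (H u v - K u v))" for u
      using D unfolding hermitian_form_def by metis
  qed (simp add: assms(3))
  then show ?thesis by simp
qed

section \<open>Cauchy-Schwarz, Cholesky and Gram-Schmidt for possibly degenerate forms\<close>

definition semipositive_form :: "(complex \<Rightarrow> 'a \<Rightarrow> 'a::ab_group_add) \<Rightarrow> ('a \<Rightarrow> 'a \<Rightarrow> complex) \<Rightarrow> bool" where
  "semipositive_form s H \<longleftrightarrow> hermitian_form s H \<and> (\<forall>u. 0 \<le> Re (H u u))"

lemma hermitian_structure_semipositive: "hermitian_structure s h \<Longrightarrow> semipositive_form s h"
  unfolding hermitian_structure_def semipositive_form_def
  by (metis hermitian_formD(3) less_eq_real_def zero_complex.sel(1))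

lemma semipositive_form_diag:
  assumes "semipositive_form s H"
  shows "H u u = of_real (Re (H u u))" "0 \<le> Re (H u u)"
  using assms hermitian_formD(12)[of s H u]
  by (auto simp: semipositive_form_def complex_eq_iff)

text \<open>The form may be degenerate, so minimising over the real parameter \<open>t\<close>
  splits into two cases: if \<open>H v v = 0\<close>, the expression is affine in \<open>t\<close>
  and bounded below, which forces \<open>H u v = 0\<close>.\<close>

lemma semipositive_cauchy_schwarz:
  assumes "semipositive_form s H"
  shows "(cmod (H u v))\<^sup>2 \<le> Re (H u u) * Re (H v v)"
proof -
  have H: "hermitian_form s H" and pos: "\<And>w. 0 \<le> Re (H w w)"
    using assms by (auto simp: semipositive_form_def)
  note D = hermitian_formD[OF H]
  have c: "H v u = cnj (H u v)" by (rule D(11))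
  have expand: "Re (H (u - s (of_real t * H u v) v) (u - s (of_real t * H u v) v)) =
      Re (H u u) - 2 * t * (cmod (H u v))\<^sup>2 + t\<^sup>2 * (cmod (H u v))\<^sup>2 * Re (H v v)" for t
  proof -
    have "H (u - s (of_real t * H u v) v) (u - s (of_real t * H u v) v) =
        H u u - of_real (2 * t) * (H u v * cnj (H u v)) + of_real (t\<^sup>2) * (H u v * cnj (H u v)) * H v v"
      by (simp add: D(1,2,4,6,7,9) c algebra_simps power2_eq_square)
    also have "\<dots> = H u u - of_real (2 * t * (cmod (H u v))\<^sup>2) + of_real (t\<^sup>2 * (cmod (H u v))\<^sup>2) * H v v"
      by (simp add: complex_norm_square[symmetric])
    finally show ?thesis by (simp del: of_real_mult)
  qed
  show ?thesis
  proof (cases "Re (H v v) = 0")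
    case True
    have "cmod (H u v) = 0"
    proof (rule ccontr)
      assume "cmod (H u v) \<noteq> 0"
      then have "0 < (cmod (H u v))\<^sup>2" by simp
      \<comment> \<open>This \<open>t\<close> makes the affine expression equal to
        \<open>- Re (H u u) - 2\<close>, which is negative.\<close>
      moreover have "0 \<le> Re (H u u) - 2 * ((Re (H u u) + 1) / (cmod (H u v))\<^sup>2) * (cmod (H u v))\<^sup>2"
        using pos expand[of "(Re (H u u) + 1) / (cmod (H u v))\<^sup>2"] True by (metis add.right_neutral mult_zero_right)
      ultimately have "0 \<le> Re (H u u) - 2 * (Re (H u u) + 1)"
        by simp
      then show False using pos[of u] by simp
    qed
    then show ?thesis using True by simp
  next
    case False
    then have p: "0 < Re (H v v)" using pos[of v] by simp
    \<comment> \<open>The minimiser is \<open>t = 1 / Re (H v v)\<close>.\<close>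
    have "0 \<le> Re (H u u) - 2 * (1 / Re (H v v)) * (cmod (H u v))\<^sup>2
        + (1 / Re (H v v))\<^sup>2 * (cmod (H u v))\<^sup>2 * Re (H v v)"
      using pos expand[of "1 / Re (H v v)"] by metis
    also have "\<dots> = Re (H u u) - (cmod (H u v))\<^sup>2 / Re (H v v)"
      using p by (simp add: field_simps power2_eq_square)
    finally show ?thesis using p by (simp add: field_simps)
  qed
qed

lemma semipositive_null:
  assumes "semipositive_form s H" "H u u = 0"
  shows "H u v = 0" "H v u = 0"
proof -
  show "H u v = 0"
    using semipositive_cauchy_schwarz[OF assms(1), of u v] assms(2) by simp
  then show "H v u = 0"
    using assms(1) hermitian_formD(11)[of s H v u] by (simp add: semipositive_form_def)
qed

text \<open>Completing the square along \<open>e\<close>, one step of Cholesky's decomposition. The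
  remainder annihilates \<open>e\<close> by construction and stays semi-positive by
  Cauchy-Schwarz.\<close>

lemma semipositive_split:
  assumes H: "semipositive_form s H"
  obtains \<beta> R where "complex_functional s \<beta>" "semipositive_form s R"
    "\<And>u v. H u v = \<beta> u * cnj (\<beta> v) + R u v" "\<And>v. R e v = 0"
proof -
  have herm: "hermitian_form s H"
    using H by (simp add: semipositive_form_def)
  have vs: "vector_space s"
    using herm unfolding hermitian_form_def Vector_Spaces.linear_def by blast
  note D = hermitian_formD[OF herm]
  define a where "a = Re (H e e)"
  have a: "0 \<le> a" "H e e = of_real a"
    using semipositive_form_diag[OF H, of e] by (simp_all add: a_def)
  \<comment> \<open>For \<open>a = 0\<close> division by zero makes \<open>\<beta> = 0\<close>; this
    is the right value, since \<open>e\<close> is then already in the kernel of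
    \<open>H\<close>.\<close>
  define \<beta> where "\<beta> u = of_real (1 / sqrt a) * H u e" for u
  have \<beta>: "complex_functional s \<beta>"
    unfolding complex_functional_iff[OF vs] \<beta>_def by (simp add: D(1,2) algebra_simps)
  have bb: "\<beta> u * cnj (\<beta> v) = H u e * H e v / of_real a" for u v
  proof -
    have "\<beta> u * cnj (\<beta> v) = of_real (1 / sqrt a * (1 / sqrt a)) * (H u e * H e v)"
      unfolding \<beta>_def D(11)[of e v] of_real_mult complex_cnj_mult complex_cnj_complex_of_real
      by (simp only: ac_simps)
    also have "1 / sqrt a * (1 / sqrt a) = 1 / a" using a by simp
    finally show ?thesis by simp
  qed
  define R where "R u v = H u v - \<beta> u * cnj (\<beta> v)" for u v
  have "hermitian_form s R"
    unfolding R_def using hermitian_form_diff[OF herm hermitian_form_rank_one[OF \<beta>, of 1]] by simp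
  moreover have "0 \<le> Re (R u u)" for u
  proof (cases "a = 0")
    case True
    then show ?thesis using bb[of u u] semipositive_form_diag(2)[OF H, of u] by (simp add: R_def)
  next
    case False
    have "H u e * H e u = of_real ((cmod (H u e))\<^sup>2)"
      using D(11)[of e u] by (simp only: complex_norm_square)
    then have "R u u = H u u - of_real ((cmod (H u e))\<^sup>2 / a)"
      unfolding R_def bb by (simp only: of_real_divide)
    then have "Re (R u u) = Re (H u u) - (cmod (H u e))\<^sup>2 / a"
      by (simp only: minus_complex.sel Re_complex_of_real)
    moreover have "(cmod (H u e))\<^sup>2 / a \<le> Re (H u u)"
      using semipositive_cauchy_schwarz[OF H, of u e] False a by (simp add: divide_le_eq a_def[symmetric])
    ultimately show ?thesis by simp
  qed
  ultimately have "semipositive_form s R" by (simp add: semipositive_form_def)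
  moreover have "R e v = 0" for v
    using a semipositive_null(1)[OF H, of e v] by (cases "a = 0") (simp_all add: R_def bb)
  ultimately show thesis
    using that[of \<beta> R] \<beta> by (simp add: R_def)
qed

text \<open>The remainder \<open>R\<close> allows for vectors \<open>es\<close> that do not span.\<close>

lemma semipositive_cholesky:
  assumes "semipositive_form s H"
  obtains \<beta>s R where "length \<beta>s = length es" "\<And>\<beta>. \<beta> \<in> set \<beta>s \<Longrightarrow> complex_functional s \<beta>"
    "semipositive_form s R" "\<And>u v. H u v = (\<Sum>\<beta>\<leftarrow>\<beta>s. \<beta> u * cnj (\<beta> v)) + R u v"
    "\<And>i j. i < j \<Longrightarrow> j < length es \<Longrightarrow> (\<beta>s ! j) (es ! i) = 0" "\<And>e v. e \<in> set es \<Longrightarrow> R e v = 0"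
  using assms
proof (induction es arbitrary: H thesis)
  case Nil
  show ?case by (rule Nil(1)[of "[]" H]) (auto simp: Nil(2))
next
  case (Cons e es)
  obtain \<beta> R where 1: "complex_functional s \<beta>" "semipositive_form s R"
    "\<And>u v. H u v = \<beta> u * cnj (\<beta> v) + R u v" "\<And>v. R e v = 0"
    using semipositive_split[OF Cons.prems(2), of e] by blast
  obtain \<beta>s R' where 2: "length \<beta>s = length es" "\<And>\<beta>. \<beta> \<in> set \<beta>s \<Longrightarrow> complex_functional s \<beta>"
    "semipositive_form s R'" "\<And>u v. R u v = (\<Sum>\<beta>\<leftarrow>\<beta>s. \<beta> u * cnj (\<beta> v)) + R' u v"
    "\<And>i j. i < j \<Longrightarrow> j < length es \<Longrightarrow> (\<beta>s ! j) (es ! i) = 0" "\<And>e v. e \<in> set es \<Longrightarrow> R' e v = 0"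
    using Cons.IH[OF _ 1(2)] by blast
  \<comment> \<open>Evaluating the decomposition of \<open>R\<close> at \<open>e\<close>, where
    \<open>R\<close> vanishes, gives nonnegative terms with sum 0. So all later functionals and the
    final remainder vanish at \<open>e\<close>, which is the triangularity.\<close>
  have "(\<Sum>\<beta>\<leftarrow>\<beta>s. (cmod (\<beta> e))\<^sup>2) + Re (R' e e) = Re (R e e)"
    unfolding 2(4) by (induction \<beta>s) (simp_all add: complex_mult_cnj cmod_power2)
  then have z: "(\<Sum>\<beta>\<leftarrow>\<beta>s. (cmod (\<beta> e))\<^sup>2) + Re (R' e e) = 0"
    by (simp add: 1(4))
  have p: "0 \<le> (\<Sum>\<beta>\<leftarrow>\<beta>s. (cmod (\<beta> e))\<^sup>2)"
    by (rule sum_list_nonneg) auto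
  have R'0: "Re (R' e e) = 0" and S0: "(\<Sum>\<beta>\<leftarrow>\<beta>s. (cmod (\<beta> e))\<^sup>2) = 0"
    using z p semipositive_form_diag(2)[OF 2(3), of e] by linarith+
  have \<beta>e: "\<beta> e = 0" if "\<beta> \<in> set \<beta>s" for \<beta>
    using S0 that by (subst (asm) sum_list_nonneg_eq_0_iff) auto
  have R'e: "R' e v = 0" for v
    using semipositive_null(1)[OF 2(3)] semipositive_form_diag(1)[OF 2(3), of e] R'0 by simp
  show ?case
  proof (rule Cons.prems(1)[of "\<beta> # \<beta>s" R'])
    show "((\<beta> # \<beta>s) ! j) ((e # es) ! i) = 0" if "i < j" "j < length (e # es)" for i j
      using that 2(1,5) \<beta>e by (cases j; cases i) auto
    show "H u v = (\<Sum>\<beta>\<leftarrow>\<beta> # \<beta>s. \<beta> u * cnj (\<beta> v)) + R' u v" for u v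
      by (simp add: 1(3) 2(4))
    show "R' x v = 0" if "x \<in> set (e # es)" for x v
      using that R'e 2(6) by auto
    show "complex_functional s b" if "b \<in> set (\<beta> # \<beta>s)" for b
      using that 1(1) 2(2) by auto
  qed (simp_all add: 2(1,3))
qed

text \<open>Nothing is normalised, so that null vectors are allowed: by Cauchy-Schwarz they are
  orthogonal to everything, and their coefficient \<open>0 / 0 = 0\<close> drops out. The change
  from \<open>fs\<close> to \<open>es\<close> is unitriangular and hence has determinant 1.\<close>

lemma semipositive_gram_schmidt:
  assumes H: "semipositive_form s H"
  obtains fs c where "length fs = length es"
    "\<And>j. j < length es \<Longrightarrow> es ! j = fs ! j + (\<Sum>k<j. s (c k j) (fs ! k))"
    "\<And>i j. i < length es \<Longrightarrow> j < length es \<Longrightarrow> i \<noteq> j \<Longrightarrow> H (fs ! i) (fs ! j) = 0"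
proof (induction es arbitrary: thesis rule: rev_induct)
  case Nil
  then show ?case by simp
next
  case (snoc e es)
  obtain fs c where IH: "length fs = length es"
    "\<And>j. j < length es \<Longrightarrow> es ! j = fs ! j + (\<Sum>k<j. s (c k j) (fs ! k))"
    "\<And>i j. i < length es \<Longrightarrow> j < length es \<Longrightarrow> i \<noteq> j \<Longrightarrow> H (fs ! i) (fs ! j) = 0"
    using snoc.IH by blast
  define d where "d k = H e (fs ! k) / H (fs ! k) (fs ! k)" for k
  define f where "f = e - (\<Sum>k<length es. s (d k) (fs ! k))"
  define c' where "c' k j = (if j = length es then d k else c k j)" for k j
  have herm: "hermitian_form s H"
    using H by (simp add: semipositive_form_def)
  note D = hermitian_formD[OF herm]
  have orth: "H f (fs ! j) = 0" if "j < length es" for j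
  proof -
    have "H f (fs ! j) = H e (fs ! j) - (\<Sum>k<length es. d k * H (fs ! k) (fs ! j))"
      by (simp add: f_def D(2,4,5))
    also have "(\<Sum>k<length es. d k * H (fs ! k) (fs ! j)) = d j * H (fs ! j) (fs ! j)"
      using that IH(3) by (subst sum.remove[of _ j]) auto
    also have "\<dots> = H e (fs ! j)"
      using semipositive_null(2)[OF H, of "fs ! j" e] by (cases "H (fs ! j) (fs ! j) = 0") (auto simp: d_def)
    finally show ?thesis by simp
  qed
  have orth': "H (fs ! j) f = 0" if "j < length es" for j
    using orth[OF that] D(11)[of "fs ! j" f] by simp
  show ?case
  proof (rule snoc.prems[of "fs @ [f]" c'])
    show "(es @ [e]) ! j = (fs @ [f]) ! j + (\<Sum>k<j. s (c' k j) ((fs @ [f]) ! k))"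
      if "j < length (es @ [e])" for j
    proof (cases "j = length es")
      case True
      then show ?thesis
        using IH(1) by (auto simp: nth_append c'_def f_def)
    next
      case False
      then have j: "j < length es" using that by simp
      then have "(\<Sum>k<j. s (c' k j) ((fs @ [f]) ! k)) = (\<Sum>k<j. s (c k j) (fs ! k))"
        using IH(1) by (intro sum.cong) (auto simp: nth_append c'_def)
      then show ?thesis using j IH(1,2) by (simp add: nth_append)
    qed
    show "H ((fs @ [f]) ! i) ((fs @ [f]) ! j) = 0"
      if "i < length (es @ [e])" "j < length (es @ [e])" "i \<noteq> j" for i j
      using that IH orth orth' by (auto simp: nth_append less_Suc_eq)
  qed (use IH(1) in auto)
qed

lemma orthonormal_set_independent:
  assumes vs: "vector_space s" and h: "hermitian_form s h"
    and on: "\<And>e f. e \<in> B \<Longrightarrow> f \<in> B \<Longrightarrow> h e f = (if e = f then 1 else 0)"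
  shows "\<not> module.dependent s B"
proof -
  interpret vector_space s by fact
  show ?thesis
    unfolding independent_explicit_finite_subsets
  proof (intro allI impI ballI)
    fix S u v
    assume S: "S \<subseteq> B" "finite S" "(\<Sum>v\<in>S. s (u v) v) = 0" "v \<in> S"
    have "0 = h (\<Sum>v\<in>S. s (u v) v) v"
      using S(3) hermitian_formD(3)[OF h] by simp
    also have "\<dots> = (\<Sum>w\<in>S. u w * h w v)"
      by (simp add: hermitian_formD(2,5)[OF h])
    also have "\<dots> = (\<Sum>w\<in>S. if w = v then u w else 0)"
      by (intro sum.cong) (use S on in \<open>auto simp: subset_iff\<close>)
    also have "\<dots> = u v" using S by simp
    finally show "u v = 0" by simp
  qed
qed

lemma exists_orthonormal_basis:
  assumes fin: "finite_dimensional_vector_space s B0" and h: "hermitian_structure s h"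
  obtains B where "orthonormal_basis s h B"
proof -
  interpret finite_dimensional_vector_space s B0 by fact
  have pos: "semipositive_form s h" and herm: "hermitian_form s h"
    and def: "\<And>u. u \<noteq> 0 \<Longrightarrow> Re (h u u) > 0"
    using h hermitian_structure_semipositive by (auto simp: hermitian_structure_def)
  obtain es where es: "set es = B0" using finite_Basis finite_list by blast
  obtain fs c where fs: "length fs = length es"
    "\<And>j. j < length es \<Longrightarrow> es ! j = fs ! j + (\<Sum>k<j. s (c k j) (fs ! k))"
    "\<And>i j. i < length es \<Longrightarrow> j < length es \<Longrightarrow> i \<noteq> j \<Longrightarrow> h (fs ! i) (fs ! j) = 0"
    using semipositive_gram_schmidt[OF pos] by blast
  define N where "N f = s (of_real (1 / hnorm h f)) f" for f
  \<comment> \<open>As a set of normalised nonzero vectors, \<open>B\<close> is orthonormal without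
    any discussion of zeros or repetitions in \<open>fs\<close>, and it has the same span.\<close>
  define B where "B = N ` (set fs - {0})"
  have NN: "h (N f) (N f) = 1" if "f \<noteq> 0" for f
  proof -
    have p: "Re (h f f) > 0" using def[OF that] .
    have "h (N f) (N f) = of_real (1 / hnorm h f) * of_real (1 / hnorm h f) * h f f"
      by (simp add: N_def hermitian_formD(2,7)[OF herm])
    also have "\<dots> = of_real (1 / hnorm h f * (1 / hnorm h f) * Re (h f f))"
      using semipositive_form_diag(1)[OF pos, of f] by simp
    also have "1 / hnorm h f * (1 / hnorm h f) * Re (h f f) = 1"
      using p by (simp add: hnorm_def)
    finally show ?thesis by simp
  qed
  have Nij: "h (N f) (N g) = 0" if "f \<in> set fs" "g \<in> set fs" "f \<noteq> g" for f g
  proof -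
    have "h f g = 0"
      using that fs(1,3) by (metis in_set_conv_nth)
    then show ?thesis by (simp add: N_def hermitian_formD(2,7)[OF herm])
  qed
  have on: "h e f = (if e = f then 1 else 0)" if "e \<in> B" "f \<in> B" for e f
  proof -
    obtain f' g' where "e = N f'" "f' \<in> set fs" "f' \<noteq> 0" "f = N g'" "g' \<in> set fs" "g' \<noteq> 0"
      using \<open>e \<in> B\<close> \<open>f \<in> B\<close> unfolding B_def by blast
    then show ?thesis
      using NN[of f'] Nij[of f' g'] by (cases "f' = g'") auto
  qed
  have "fs ! k \<in> span B" if k: "k < length fs" for k
  proof (cases "fs ! k = 0")
    case False
    then have "N (fs ! k) \<in> B" using k by (simp add: B_def)
    moreover have "fs ! k = s (of_real (hnorm h (fs ! k))) (N (fs ! k))"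
      using def[OF False] by (simp add: N_def hnorm_def flip: of_real_mult)
    ultimately show ?thesis by (metis span_base span_scale)
  qed (simp add: span_zero)
  then have "es ! j \<in> span B" if "j < length es" for j
    unfolding fs(2)[OF that] using that fs(1) by (intro span_add span_sum span_scale) auto
  then have "B0 \<subseteq> span B" by (auto simp: es[symmetric] in_set_conv_nth)
  then have "span B = UNIV" using span_Basis span_mono span_span by (metis top.extremum_uniqueI)
  moreover have "independent B"
    by (rule orthonormal_set_independent[OF vector_space_axioms herm on])
  moreover have "finite B" by (simp add: B_def)
  ultimately have "finite_dimensional_vector_space s B"
    by unfold_locales
  then show thesis using that[of B] on by (simp add: orthonormal_basis_def)
qed

section \<open>Wedge products\<close>

lemma wedge_sum_list_left: "wedge p q (\<lambda>v. \<Sum>x\<leftarrow>xs. a x v) b = (\<lambda>v. \<Sum>x\<leftarrow>xs. wedge p q (a x) b v)"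
  by (induction xs)
    (simp_all add: wedge_def fun_eq_iff sum.distrib add_divide_distrib ring_distribs)

lemma wedge_sum_list_right: "wedge p q a (\<lambda>v. \<Sum>x\<leftarrow>xs. b x v) = (\<lambda>v. \<Sum>x\<leftarrow>xs. wedge p q a (b x) v)"
  by (induction xs)
    (simp_all add: wedge_def fun_eq_iff sum.distrib add_divide_distrib ring_distribs)

lemma wedge_scale: "wedge p q (\<lambda>v. c * a v) (\<lambda>v. d * b v) = (\<lambda>v. c * d * wedge p q a b v)"
  by (simp add: wedge_def fun_eq_iff sum_distrib_left algebra_simps)

lemma length_in_product_lists: "xs \<in> set (product_lists Fs) \<Longrightarrow> length xs = length Fs"
  by (induction Fs arbitrary: xs) auto

lemma in_product_listsD: "xs \<in> set (product_lists Fs) \<Longrightarrow> i < length Fs \<Longrightarrow> xs ! i \<in> set (Fs ! i)"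
proof (induction Fs arbitrary: xs i)
  case (Cons F Fs)
  then show ?case by (cases i) auto
qed simp

lemma sum_list_concat_map: "(\<Sum>x\<leftarrow>concat (map f xs). g x) = (\<Sum>x\<leftarrow>xs. \<Sum>y\<leftarrow>f x. (g y :: 'a::comm_monoid_add))"
  by (induction xs) auto

text \<open>Distributivity in every factor at once; \<open>product_lists\<close> runs through the
  choices of one summand per factor.\<close>

lemma wedge_list_expand:
  "wedge_list (map (\<lambda>F v. \<Sum>x\<leftarrow>F. c x * w x v) Fs) =
     (\<lambda>v. \<Sum>xs\<leftarrow>product_lists Fs. prod_list (map c xs) * wedge_list (map w xs) v)"
proof (induction Fs)
  case (Cons F Fs)
  have "wedge_list (map (\<lambda>F v. \<Sum>x\<leftarrow>F. c x * w x v) (F # Fs)) =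
      wedge 2 (2 * length Fs) (\<lambda>v. \<Sum>x\<leftarrow>F. c x * w x v)
        (\<lambda>v. \<Sum>xs\<leftarrow>product_lists Fs. prod_list (map c xs) * wedge_list (map w xs) v)"
    by (simp add: Cons)
  also have "\<dots> = (\<lambda>v. \<Sum>x\<leftarrow>F. \<Sum>xs\<leftarrow>product_lists Fs. c x * prod_list (map c xs) *
      wedge 2 (2 * length Fs) (w x) (wedge_list (map w xs)) v)"
    by (simp add: wedge_sum_list_left wedge_sum_list_right wedge_scale)
  also have "\<dots> = (\<lambda>v. \<Sum>x\<leftarrow>F. \<Sum>xs\<leftarrow>product_lists Fs. prod_list (map c (x # xs)) *
      wedge_list (map w (x # xs)) v)"
    by (intro ext arg_cong[where f = sum_list] map_cong refl) (auto dest: length_in_product_lists)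
  finally show ?case
    by (simp add: sum_list_concat_map o_def)
qed simp

lemma prod_list_expand:
  "(\<Prod>F\<leftarrow>Fs. \<Sum>x\<leftarrow>F. c x) = (\<Sum>xs\<leftarrow>product_lists Fs. prod_list (map c xs) :: 'a::comm_semiring_1)"
proof (induction Fs)
  case (Cons F Fs)
  then show ?case
    by (simp add: sum_list_concat_map o_def sum_list_mult_const sum_list_const_mult)
qed simp

text \<open>A value of the product evaluates the factors on the given vectors only. This allows a
  hermitian form to be replaced by its Cholesky sum on frames that lie in the kernel
  \<open>Z\<close> of the remainder.\<close>

lemma wedge_list_cong_on:
  assumes "length ws = length ws'" "\<And>i. i < 2 * length ws \<Longrightarrow> v i \<in> Z"
    "\<And>j w. j < length ws \<Longrightarrow> w 0 \<in> Z \<Longrightarrow> w 1 \<in> Z \<Longrightarrow> (ws ! j) w = (ws' ! j) w"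
  shows "wedge_list ws v = wedge_list ws' v"
  using assms
proof (induction ws ws' arbitrary: v rule: list_induct2)
  case (Cons a ws a' ws')
  have "a (\<lambda>i. v (\<sigma> i)) = a' (\<lambda>i. v (\<sigma> i)) \<and>
      wedge_list ws (\<lambda>i. v (\<sigma> (2 + i))) = wedge_list ws' (\<lambda>i. v (\<sigma> (2 + i)))"
    if "\<sigma> permutes {..<2 + 2 * length ws}" for \<sigma>
  proof
    have in_Z: "v (\<sigma> i) \<in> Z" if "i < 2 + 2 * length ws" for i
      using permutes_in_image[OF \<open>\<sigma> permutes _\<close>, of i] that Cons.prems(1)[of "\<sigma> i"] by simp
    show "a (\<lambda>i. v (\<sigma> i)) = a' (\<lambda>i. v (\<sigma> i))"
      using Cons.prems(2)[of 0 "\<lambda>i. v (\<sigma> i)"] in_Z by simp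
    show "wedge_list ws (\<lambda>i. v (\<sigma> (2 + i))) = wedge_list ws' (\<lambda>i. v (\<sigma> (2 + i)))"
    proof (rule Cons.IH)
      show "(ws ! j) w = (ws' ! j) w" if "j < length ws" "w 0 \<in> Z" "w 1 \<in> Z" for j w
        using Cons.prems(2)[of "Suc j" w] that by simp
    qed (use in_Z in simp)
  qed
  then show ?case
    using Cons.hyps by (auto simp: wedge_def intro!: sum.cong)
qed simp

section \<open>Products of 1-forms as determinants\<close>

definition wedge_1forms :: "nat \<Rightarrow> (nat \<Rightarrow> 't \<Rightarrow> complex) \<Rightarrow> 't form" where
  "wedge_1forms n \<phi> = (\<lambda>v. \<Sum>\<sigma> | \<sigma> permutes {..<n}. of_int (sign \<sigma>) * (\<Prod>i<n. \<phi> i (v (\<sigma> i))))"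

lemma wedge_1forms_cong: "(\<And>i. i < n \<Longrightarrow> \<phi> i = \<psi> i) \<Longrightarrow> wedge_1forms n \<phi> = wedge_1forms n \<psi>"
  by (simp add: wedge_1forms_def fun_eq_iff)

lemma wedge_1forms_det: "wedge_1forms n \<phi> v = det (mat n n (\<lambda>(i, j). \<phi> i (v j)))"
proof -
  have "(\<Prod>i = 0..<n. mat n n (\<lambda>(i, j). \<phi> i (v j)) $$ (i, \<sigma> i)) = (\<Prod>i<n. \<phi> i (v (\<sigma> i)))"
    if "\<sigma> permutes {0..<n}" for \<sigma>
    using permutes_in_image[OF that] unfolding lessThan_atLeast0 by (intro prod.cong) auto
  then show ?thesis
    unfolding wedge_1forms_def det_def'[OF mat_carrier] lessThan_atLeast0 by (intro sum.cong) auto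
qed

text \<open>Each pair of permutations \<rho>, \<tau> of the two blocks contributes the full Leibniz
  sum, because composing with the block permutation made of \<rho> and \<tau> merely reindexes the
  sum over \<sigma>. There are \<open>p! q!\<close> pairs, which cancels the normalisation of
  \<open>wedge\<close>.\<close>

lemma wedge_1forms_append:
  "wedge p q (wedge_1forms p \<phi>) (wedge_1forms q \<psi>) =
     wedge_1forms (p + q) (\<lambda>i. if i < p then \<phi> i else \<psi> (i - p))"
proof
  fix v
  define \<kappa> where "\<kappa> = (\<lambda>i. if i < p then \<phi> i else \<psi> (i - p))"
  define S where "S n = {\<sigma>. \<sigma> permutes {..<n :: nat}}" for n
  define G where "G \<sigma> = of_int (sign \<sigma>) * (\<Prod>i<p + q. \<kappa> i (v (\<sigma> i)))" for \<sigma>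
  have fin: "finite (S n)" for n
    unfolding S_def by (rule finite_permutations) simp
  have prod_split: "(\<Prod>i<p + q. f i) = (\<Prod>i<p. f i) * (\<Prod>i<q. f (p + i))" for f :: "nat \<Rightarrow> complex"
    by (induction q) (simp_all add: mult.assoc)
  have reindex: "(\<Sum>\<sigma>\<in>S (p + q). of_int (sign \<sigma>) * (of_int (sign \<rho>) * (\<Prod>i<p. \<phi> i (v (\<sigma> (\<rho> i))))) *
      (of_int (sign \<tau>) * (\<Prod>i<q. \<psi> i (v (\<sigma> (p + \<tau> i)))))) = sum G (S (p + q))"
    if \<rho>: "\<rho> \<in> S p" and \<tau>: "\<tau> \<in> S q" for \<rho> \<tau>
  proof -
    \<comment> \<open>The permutation \<tau> is transported to the second block;
      \<open>\<pi>\<close> below is the resulting block permutation.\<close>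
    define \<tau>' where "\<tau>' = map_permutation {..<q} ((+) p) \<tau>"
    have bij: "bij_betw ((+) p) {..<q} {p..<p + q}"
      by (rule bij_betwI[where g = "\<lambda>i. i - p"]) auto
    have \<tau>'_perm: "\<tau>' permutes {p..<p + q}"
      unfolding \<tau>'_def using map_permutation_permutes[OF bij] \<tau> by (simp add: S_def)
    have sign_\<tau>': "sign \<tau>' = sign \<tau>"
      unfolding \<tau>'_def using \<tau> by (intro sign_map_permutation) (auto simp: S_def)
    have \<tau>'_lt: "\<tau>' i = i" if "i < p" for i
      using permutes_not_in[OF \<tau>'_perm] that by simp
    have \<tau>'_ge: "\<tau>' (p + i) = p + \<tau> i" if "i < q" for i
      unfolding \<tau>'_def using that by (intro map_permutation_apply) auto
    have sub: "{p..<p + q} \<subseteq> {..<p + q}"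
      by auto
    have \<rho>_perm: "\<rho> permutes {..<p + q}" and \<tau>'_perm': "\<tau>' permutes {..<p + q}"
      using permutes_subset[of \<rho> "{..<p}" "{..<p + q}"] permutes_subset[OF \<tau>'_perm sub] \<rho>
      by (auto simp: S_def)
    have \<rho>_ge: "\<rho> (p + i) = p + i" for i
      using \<rho> permutes_not_in[of \<rho> "{..<p}" "p + i"] by (simp add: S_def)
    define \<pi> where "\<pi> = \<rho> \<circ> \<tau>'"
    have \<pi>_perm: "\<pi> permutes {..<p + q}"
      unfolding \<pi>_def by (rule permutes_compose[OF \<tau>'_perm' \<rho>_perm])
    have perm: "permutation \<sigma>" if "\<sigma> permutes {..<p + q}" for \<sigma>
      using that by (auto simp: permutation_permutes)
    have sign_\<pi>: "sign \<pi> = sign \<rho> * sign \<tau>"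
      unfolding \<pi>_def using sign_compose[OF perm[OF \<rho>_perm] perm[OF \<tau>'_perm']] sign_\<tau>' by simp
    have \<pi>_lt: "\<pi> i = \<rho> i" if "i < p" for i
      by (simp add: \<pi>_def \<tau>'_lt that)
    have \<tau>_lt: "\<tau> i < q" if "i < q" for i
      using permutes_in_image[of \<tau> "{..<q}" i] \<tau> that by (simp add: S_def)
    have \<pi>_ge: "\<pi> (p + i) = p + \<tau> i" if "i < q" for i
      by (simp add: \<pi>_def \<tau>'_ge that \<rho>_ge)
    have "of_int (sign \<sigma>) * (of_int (sign \<rho>) * (\<Prod>i<p. \<phi> i (v (\<sigma> (\<rho> i))))) *
        (of_int (sign \<tau>) * (\<Prod>i<q. \<psi> i (v (\<sigma> (p + \<tau> i))))) = G (\<sigma> \<circ> \<pi>)"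
      if \<sigma>: "\<sigma> \<in> S (p + q)" for \<sigma>
    proof -
      have "sign (\<sigma> \<circ> \<pi>) = sign \<sigma> * (sign \<rho> * sign \<tau>)"
        using sign_compose[OF perm perm[OF \<pi>_perm], of \<sigma>] \<sigma> sign_\<pi> by (simp add: S_def)
      then show ?thesis
        unfolding G_def prod_split by (simp add: \<kappa>_def \<pi>_lt \<pi>_ge)
    qed
    then have "(\<Sum>\<sigma>\<in>S (p + q). of_int (sign \<sigma>) * (of_int (sign \<rho>) * (\<Prod>i<p. \<phi> i (v (\<sigma> (\<rho> i))))) *
        (of_int (sign \<tau>) * (\<Prod>i<q. \<psi> i (v (\<sigma> (p + \<tau> i)))))) = (\<Sum>\<sigma>\<in>S (p + q). G (\<sigma> \<circ> \<pi>))"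
      by (intro sum.cong) auto
    also have "\<dots> = sum G (S (p + q))"
      unfolding S_def by (rule sum_permutations_compose_right[OF \<pi>_perm, symmetric])
    finally show ?thesis .
  qed
  have "(\<Sum>\<sigma>\<in>S (p + q). of_int (sign \<sigma>) * wedge_1forms p \<phi> (\<lambda>i. v (\<sigma> i)) * wedge_1forms q \<psi> (\<lambda>i. v (\<sigma> (p + i)))) =
      (\<Sum>\<sigma>\<in>S (p + q). \<Sum>\<tau>\<in>S q. \<Sum>\<rho>\<in>S p. of_int (sign \<sigma>) * (of_int (sign \<rho>) * (\<Prod>i<p. \<phi> i (v (\<sigma> (\<rho> i))))) *
      (of_int (sign \<tau>) * (\<Prod>i<q. \<psi> i (v (\<sigma> (p + \<tau> i))))))"
    unfolding wedge_1forms_def S_def by (simp only: sum_distrib_left sum_distrib_right)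
  also have "\<dots> = (\<Sum>\<tau>\<in>S q. \<Sum>\<rho>\<in>S p. \<Sum>\<sigma>\<in>S (p + q). of_int (sign \<sigma>) * (of_int (sign \<rho>) * (\<Prod>i<p. \<phi> i (v (\<sigma> (\<rho> i))))) *
      (of_int (sign \<tau>) * (\<Prod>i<q. \<psi> i (v (\<sigma> (p + \<tau> i))))))"
    \<comment> \<open>The sum over \<sigma> has to be innermost, since it is reindexed for fixed
      \<rho> and \<tau>.\<close>
    by (rule trans[OF sum.swap], rule sum.cong[OF refl], rule sum.swap)
  also have "\<dots> = (\<Sum>\<tau>\<in>S q. \<Sum>\<rho>\<in>S p. sum G (S (p + q)))"
    by (intro sum.cong refl reindex)
  also have "\<dots> = fact p * fact q * sum G (S (p + q))"
    using card_permutations[of "{..<p}" p] card_permutations[of "{..<q}" q] by (simp add: S_def)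
  finally show "wedge p q (wedge_1forms p \<phi>) (wedge_1forms q \<psi>) v = wedge_1forms (p + q) \<kappa> v"
    unfolding wedge_def[of p q] S_def[symmetric] by (simp add: wedge_1forms_def G_def S_def)
qed

lemma wedge_1forms_1: "wedge_1forms 1 \<phi> = (\<lambda>v. \<phi> 0 (v 0))"
proof -
  have "{..<1} = {0 :: nat}" by auto
  then have "{\<sigma>. \<sigma> permutes {..<1 :: nat}} = {id}" by auto
  then show ?thesis by (simp add: wedge_1forms_def)
qed

text \<open>The rows alternate because the factors come in the order of the elementary forms, each
  functional being followed by its conjugate; \<open>interleave\<close> separates the two kinds
  later.\<close>

definition conj_rows :: "('t \<Rightarrow> complex) list \<Rightarrow> nat \<Rightarrow> 't \<Rightarrow> complex" where
  "conj_rows \<beta>s i x = (if even i then (\<beta>s ! (i div 2)) x else cnj ((\<beta>s ! (i div 2)) x))"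

lemma wedge_list_i_wedge_conj:
  "wedge_list (map i_wedge_conj \<beta>s) v = \<i> ^ length \<beta>s * wedge_1forms (2 * length \<beta>s) (conj_rows \<beta>s) v"
proof (induction \<beta>s arbitrary: v)
  case Nil
  then show ?case by (simp add: wedge_1forms_def)
next
  case (Cons \<beta> \<beta>s)
  have "(\<lambda>i. if i < 1 then \<beta> else (\<lambda>x. cnj (\<beta> x))) i = conj_rows [\<beta>] i" if "i < 2" for i
    using that by (auto simp: conj_rows_def less_2_cases_iff)
  then have "wedge 1 1 (\<lambda>w. \<beta> (w 0)) (\<lambda>w. cnj (\<beta> (w 0))) = wedge_1forms 2 (conj_rows [\<beta>])"
    using wedge_1forms_append[of 1 1 "\<lambda>i. \<beta>" "\<lambda>i x. cnj (\<beta> x)"]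
      wedge_1forms_cong[of 2 "\<lambda>i. if i < 1 then \<beta> else (\<lambda>x. cnj (\<beta> x))" "conj_rows [\<beta>]"]
    by (simp only: wedge_1forms_1 one_add_one)
  then have *: "i_wedge_conj \<beta> = (\<lambda>v. \<i> * wedge_1forms 2 (conj_rows [\<beta>]) v)"
    by (simp add: i_wedge_conj_def)
  have rows: "conj_rows (\<beta> # \<beta>s) = (\<lambda>i. if i < 2 then conj_rows [\<beta>] i else conj_rows \<beta>s (i - 2))"
  proof (intro ext)
    fix i x
    show "conj_rows (\<beta> # \<beta>s) i x = (if i < 2 then conj_rows [\<beta>] i else conj_rows \<beta>s (i - 2)) x"
    proof (cases "i < 2")
      case True
      then show ?thesis by (simp add: conj_rows_def)
    next
      case False
      then obtain k where "i = Suc (Suc k)" by (metis add_2_eq_Suc le_Suc_ex not_le)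
      then show ?thesis by (simp add: conj_rows_def)
    qed
  qed
  have IH: "wedge_list (map i_wedge_conj \<beta>s) = (\<lambda>v. \<i> ^ length \<beta>s * wedge_1forms (2 * length \<beta>s) (conj_rows \<beta>s) v)"
    by (intro ext Cons)
  show ?case
    by (simp add: * IH wedge_scale wedge_1forms_append rows)
qed


section \<open>Values of elementary forms on real frames of complex subspaces\<close>

lemma det_permute_rows_cols:
  assumes A: "A \<in> carrier_mat n n" and p: "p permutes {0..<n}"
  shows "det (mat n n (\<lambda>(i, j). A $$ (p i, p j))) = (det A :: 'a::comm_ring_1)"
proof -
  define B where "B = mat n n (\<lambda>(i, j). A $$ (p i, j))"
  have B: "B \<in> carrier_mat n n" by (simp add: B_def)
  have p_lt: "p i < n" if "i < n" for i
    using permutes_in_image[OF p, of i] that by simp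
  have "mat n n (\<lambda>(i, j). A $$ (p i, p j)) = transpose_mat (mat n n (\<lambda>(i, j). transpose_mat B $$ (p i, j)))"
    using p_lt by (intro eq_matI) (auto simp: B_def)
  then have "det (mat n n (\<lambda>(i, j). A $$ (p i, p j))) = det (mat n n (\<lambda>(i, j). transpose_mat B $$ (p i, j)))"
    by (simp add: det_transpose[OF mat_carrier])
  also have "\<dots> = of_int (sign p) * det B"
    using det_permute_rows[OF _ p, of "transpose_mat B"] B by (simp add: det_transpose[OF B])
  also have "det B = of_int (sign p) * det A"
    using det_permute_rows[OF A p] by (simp add: B_def)
  also have "of_int (sign p) * (of_int (sign p) * det A) = (of_int (sign p * sign p) :: 'a) * det A"
    by (simp only: of_int_mult mult.assoc)
  finally show ?thesis by simp
qed

text \<open>Position \<open>2 * k\<close> goes to \<open>k\<close> and \<open>2 * k + 1\<close> to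
  \<open>q + k\<close>: holomorphic entries move to the first block, conjugate ones to the second.
  Beyond \<open>2 * q\<close> it is the identity, as \<open>permutes\<close> demands.\<close>

definition interleave :: "nat \<Rightarrow> nat \<Rightarrow> nat" where
  "interleave q x = (if x < 2 * q then (x mod 2) * q + x div 2 else x)"

lemma interleave_permutes: "interleave q permutes {0..<2 * q}"
proof (rule bij_imp_permutes)
  show "bij_betw (interleave q) {0..<2 * q} {0..<2 * q}"
  proof (rule bij_betwI[where g = "\<lambda>y. if y < q then 2 * y else 2 * (y - q) + 1"])
    show "interleave q \<in> {0..<2 * q} \<rightarrow> {0..<2 * q}"
      by (auto simp: interleave_def mod2_eq_if)
    show "(if interleave q x < q then 2 * interleave q x else 2 * (interleave q x - q) + 1) = x"
      if "x \<in> {0..<2 * q}" for x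
    proof (cases "even x")
      case True
      then obtain k where "x = 2 * k" by blast
      then show ?thesis using that by (simp add: interleave_def)
    next
      case False
      then obtain k where "x = 2 * k + 1" by (rule oddE)
      then show ?thesis using that by (simp add: interleave_def)
    qed
  qed (auto simp: interleave_def)
qed (simp add: interleave_def)

text \<open>The matrix is the block diagonal of \<open>M\<close> and its conjugate times a constant
  matrix with block rows \<open>(1, \<i>)\<close> and \<open>(1, - \<i>)\<close>. The latter has an
  LU decomposition with diagonal blocks \<open>1\<close> and \<open>- 2 * \<i>\<close>, whence the
  factor \<open>(- 2 * \<i>) ^ q\<close>.\<close>

lemma det_conj_blocks:
  assumes M: "M \<in> carrier_mat q q"
  shows "det (four_block_mat M (\<i> \<cdot>\<^sub>m M) (map_mat cnj M) ((- \<i>) \<cdot>\<^sub>m map_mat cnj M)) =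
    (- 2 * \<i>) ^ q * of_real ((cmod (det M))\<^sup>2)"
proof -
  interpret cnj: comm_ring_hom cnj
    by unfold_locales auto
  define M' where "M' = map_mat cnj M"
  have M': "M' \<in> carrier_mat q q" using M by (simp add: M'_def)
  let ?I = "1\<^sub>m q :: complex mat" and ?O = "0\<^sub>m q q :: complex mat"
  let ?D = "four_block_mat M ?O ?O M'" and ?W = "four_block_mat ?I (\<i> \<cdot>\<^sub>m ?I) ?I ((- \<i>) \<cdot>\<^sub>m ?I)"
  let ?L = "four_block_mat ?I ?O ?I ?I" and ?U = "four_block_mat ?I (\<i> \<cdot>\<^sub>m ?I) ?O ((- 2 * \<i>) \<cdot>\<^sub>m ?I)"
  have I: "?I \<in> carrier_mat q q" "?O \<in> carrier_mat q q" "c \<cdot>\<^sub>m ?I \<in> carrier_mat q q" for c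
    by auto
  have "?D * ?W = four_block_mat M (\<i> \<cdot>\<^sub>m M) M' ((- \<i>) \<cdot>\<^sub>m M')"
    unfolding mult_four_block_mat[OF M I(2,2) M' I(1,3,1,3)]
    using M M' by (intro arg_cong4[where f = four_block_mat]) (auto intro!: eq_matI)
  moreover have "?L * ?U = ?W"
    unfolding mult_four_block_mat[OF I(1,2,1,1,1,3,2,3)]
    by (intro arg_cong4[where f = four_block_mat]) (auto intro!: eq_matI)
  moreover have "det ?D = det M * det M'"
    by (rule det_four_block_mat_upper_right_zero[OF M refl I(2) M'])
  moreover have "det ?L = 1"
    using det_four_block_mat_upper_right_zero[OF I(1) refl I(1,1)] by simp
  moreover have "det ?U = (- 2 * \<i>) ^ q"
    using det_four_block_mat_lower_left_zero[OF I(1,3) refl I(3)] by (simp add: det_smult)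
  moreover have "det (?D * ?W) = det ?D * det ?W"
    by (rule det_mult[of _ "q + q"]) (use M M' in auto)
  moreover have "det (?L * ?U) = det ?L * det ?U"
    by (rule det_mult[of _ "q + q"]) auto
  moreover have "det M' = cnj (det M)"
    by (simp add: M'_def)
  ultimately show ?thesis
    unfolding complex_norm_square by (simp add: M'_def mult_ac)
qed

text \<open>On the pair \<open>e, \<i> e\<close> a functional takes values with ratio
  \<open>\<i>\<close> and its conjugate values with ratio \<open>- \<i>\<close>; after separating
  rows and columns this is the block matrix of \<open>det_conj_blocks\<close>. The \<open>q\<close>
  factors \<open>\<i>\<close> of the elementary forms combine with \<open>(- 2 * \<i>) ^ q\<close>
  to \<open>2 ^ q\<close>, so the value is nonnegative.\<close>

lemma wedge_list_i_wedge_conj_real_frame: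
  assumes \<beta>s: "\<And>\<beta>. \<beta> \<in> set \<beta>s \<Longrightarrow> complex_functional s \<beta>" and len: "length \<beta>s = q"
  shows "wedge_list (map i_wedge_conj \<beta>s) (real_frame s es) =
    of_real (2 ^ q * (cmod (det (mat q q (\<lambda>(i, j). (\<beta>s ! i) (es ! j)))))\<^sup>2)"
proof -
  define M where "M = mat q q (\<lambda>(i, j). (\<beta>s ! i) (es ! j))"
  have M: "M \<in> carrier_mat q q" by (simp add: M_def)
  define N where "N = four_block_mat M (\<i> \<cdot>\<^sub>m M) (map_mat cnj M) ((- \<i>) \<cdot>\<^sub>m map_mat cnj M)"
  have N: "N \<in> carrier_mat (2 * q) (2 * q)"
    using M unfolding N_def mult_2 by auto
  have entry: "conj_rows \<beta>s i (real_frame s es j) = N $$ (interleave q i, interleave q j)"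
    if "i < 2 * q" "j < 2 * q" for i j
  proof -
    have l: "i div 2 < q" "j div 2 < q" using that by auto
    have scale: "(\<beta>s ! (i div 2)) (s c x) = c * (\<beta>s ! (i div 2)) x" for c x
      using complex_functionalD(2)[OF \<beta>s] l len by simp
    show ?thesis
      using that l
      by (cases "even i"; cases "even j")
        (auto simp: N_def M_def conj_rows_def real_frame_def interleave_def scale odd_iff_mod_2_eq_one
          even_iff_mod_2_eq_zero)
  qed
  have "wedge_1forms (2 * q) (conj_rows \<beta>s) (real_frame s es) =
      det (mat (2 * q) (2 * q) (\<lambda>(i, j). N $$ (interleave q i, interleave q j)))"
    unfolding wedge_1forms_det by (intro arg_cong[where f = det] eq_matI) (auto simp: entry)
  also have "\<dots> = det N"
    by (rule det_permute_rows_cols[OF N interleave_permutes])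
  also have "\<dots> = (- 2 * \<i>) ^ q * of_real ((cmod (det M))\<^sup>2)"
    unfolding N_def by (rule det_conj_blocks[OF M])
  finally have "wedge_list (map i_wedge_conj \<beta>s) (real_frame s es) =
      \<i> ^ q * ((- 2 * \<i>) ^ q * of_real ((cmod (det M))\<^sup>2))"
    by (simp add: wedge_list_i_wedge_conj len)
  also have "\<dots> = (\<i> * (- 2 * \<i>)) ^ q * of_real ((cmod (det M))\<^sup>2)"
    by (simp only: power_mult_distrib mult.assoc)
  also have "\<i> * (- 2 * \<i>) = 2"
    by (simp add: complex_eq_iff)
  finally show ?thesis by (simp add: M_def)
qed

lemma form_of_hermitian_sum:
  "form_of_hermitian (\<lambda>u v. \<Sum>x\<leftarrow>xs. c x * (\<beta> x u * cnj (\<beta> x v))) = (\<lambda>v. \<Sum>x\<leftarrow>xs. c x * i_wedge_conj (\<beta> x) v)"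
proof -
  have i_wedge_conj_eq: "i_wedge_conj b v = \<i> * (b (v 0) * cnj (b (v 1)) - b (v 1) * cnj (b (v 0)))" for b :: "'a \<Rightarrow> complex" and v
  proof -
    have "{\<sigma>. \<sigma> permutes {..<1 + 1 :: nat}} = {id, Transposition.transpose 0 1}"
    proof -
      have *: "{..<1 + 1} = {0, 1 :: nat}" by auto
      show ?thesis unfolding * by (auto simp: permutes_doubleton_iff)
    qed
    moreover have "id \<noteq> Transposition.transpose 0 (1 :: nat)"
      by (metis id_apply transpose_apply_first zero_neq_one)
    ultimately show ?thesis
      by (simp add: i_wedge_conj_def wedge_def sign_swap_id sign_id)
  qed
  show ?thesis
    by (induction xs) (simp_all add: fun_eq_iff form_of_hermitian_def i_wedge_conj_eq algebra_simps)
qed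

text \<open>
  \<open>D\<close> is the determinant of \<open>H\<close> in the basis \<open>fs\<close>, computed from a Cholesky decomposition that is
  triangular with respect to \<open>fs\<close>, and the inequality is Hadamard's. The factor \<open>N\<close>, in fact
  \<open>2 ^ q * fact q\<close>, is only needed to be the same for all \<open>H\<close>.
\<close>

lemma wedge_power_real_frame:
  assumes H: "semipositive_form s H" and len: "length es = q" "length fs = q"
    and es: "\<And>j. j < q \<Longrightarrow> es ! j = fs ! j + (\<Sum>k<j. s (c k j) (fs ! k))"
  defines "N \<equiv> 2 ^ q * real (length (filter distinct (product_lists (replicate q [0..<q]))))"
  obtains D where "0 \<le> D"
    "wedge_list (replicate q (form_of_hermitian H)) (real_frame s es) = of_real (N * D)"
    "D \<le> (\<Prod>j<q. Re (H (fs ! j) (fs ! j)))"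
    "(\<And>i j. i < q \<Longrightarrow> j < q \<Longrightarrow> i \<noteq> j \<Longrightarrow> H (fs ! i) (fs ! j) = 0) \<Longrightarrow>
      D = (\<Prod>j<q. Re (H (fs ! j) (fs ! j)))"
proof -
  obtain \<beta>s R where \<beta>s: "length \<beta>s = length fs" "\<And>\<beta>. \<beta> \<in> set \<beta>s \<Longrightarrow> complex_functional s \<beta>"
    "semipositive_form s R" "\<And>u v. H u v = (\<Sum>\<beta>\<leftarrow>\<beta>s. \<beta> u * cnj (\<beta> v)) + R u v"
    "\<And>i j. i < j \<Longrightarrow> j < length fs \<Longrightarrow> (\<beta>s ! j) (fs ! i) = 0" "\<And>e v. e \<in> set fs \<Longrightarrow> R e v = 0"
    using semipositive_cholesky[OF H, of fs] by blast
  have R: "hermitian_form s R" using \<beta>s(3) by (simp add: semipositive_form_def)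
  note RD = hermitian_formD[OF R]
  have fun_\<beta>: "complex_functional s (\<beta>s ! i)" if "i < q" for i
    using that \<beta>s(1,2) len by simp
  \<comment> \<open>The kernel of the remainder contains the complex span of \<open>fs\<close>,
    hence the whole real frame; there \<open>H\<close> is its Cholesky sum.\<close>
  define Z where "Z = {x. \<forall>v. R x v = 0}"
  have fs_Z: "fs ! j \<in> Z" if "j < q" for j
    using that \<beta>s(6) len by (simp add: Z_def)
  have es_Z: "es ! j \<in> Z" if "j < q" for j
    unfolding es[OF that] using that fs_Z by (auto simp: Z_def RD(1,2,5) intro!: sum.neutral)
  have frame_Z: "real_frame s es i \<in> Z" if "i < 2 * q" for i
    using es_Z[of "i div 2"] that by (auto simp: real_frame_def Z_def RD(2))
  define M where "M = mat q q (\<lambda>(i, j). (\<beta>s ! i) (es ! j))"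
  define B where "B = mat q q (\<lambda>(i, j). (\<beta>s ! i) (fs ! j))"
  \<comment> \<open>\<open>C\<close> is the unitriangular change of basis from \<open>fs\<close> to
    \<open>es\<close>, so \<open>M = B * C\<close> and \<open>det M = det B\<close>.\<close>
  define C where "C = mat q q (\<lambda>(k, j). if k < j then c k j else if k = j then 1 else 0)"
  have carr: "M \<in> carrier_mat q q" "B \<in> carrier_mat q q" "C \<in> carrier_mat q q"
    by (simp_all add: M_def B_def C_def)
  define D where "D = (cmod (det M))\<^sup>2"
  have "M = B * C"
  proof (rule eq_matI)
    fix i j assume "i < dim_row (B * C)" "j < dim_col (B * C)"
    then have ij: "i < q" "j < q" using carr by auto
    have "(B * C) $$ (i, j) = (\<Sum>k<q. (\<beta>s ! i) (fs ! k) * (if k < j then c k j else if k = j then 1 else 0))"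
      using ij by (simp add: B_def C_def scalar_prod_def lessThan_atLeast0)
    also have "\<dots> = (\<Sum>k\<in>insert j {..<j}. (\<beta>s ! i) (fs ! k) * (if k < j then c k j else if k = j then 1 else 0))"
      using ij by (intro sum.mono_neutral_right) auto
    also have "\<dots> = (\<beta>s ! i) (fs ! j) + (\<Sum>k<j. c k j * (\<beta>s ! i) (fs ! k))"
      by simp (intro sum.cong, auto)
    also have "\<dots> = (\<beta>s ! i) (es ! j)"
      using ij by (simp add: es complex_functionalD[OF fun_\<beta>])
    finally show "M $$ (i, j) = (B * C) $$ (i, j)" using ij by (simp add: M_def)
  qed (use carr in auto)
  moreover have "det C = 1"
  proof -
    have "det C = prod_list (diag_mat C)"
      by (rule det_upper_triangular[OF _ carr(3)]) (auto simp: upper_triangular_def C_def)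
    also have "\<dots> = 1"
      by (simp add: prod_list_diag_prod C_def)
    finally show ?thesis .
  qed
  ultimately have det_M: "det M = det B"
    using det_mult[OF carr(2,3)] by simp
  \<comment> \<open>The Cholesky functionals were adapted to \<open>fs\<close>, so \<open>B\<close>
    is triangular and \<open>D\<close> is the product of the squared moduli of its diagonal
    entries.\<close>
  have "det B = prod_list (diag_mat B)"
    by (rule det_upper_triangular[OF _ carr(2)]) (use \<beta>s(5) len in \<open>auto simp: upper_triangular_def B_def\<close>)
  then have det_B: "det B = (\<Prod>j<q. (\<beta>s ! j) (fs ! j))"
    by (simp add: prod_list_diag_prod B_def lessThan_atLeast0)
  have H_fs: "H (fs ! i) v = (\<Sum>k<q. (\<beta>s ! k) (fs ! i) * cnj ((\<beta>s ! k) v))" if "i < q" for i v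
    unfolding \<beta>s(4) using fs_Z[OF that] \<beta>s(1) len
    by (simp add: Z_def sum_list_sum_nth lessThan_atLeast0)
  have le: "D \<le> (\<Prod>j<q. Re (H (fs ! j) (fs ! j)))"
  proof -
    have "D = (\<Prod>j<q. (cmod ((\<beta>s ! j) (fs ! j)))\<^sup>2)"
      unfolding D_def det_M det_B by (simp add: prod_norm[symmetric] prod_power_distrib)
    also have "\<dots> \<le> (\<Prod>j<q. Re (H (fs ! j) (fs ! j)))"
    proof (rule prod_mono)
      fix j assume "j \<in> {..<q}"
      then have "Re (H (fs ! j) (fs ! j)) = (\<Sum>k<q. (cmod ((\<beta>s ! k) (fs ! j)))\<^sup>2)"
        by (simp add: H_fs cmod_power2) (simp add: power2_eq_square)
      \<comment> \<open>This is Hadamard's inequality: the squared diagonal entry is one of the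
        \<open>q\<close> nonnegative summands of \<open>H (fs ! j) (fs ! j)\<close>.\<close>
      also have "\<dots> \<ge> (cmod ((\<beta>s ! j) (fs ! j)))\<^sup>2"
        using \<open>j \<in> {..<q}\<close> by (intro member_le_sum) auto
      finally show "0 \<le> (cmod ((\<beta>s ! j) (fs ! j)))\<^sup>2 \<and> (cmod ((\<beta>s ! j) (fs ! j)))\<^sup>2 \<le> Re (H (fs ! j) (fs ! j))"
        by simp
    qed
    finally show ?thesis .
  qed
  have eq: "D = (\<Prod>j<q. Re (H (fs ! j) (fs ! j)))"
    if orth: "\<And>i j. i < q \<Longrightarrow> j < q \<Longrightarrow> i \<noteq> j \<Longrightarrow> H (fs ! i) (fs ! j) = 0"
  proof -
    interpret cnj: comm_ring_hom cnj
      by unfold_locales auto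
    \<comment> \<open>The Gram matrix of \<open>fs\<close> has determinant \<open>D\<close>, and it
      is diagonal when \<open>fs\<close> is orthogonal.\<close>
    define G where "G = mat q q (\<lambda>(i, j). H (fs ! i) (fs ! j))"
    have G: "G \<in> carrier_mat q q" by (simp add: G_def)
    have "G = transpose_mat B * map_mat cnj B"
      by (rule eq_matI) (auto simp: G_def B_def scalar_prod_def H_fs lessThan_atLeast0)
    then have "det G = det B * cnj (det B)"
      using det_mult[of "transpose_mat B" q "map_mat cnj B"] carr by (simp add: det_transpose[OF carr(2)])
    also have "\<dots> = of_real D"
      unfolding D_def det_M by (rule complex_norm_square[symmetric])
    finally have "of_real D = det G" by simp
    also have "det G = prod_list (diag_mat G)"
      by (rule det_upper_triangular[OF _ G]) (use orth in \<open>auto simp: upper_triangular_def G_def\<close>)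
    also have "\<dots> = (\<Prod>j<q. H (fs ! j) (fs ! j))"
      by (simp add: prod_list_diag_prod G_def lessThan_atLeast0)
    also have "\<dots> = of_real (\<Prod>j<q. Re (H (fs ! j) (fs ! j)))"
      using semipositive_form_diag(1)[OF H] by simp
    finally show ?thesis by (simp only: of_real_eq_iff)
  qed
  \<comment> \<open>A list of row indices with a repetition gives determinant 0; otherwise it
    permutes the rows, and the sign disappears in the modulus. So all nonzero terms of the expansion
    are equal, and \<open>N\<close> counts them, each with its factor \<open>2 ^ q\<close>.\<close>
  have perm: "(cmod (det (mat q q (\<lambda>(i, j). (\<beta>s ! (xs ! i)) (es ! j)))))\<^sup>2 = (if distinct xs then D else 0)"
    if xs: "length xs = q" "set xs \<subseteq> {..<q}" for xs
  proof (cases "distinct xs")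
    case True
    define p where "p i = (if i < q then xs ! i else i)" for i
    have "inj_on ((!) xs) {0..<q}"
      using True xs(1) by (auto simp: inj_on_def nth_eq_iff_index_eq)
    moreover have "(!) xs ` {0..<q} \<subseteq> {0..<q}"
      using xs by (auto simp: subset_iff)
    ultimately have "bij_betw ((!) xs) {0..<q} {0..<q}"
      by (simp add: bij_betw_def endo_inj_surj)
    then have "bij_betw p {0..<q} {0..<q}"
      by (rule bij_betw_cong[THEN iffD1, rotated]) (simp add: p_def)
    then have p: "p permutes {0..<q}"
      by (rule bij_imp_permutes) (simp add: p_def)
    have "mat q q (\<lambda>(i, j). (\<beta>s ! (xs ! i)) (es ! j)) = mat q q (\<lambda>(i, j). M $$ (p i, j))"
      using xs by (intro eq_matI) (auto simp: M_def p_def subset_iff)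
    then have "det (mat q q (\<lambda>(i, j). (\<beta>s ! (xs ! i)) (es ! j))) = of_int (sign p) * det M"
      using det_permute_rows[OF carr(1) p] by simp
    then show ?thesis
      using True by (simp add: D_def norm_mult power_mult_distrib sign_def)
  next
    case False
    then obtain i j where ij: "i < q" "j < q" "i \<noteq> j" "xs ! i = xs ! j"
      using xs(1) by (auto simp: distinct_conv_nth)
    have "det (mat q q (\<lambda>(i, j). (\<beta>s ! (xs ! i)) (es ! j))) = 0"
      by (rule det_identical_rows[OF mat_carrier ij(3,1,2)]) (use ij in auto)
    then show ?thesis using False by simp
  qed
  have "wedge_list (replicate q (form_of_hermitian H)) (real_frame s es) =
      wedge_list (map (\<lambda>F v. \<Sum>x\<leftarrow>F. 1 * i_wedge_conj (\<beta>s ! x) v) (replicate q [0..<q])) (real_frame s es)"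
  proof (rule wedge_list_cong_on[where Z = Z])
    fix j and w :: "nat \<Rightarrow> 'a"
    assume j: "j < length (replicate q (form_of_hermitian H))" and w: "w 0 \<in> Z" "w 1 \<in> Z"
    have *: "H u v = (\<Sum>x\<leftarrow>[0..<q]. 1 * ((\<beta>s ! x) u * cnj ((\<beta>s ! x) v)))" if "u \<in> Z" for u v
      using that \<beta>s(1) len by (simp add: \<beta>s(4) Z_def sum_list_sum_nth sum_list_distinct_conv_sum_set)
    have "form_of_hermitian H w =
        form_of_hermitian (\<lambda>u v. \<Sum>x\<leftarrow>[0..<q]. 1 * ((\<beta>s ! x) u * cnj ((\<beta>s ! x) v))) w"
      unfolding form_of_hermitian_def by (simp only: *[OF w(1)] *[OF w(2)])
    also have "\<dots> = (\<Sum>x\<leftarrow>[0..<q]. 1 * i_wedge_conj (\<beta>s ! x) w)"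
      unfolding form_of_hermitian_sum ..
    finally show "(replicate q (form_of_hermitian H) ! j) w =
        (map (\<lambda>F v. \<Sum>x\<leftarrow>F. 1 * i_wedge_conj (\<beta>s ! x) v) (replicate q [0..<q]) ! j) w"
      using j by simp
  qed (use frame_Z in simp_all)
  also have "\<dots> = (\<Sum>xs\<leftarrow>product_lists (replicate q [0..<q]).
      wedge_list (map i_wedge_conj (map ((!) \<beta>s) xs)) (real_frame s es))"
    unfolding wedge_list_expand by (simp add: o_def map_replicate_const)
  also have "\<dots> = (\<Sum>xs\<leftarrow>product_lists (replicate q [0..<q]). of_real (2 ^ q * (if distinct xs then D else 0)))"
  proof (intro arg_cong[where f = sum_list] map_cong refl)
    fix xs assume xs_in: "xs \<in> set (product_lists (replicate q [0..<q]))"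
    have len_xs: "length xs = q"
      using length_in_product_lists[OF xs_in] by simp
    moreover have "xs ! i < q" if "i < q" for i
      using in_product_listsD[OF xs_in, of i] that by simp
    ultimately have xs: "length xs = q" "set xs \<subseteq> {..<q}"
      by (auto simp: in_set_conv_nth)
    have "wedge_list (map i_wedge_conj (map ((!) \<beta>s) xs)) (real_frame s es) =
        of_real (2 ^ q * (cmod (det (mat q q (\<lambda>(i, j). (map ((!) \<beta>s) xs ! i) (es ! j)))))\<^sup>2)"
      by (rule wedge_list_i_wedge_conj_real_frame) (use xs fun_\<beta> in \<open>auto simp: subset_iff\<close>)
    also have "mat q q (\<lambda>(i, j). (map ((!) \<beta>s) xs ! i) (es ! j)) = mat q q (\<lambda>(i, j). (\<beta>s ! (xs ! i)) (es ! j))"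
      using xs by (intro eq_matI) auto
    finally show "wedge_list (map i_wedge_conj (map ((!) \<beta>s) xs)) (real_frame s es) =
        of_real (2 ^ q * (if distinct xs then D else 0))"
      by (simp only: perm[OF xs])
  qed
  also have "\<dots> = of_real (N * D)"
  proof -
    have "(\<Sum>xs\<leftarrow>L. of_real (2 ^ q * (if distinct xs then D else 0))) =
        complex_of_real (2 ^ q * real (length (filter distinct L)) * D)" for L :: "nat list list"
      by (induction L) (auto simp: algebra_simps)
    then show ?thesis by (simp only: N_def)
  qed
  finally show thesis
    using that[of D] le eq by (simp add: D_def)
qed

section \<open>Moments of linear forms on the unit sphere\<close>

locale invariant_sphere =
  fixes s :: "complex \<Rightarrow> 'e \<Rightarrow> 'e::ab_group_add" and h :: "'e \<Rightarrow> 'e \<Rightarrow> complex"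
    and \<mu> :: "'e measure" and B :: "'e set"
  assumes hermitian: "hermitian_structure s h"
    and invariant: "unitary_invariant_probability s h \<mu>"
    and orthonormal: "orthonormal_basis s h B"
begin

sublocale finite_dimensional_vector_space s B
  using orthonormal by (simp add: orthonormal_basis_def)

sublocale prob_space \<mu>
  using invariant by (simp add: unitary_invariant_probability_def)

lemma h_form: "hermitian_form s h"
  using hermitian by (simp add: hermitian_structure_def)

lemmas hD = hermitian_formD(1-10)[OF h_form]

lemmas h_cnj = hermitian_formD(11)[OF h_form]

lemma h_pos: "semipositive_form s h"
  using hermitian by (rule hermitian_structure_semipositive)

lemma h_diag: "h u u = of_real ((hnorm h u)\<^sup>2)" "hnorm h u \<ge> 0"
  using semipositive_form_diag[OF h_pos, of u] by (simp_all add: hnorm_def)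

lemma h_basis: "e \<in> B \<Longrightarrow> f \<in> B \<Longrightarrow> h e f = (if e = f then 1 else 0)"
  using orthonormal by (simp add: orthonormal_basis_def)

lemma space_eq: "space \<mu> = {u. hnorm h u = 1}"
  using invariant by (simp add: unitary_invariant_probability_def unit_sphere_def)

lemma basis_expansion: "u = (\<Sum>e\<in>B. s (h u e) e)"
proof -
  have "u \<in> span B" using span_Basis by simp
  then obtain c where c: "u = (\<Sum>e\<in>B. s (c e) e)"
    unfolding span_finite[OF finite_Basis] by blast
  have "h u e = c e" if "e \<in> B" for e
  proof -
    have "h u e = (\<Sum>f\<in>B. c f * h f e)"
      unfolding c by (simp add: hD)
    also have "\<dots> = (\<Sum>f\<in>B. if f = e then c f else 0)"
      by (intro sum.cong) (use that h_basis in auto)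
    also have "\<dots> = c e" using that finite_Basis by simp
    finally show ?thesis .
  qed
  then have "(\<Sum>e\<in>B. s (h u e) e) = (\<Sum>e\<in>B. s (c e) e)"
    by (intro sum.cong) auto
  with c show ?thesis by simp
qed

lemma functional_expansion: "complex_functional s l \<Longrightarrow> l u = (\<Sum>e\<in>B. h u e * l e)"
  by (subst basis_expansion[of u]) (simp add: complex_functionalD)

definition dual_inner :: "('e \<Rightarrow> complex) \<Rightarrow> ('e \<Rightarrow> complex) \<Rightarrow> complex" where
  "dual_inner l m = (\<Sum>e\<in>B. l e * cnj (m e))"

definition riesz :: "('e \<Rightarrow> complex) \<Rightarrow> 'e" where
  "riesz l = (\<Sum>e\<in>B. s (cnj (l e)) e)"

lemma h_riesz: "complex_functional s l \<Longrightarrow> h u (riesz l) = l u"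
  unfolding functional_expansion[of l u] by (simp add: riesz_def hD mult.commute)

lemma functional_riesz: "complex_functional s m \<Longrightarrow> cnj (m (riesz l)) = dual_inner l m"
  by (simp add: riesz_def dual_inner_def complex_functionalD)

text \<open>Cauchy-Schwarz bounds the supremum, and the normalised representing vector attains it;
  if that vector has norm 0, the vector 0 does.\<close>

lemma dual_norm_eq_riesz:
  assumes l: "complex_functional s l"
  shows "dual_norm h l = hnorm h (riesz l)"
proof -
  define w where "w = riesz l"
  have l_eq: "l u = h u w" for u by (simp add: h_riesz[OF l] w_def)
  have le: "cmod (l u) \<le> hnorm h u * hnorm h w" for u
  proof (rule power2_le_imp_le)
    show "(cmod (l u))\<^sup>2 \<le> (hnorm h u * hnorm h w)\<^sup>2"
      using semipositive_cauchy_schwarz[OF h_pos, of u w]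
      by (simp add: l_eq h_diag power_mult_distrib del: of_real_power)
  qed (simp add: h_diag)
  show ?thesis
    unfolding dual_norm_def w_def[symmetric]
  proof (rule cSup_eq_maximum)
    show "hnorm h w \<in> {cmod (l u) |u. hnorm h u \<le> 1}"
    proof (cases "hnorm h w = 0")
      case True
      have "l 0 = 0" "hnorm h 0 = 0" using complex_functionalD(3)[OF l] hD(3) by (auto simp: hnorm_def)
      then show ?thesis using True by (intro CollectI exI[of _ 0]) auto
    next
      case False
      define u where "u = s (of_real (1 / hnorm h w)) w"
      have "l u = of_real (hnorm h w)"
        using False h_diag(1)[of w] by (simp add: u_def l_eq hD power2_eq_square)
      moreover have "h u u = 1"
        using False h_diag(1)[of w] by (simp add: u_def hD power2_eq_square)
      ultimately show ?thesis
        using h_diag(2)[of w] by (intro CollectI exI[of _ u]) (simp add: hnorm_def)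
    qed
    show "x \<le> hnorm h w" if "x \<in> {cmod (l u) |u. hnorm h u \<le> 1}" for x
      using that le h_diag(2)[of w] by (auto intro: order_trans[OF le mult_left_le_one_le] simp: h_diag(2))
  qed
qed

lemma dual_norm_nonneg: "complex_functional s l \<Longrightarrow> 0 \<le> dual_norm h l"
  by (simp add: dual_norm_eq_riesz h_diag)

lemma cmod_functional_le:
  assumes l: "complex_functional s l"
  shows "cmod (l u) \<le> hnorm h u * dual_norm h l"
proof (rule power2_le_imp_le)
  show "(cmod (l u))\<^sup>2 \<le> (hnorm h u * dual_norm h l)\<^sup>2"
    using semipositive_cauchy_schwarz[OF h_pos, of u "riesz l"]
    by (simp add: h_riesz[OF l] dual_norm_eq_riesz[OF l] h_diag power_mult_distrib del: of_real_power)
qed (simp add: h_diag dual_norm_nonneg[OF l])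

lemma dual_inner_self:
  assumes l: "complex_functional s l"
  shows "dual_inner l l = of_real ((dual_norm h l)\<^sup>2)"
  using h_diag(1)[of "riesz l"] functional_riesz[OF l, of l] h_riesz[OF l, of "riesz l"]
  unfolding dual_norm_eq_riesz[OF l]
  by (metis complex_cnj_complex_of_real)

lemma dual_norm_square: "complex_functional s l \<Longrightarrow> (dual_norm h l)\<^sup>2 = (\<Sum>e\<in>B. (cmod (l e))\<^sup>2)"
proof -
  assume "complex_functional s l"
  then have "of_real ((dual_norm h l)\<^sup>2) = complex_of_real (\<Sum>e\<in>B. (cmod (l e))\<^sup>2)"
    using dual_inner_self[of l] unfolding dual_inner_def by (simp add: complex_norm_square del: of_real_power)
  then show ?thesis by (simp only: of_real_eq_iff)
qed

lemma cmod_dual_inner_le: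
  assumes "complex_functional s l" "complex_functional s m"
  shows "cmod (dual_inner l m) \<le> dual_norm h l * dual_norm h m"
  using cmod_functional_le[OF assms(2), of "riesz l"]
  unfolding dual_norm_eq_riesz[OF assms(1), symmetric] functional_riesz[OF assms(2), symmetric] by simp

text \<open>A probability space is nonempty, so there is a unit vector. Positivity makes the natural
  number \<open>card B - 1\<close> the true difference.\<close>

lemma card_B_pos: "0 < card B"
proof -
  obtain u where "hnorm h u = 1" using not_empty space_eq by auto
  then have "u \<noteq> 0" using hD(3) by (auto simp: hnorm_def)
  then have "B \<noteq> {}" using basis_expansion[of u] by auto
  then show ?thesis using finite_Basis by (simp add: card_gt_0_iff)
qed

lemma h_basis_sum: "(\<Sum>e\<in>B. h u e * cnj (h u e)) = h u u"
proof -
  have "complex_functional s (\<lambda>v. h v u)"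
    using h_form unfolding hermitian_form_def by blast
  from functional_expansion[OF this, of u] show ?thesis
    by (simp add: h_cnj[of _ u, symmetric])
qed

subsection \<open>Measurability and invariance\<close>

lemma functional_measurable:
  assumes l: "complex_functional s l"
  shows "l \<in> borel_measurable \<mu>"
proof (rule borel_measurableI)
  fix S :: "complex set" assume S: "open S"
  have "h_open h (l -` S)"
    unfolding h_open_def
  proof
    fix u assume "u \<in> l -` S"
    then obtain \<epsilon> where \<epsilon>: "\<epsilon> > 0" "ball (l u) \<epsilon> \<subseteq> S"
      using S by (auto simp: open_contains_ball)
    \<comment> \<open>The functional is Lipschitz with its dual norm as constant; the
      \<open>+ 1\<close> avoids division by zero.\<close>
    define d where "d = \<epsilon> / (dual_norm h l + 1)"
    have p: "dual_norm h l + 1 > 0" using dual_norm_nonneg[OF l] by simp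
    have "v \<in> l -` S" if v: "hnorm h (v - u) < d" for v
    proof -
      have "cmod (l v - l u) \<le> hnorm h (v - u) * dual_norm h l"
        using cmod_functional_le[OF l, of "v - u"] by (simp add: complex_functionalD[OF l])
      also have "\<dots> \<le> hnorm h (v - u) * (dual_norm h l + 1)"
        by (intro mult_left_mono) (auto simp: h_diag)
      also have "\<dots> < \<epsilon>"
        using v p by (simp add: d_def pos_less_divide_eq)
      finally show ?thesis using \<epsilon> by (auto simp: dist_norm norm_minus_commute)
    qed
    moreover have "d > 0" using \<epsilon> p by (simp add: d_def)
    ultimately show "\<exists>\<epsilon>>0. \<forall>v. hnorm h (v - u) < \<epsilon> \<longrightarrow> v \<in> l -` S" by blast
  qed
  then show "l -` S \<inter> space \<mu> \<in> sets \<mu>"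
    using invariant unfolding unitary_invariant_probability_def by (auto intro!: sigma_sets.Basic)
qed

text \<open>An isometry pulls open sets back to open sets and is therefore measurable; that its
  image measure is \<mu> is the invariance in the definition.\<close>

lemma integral_invariant:
  assumes g: "Vector_Spaces.linear s s g" and gh: "\<And>u v. h (g u) (g v) = h u v"
    and f: "f \<in> borel_measurable \<mu>"
  shows "(\<integral>u. f (g u) \<partial>\<mu>) = (\<integral>u. (f u :: complex) \<partial>\<mu>)"
proof -
  interpret g: Vector_Spaces.linear s s g by (rule g)
  define S where "S = unit_sphere h"
  define G where "G = {U \<inter> S |U. h_open h U}"
  have sp: "space \<mu> = S" and se: "sets \<mu> = sigma_sets S G"
    and em: "\<And>A. A \<in> sets \<mu> \<Longrightarrow> emeasure \<mu> (g -` A \<inter> S) = emeasure \<mu> A"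
    using invariant g gh unfolding unitary_invariant_probability_def S_def G_def by auto
  have norm_g: "hnorm h (g u) = hnorm h u" for u by (simp add: hnorm_def gh)
  have meas: "g \<in> measurable \<mu> \<mu>"
  proof (rule measurable_sigma_sets[OF se])
    show "G \<subseteq> Pow S" by (auto simp: G_def)
    show "g \<in> space \<mu> \<rightarrow> S" by (auto simp: sp S_def unit_sphere_def norm_g)
    fix y assume "y \<in> G"
    then obtain U where U: "y = U \<inter> S" "h_open h U" by (auto simp: G_def)
    have "h_open h (g -` U)"
      unfolding h_open_def
    proof
      fix u assume "u \<in> g -` U"
      then obtain \<epsilon> where "\<epsilon> > 0" "\<And>v. hnorm h (v - g u) < \<epsilon> \<Longrightarrow> v \<in> U"
        using U(2) by (auto simp: h_open_def)
      then show "\<exists>\<epsilon>>0. \<forall>v. hnorm h (v - u) < \<epsilon> \<longrightarrow> v \<in> g -` U"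
        by (metis g.diff norm_g vimageI)
    qed
    moreover have "g -` y \<inter> space \<mu> = g -` U \<inter> S"
      by (auto simp: U sp S_def unit_sphere_def norm_g)
    ultimately show "g -` y \<inter> space \<mu> \<in> sets \<mu>"
      unfolding se by (auto simp: G_def intro!: sigma_sets.Basic)
  qed
  have "distr \<mu> \<mu> g = \<mu>"
  proof (rule measure_eqI)
    show "emeasure (distr \<mu> \<mu> g) A = emeasure \<mu> A" if "A \<in> sets (distr \<mu> \<mu> g)" for A
      using that meas em[of A] by (simp add: emeasure_distr sp)
  qed simp
  then show ?thesis
    using integral_distr[OF meas f] by simp
qed

text \<open>A class of integrands that is closed under products and conjugation, and whose members
  are integrable because \<mu> is finite.\<close>

definition bounded_measurable :: "('e \<Rightarrow> complex) \<Rightarrow> bool" where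
  "bounded_measurable f \<longleftrightarrow> f \<in> borel_measurable \<mu> \<and> (\<exists>K. \<forall>u\<in>space \<mu>. norm (f u) \<le> K)"

lemma bounded_measurable_integrable: "bounded_measurable f \<Longrightarrow> integrable \<mu> f"
  unfolding bounded_measurable_def by (auto intro!: integrable_const_bound AE_I2)

lemma bounded_measurable_functional: "complex_functional s l \<Longrightarrow> bounded_measurable l"
  unfolding bounded_measurable_def
  using functional_measurable cmod_functional_le[of l]
  by (auto simp: space_eq intro!: exI[of _ "dual_norm h l"]) (metis mult_1)

lemma bounded_measurable_cnj: "bounded_measurable f \<Longrightarrow> bounded_measurable (\<lambda>u. cnj (f u))"
  unfolding bounded_measurable_def
  by (auto intro!: borel_measurable_continuous_on[OF continuous_on_cnj[OF continuous_on_id], unfolded id_def])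

lemma bounded_measurable_const: "bounded_measurable (\<lambda>u. c)"
  unfolding bounded_measurable_def by auto

lemma bounded_measurable_mult:
  assumes "bounded_measurable f" "bounded_measurable g"
  shows "bounded_measurable (\<lambda>u. f u * g u)"
proof -
  obtain K L where "\<forall>u\<in>space \<mu>. norm (f u) \<le> K" "\<forall>u\<in>space \<mu>. norm (g u) \<le> L"
    using assms by (auto simp: bounded_measurable_def)
  then have "\<forall>u\<in>space \<mu>. norm (f u * g u) \<le> max K 0 * L"
    by (force simp: norm_mult intro!: mult_mono)
  then show ?thesis using assms unfolding bounded_measurable_def by (auto intro!: exI[of _ "max K 0 * L"])
qed

lemma bounded_measurable_prod:
  "(\<And>i. i \<in> I \<Longrightarrow> bounded_measurable (f i)) \<Longrightarrow> bounded_measurable (\<lambda>u. \<Prod>i\<in>I. f i u)"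
  by (induction I rule: infinite_finite_induct) (auto intro: bounded_measurable_const bounded_measurable_mult)

lemma bounded_measurable_h: "bounded_measurable (\<lambda>u. h u v)" "bounded_measurable (\<lambda>u. h v u)"
proof -
  show "bounded_measurable (\<lambda>u. h u v)"
    using h_form bounded_measurable_functional unfolding hermitian_form_def by blast
  from bounded_measurable_cnj[OF this] show "bounded_measurable (\<lambda>u. h v u)"
    by (simp add: h_cnj[of v, symmetric])
qed

section \<open>Differentiating the invariance of the integral\<close>

text \<open>The integral is a polynomial in the \<open>z i t\<close> with constant coefficients, so
  the product rule suffices. One factor is split off at a time; \<open>f\<close> collects those
  already split off and therefore varies in the induction.\<close>

lemma integral_prod_has_vector_derivative:
  assumes "finite I" "bounded_measurable f"
    "\<And>i. i \<in> I \<Longrightarrow> bounded_measurable (x i)" "\<And>i. i \<in> I \<Longrightarrow> bounded_measurable (y i)"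
    "\<And>i. i \<in> I \<Longrightarrow> (z i has_vector_derivative d i) (at 0)" "\<And>i. i \<in> I \<Longrightarrow> z i 0 = 0"
  shows "((\<lambda>t. \<integral>u. f u * (\<Prod>i\<in>I. x i u + z i t * y i u) \<partial>\<mu>) has_vector_derivative
    (\<Sum>i\<in>I. d i * (\<integral>u. f u * (y i u * (\<Prod>j\<in>I - {i}. x j u)) \<partial>\<mu>))) (at (0 :: real))"
  using assms
proof (induction I arbitrary: f rule: finite_induct)
  case empty
  then show ?case by simp
next
  case (insert i I)
  have bd: "bounded_measurable (\<lambda>u. \<Prod>j\<in>I. x j u + z j t * y j u)" for t
  proof (rule bounded_measurable_prod)
    fix j assume "j \<in> I"
    then have "bounded_measurable (x j)" "bounded_measurable (\<lambda>u. z j t * y j u)"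
      using insert.prems by (auto intro!: bounded_measurable_mult[OF bounded_measurable_const])
    then obtain K L where "\<forall>u\<in>space \<mu>. norm (x j u) \<le> K" "\<forall>u\<in>space \<mu>. norm (z j t * y j u) \<le> L"
      and m: "x j \<in> borel_measurable \<mu>" "(\<lambda>u. z j t * y j u) \<in> borel_measurable \<mu>"
      by (auto simp: bounded_measurable_def)
    then have "\<forall>u\<in>space \<mu>. norm (x j u + z j t * y j u) \<le> K + L"
      by (auto intro!: norm_triangle_le add_mono)
    then show "bounded_measurable (\<lambda>u. x j u + z j t * y j u)"
      using borel_measurable_add[OF m] by (auto simp: bounded_measurable_def)
  qed
  have int: "integrable \<mu> (\<lambda>u. f u * (g u * (\<Prod>j\<in>I. x j u + z j t * y j u)))" if "bounded_measurable g" for g t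
    using insert.prems that bd by (intro bounded_measurable_integrable bounded_measurable_mult) auto
  have split: "(\<integral>u. f u * (\<Prod>j\<in>insert i I. x j u + z j t * y j u) \<partial>\<mu>) =
      (\<integral>u. (f u * x i u) * (\<Prod>j\<in>I. x j u + z j t * y j u) \<partial>\<mu>) +
      z i t * (\<integral>u. (f u * y i u) * (\<Prod>j\<in>I. x j u + z j t * y j u) \<partial>\<mu>)" for t
  proof -
    have "(\<integral>u. f u * (\<Prod>j\<in>insert i I. x j u + z j t * y j u) \<partial>\<mu>) =
        (\<integral>u. f u * (x i u * (\<Prod>j\<in>I. x j u + z j t * y j u)) +
          z i t * (f u * (y i u * (\<Prod>j\<in>I. x j u + z j t * y j u))) \<partial>\<mu>)"
      using insert.hyps by (intro Bochner_Integration.integral_cong) (auto simp: algebra_simps)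
    also have "\<dots> = (\<integral>u. f u * (x i u * (\<Prod>j\<in>I. x j u + z j t * y j u)) \<partial>\<mu>) +
        z i t * (\<integral>u. f u * (y i u * (\<Prod>j\<in>I. x j u + z j t * y j u)) \<partial>\<mu>)"
      using int[of "x i" t] int[of "y i" t] insert.prems by simp
    finally show ?thesis by (simp add: mult.assoc)
  qed
  have "((\<lambda>t. \<integral>u. (f u * g u) * (\<Prod>j\<in>I. x j u + z j t * y j u) \<partial>\<mu>) has_vector_derivative
      (\<Sum>j\<in>I. d j * (\<integral>u. (f u * g u) * (y j u * (\<Prod>k\<in>I - {j}. x k u)) \<partial>\<mu>))) (at 0)"
    if "bounded_measurable g" for g
    using insert.prems that by (intro insert.IH bounded_measurable_mult) auto
  note D = this[of "x i"] this[of "y i"]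
  have "((\<lambda>t. (\<integral>u. (f u * x i u) * (\<Prod>j\<in>I. x j u + z j t * y j u) \<partial>\<mu>) +
      z i t * (\<integral>u. (f u * y i u) * (\<Prod>j\<in>I. x j u + z j t * y j u) \<partial>\<mu>)) has_vector_derivative
      (\<Sum>j\<in>I. d j * (\<integral>u. (f u * x i u) * (y j u * (\<Prod>k\<in>I - {j}. x k u)) \<partial>\<mu>)) +
      (z i 0 * (\<Sum>j\<in>I. d j * (\<integral>u. (f u * y i u) * (y j u * (\<Prod>k\<in>I - {j}. x k u)) \<partial>\<mu>)) +
       d i * (\<integral>u. (f u * y i u) * (\<Prod>j\<in>I. x j u + z j 0 * y j u) \<partial>\<mu>))) (at 0)"
    using insert.prems by (intro has_vector_derivative_add has_vector_derivative_mult D) auto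
  moreover have "(\<Sum>j\<in>insert i I. d j * (\<integral>u. f u * (y j u * (\<Prod>k\<in>insert i I - {j}. x k u)) \<partial>\<mu>)) =
      (\<Sum>j\<in>I. d j * (\<integral>u. (f u * x i u) * (y j u * (\<Prod>k\<in>I - {j}. x k u)) \<partial>\<mu>)) +
      (z i 0 * (\<Sum>j\<in>I. d j * (\<integral>u. (f u * y i u) * (y j u * (\<Prod>k\<in>I - {j}. x k u)) \<partial>\<mu>)) +
       d i * (\<integral>u. (f u * y i u) * (\<Prod>j\<in>I. x j u + z j 0 * y j u) \<partial>\<mu>))"
  proof -
    have "(\<Prod>k\<in>insert i I - {j}. x k u) = x i u * (\<Prod>k\<in>I - {j}. x k u)" if "j \<in> I" for j u
    proof -
      have "insert i I - {j} = insert i (I - {j})" using that insert.hyps by auto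
      then show ?thesis using insert.hyps by simp
    qed
    then have 1: "(\<Sum>j\<in>I. d j * (\<integral>u. f u * (y j u * (\<Prod>k\<in>insert i I - {j}. x k u)) \<partial>\<mu>)) =
        (\<Sum>j\<in>I. d j * (\<integral>u. (f u * x i u) * (y j u * (\<Prod>k\<in>I - {j}. x k u)) \<partial>\<mu>))"
      by (intro sum.cong) (auto simp: mult_ac)
    have 2: "(\<Prod>j\<in>I. x j u + z j 0 * y j u) = (\<Prod>j\<in>insert i I - {i}. x j u)" for u
      using insert.prems(5) insert.hyps by (intro prod.cong) auto
    show ?thesis
      unfolding sum.insert[OF insert.hyps] 1 2 using insert.prems(5) by (simp add: mult.assoc)
  qed
  ultimately show ?case
    unfolding split by simp
qed

lemmas bounded_measurable_intros = bounded_measurable_const bounded_measurable_mult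
  bounded_measurable_prod bounded_measurable_cnj bounded_measurable_h

lemma reflection_linear: "Vector_Spaces.linear s s (\<lambda>u. u + s (c * h u w) w)"
  by (auto simp: Vector_Spaces.linear_iff vector_space_axioms hD algebra_simps)

text \<open>With \<open>\<zeta> = 1 + c\<close> on the unit circle,
  \<open>c + cnj c + c * cnj c = 0\<close>, and this is the only term by which the two sides could
  differ.\<close>

lemma reflection_unitary:
  assumes w: "h w w = 1" and c: "cmod (1 + c) = 1"
  shows "h (u + s (c * h u w) w) (v + s (c * h v w) w) = h u v"
proof -
  have "1 = (1 + c) * cnj (1 + c)"
    using complex_norm_square[of "1 + c"] unfolding c by simp
  then have "c + cnj c + c * cnj c = 0"
    by (simp add: algebra_simps)
  then have "h u v + h u w * h w v * (c + cnj c + c * cnj c) = h u v"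
    by simp
  moreover have "h (u + s (c * h u w) w) (v + s (c * h v w) w) =
      h u v + h u w * h w v * (c + cnj c + c * cnj c)"
    using w by (simp add: hD h_cnj[of w v] algebra_simps)
  ultimately show ?thesis by simp
qed

lemma cis_minus_1_has_vector_derivative:
  "((\<lambda>t. cis t - 1) has_vector_derivative \<i>) (at 0)" "((\<lambda>t. cnj (cis t) - 1) has_vector_derivative - \<i>) (at 0)"
proof -
  have "((\<lambda>z. exp (\<i> * z) - 1) has_field_derivative \<i>) (at (of_real 0))"
    by (auto intro!: derivative_eq_intros)
  from has_vector_derivative_real_field[OF this]
  show "((\<lambda>t. cis t - 1) has_vector_derivative \<i>) (at 0)"
    by (simp add: cis_conv_exp)
  from has_vector_derivative_cnj[OF this]
  show "((\<lambda>t. cnj (cis t) - 1) has_vector_derivative - \<i>) (at 0)"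
    by simp
qed

text \<open>\<open>J t\<close> is the integral of the product pulled back by the reflection with
  \<open>\<zeta> = cis t\<close>. It is constant, and the product rule at \<open>t = 0\<close> gives
  \<open>\<i>\<close> times the difference of the two sides: a factor \<open>l a\<close> varies with
  \<open>\<i>\<close>, a conjugate factor with \<open>- \<i>\<close>.\<close>

lemma infinitesimal_reflection:
  assumes "finite A" "finite C"
    and l: "\<And>a. a \<in> A \<Longrightarrow> complex_functional s (l a)" and m: "\<And>b. b \<in> C \<Longrightarrow> complex_functional s (m b)"
    and w: "h w w = 1"
  shows "(\<Sum>a\<in>A. l a w * (\<integral>u. h u w * ((\<Prod>i\<in>A - {a}. l i u) * (\<Prod>b\<in>C. cnj (m b u))) \<partial>\<mu>)) =
    (\<Sum>b\<in>C. cnj (m b w) * (\<integral>u. cnj (h u w) * ((\<Prod>a\<in>A. l a u) * (\<Prod>i\<in>C - {b}. cnj (m i u))) \<partial>\<mu>))"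
proof -
  \<comment> \<open>Indexing by a disjoint union turns both families into a single product.\<close>
  define x where "x = case_sum l (\<lambda>b u. cnj (m b u))"
  define y where "y = case_sum (\<lambda>a u. l a w * h u w) (\<lambda>b u. cnj (m b w) * cnj (h u w))"
  define z where "z = case_sum (\<lambda>a :: 'a. \<lambda>t. cis t - 1) (\<lambda>b :: 'b. \<lambda>t. cnj (cis t - 1))"
  define d where "d = case_sum (\<lambda>a :: 'a. \<i>) (\<lambda>b :: 'b. - \<i>)"
  define J where "J t = (\<integral>u. 1 * (\<Prod>i\<in>A <+> C. x i u + z i t * y i u) \<partial>\<mu>)" for t
  have fin: "finite (A <+> C)" using assms(1,2) by simp
  have bx: "bounded_measurable (x i)" and by': "bounded_measurable (y i)" if "i \<in> A <+> C" for i
    using that by (auto simp: x_def y_def intro!: bounded_measurable_intros bounded_measurable_functional[OF l] bounded_measurable_functional[OF m])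
  have "(J has_vector_derivative (\<Sum>i\<in>A <+> C. d i * (\<integral>u. 1 * (y i u * (\<Prod>j\<in>(A <+> C) - {i}. x j u)) \<partial>\<mu>))) (at 0)"
    unfolding J_def
    by (rule integral_prod_has_vector_derivative[OF fin bounded_measurable_const bx by'])
      (auto simp: z_def d_def cis_minus_1_has_vector_derivative)
  moreover have "J t = J 0" for t
  proof -
    define f where "f u = (\<Prod>a\<in>A. l a u) * (\<Prod>b\<in>C. cnj (m b u))" for u
    define g where "g u = u + s ((cis t - 1) * h u w) w" for u
    have "bounded_measurable f"
      unfolding f_def by (intro bounded_measurable_intros bounded_measurable_functional l m)
    then have f: "f \<in> borel_measurable \<mu>" by (simp add: bounded_measurable_def)
    have "(\<integral>u. f (g u) \<partial>\<mu>) = (\<integral>u. f u \<partial>\<mu>)"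
    proof (rule integral_invariant[OF _ _ f])
      show "Vector_Spaces.linear s s g"
        unfolding g_def by (rule reflection_linear)
      show "h (g u) (g v) = h u v" for u v
        unfolding g_def by (rule reflection_unitary[OF w]) simp
    qed
    moreover have "1 * (\<Prod>i\<in>A <+> C. x i u + z i t * y i u) = f (g u)" for u
    proof -
      have "f (g u) = (\<Prod>a\<in>A. l a u + (cis t - 1) * (l a w * h u w)) *
          (\<Prod>b\<in>C. cnj (m b u) + cnj (cis t - 1) * (cnj (m b w) * cnj (h u w)))"
        unfolding f_def g_def
        by (intro arg_cong2[where f = "(*)"] prod.cong refl)
          (simp_all add: complex_functionalD(1,2)[OF l] complex_functionalD(1,2)[OF m] mult_ac)
      then show ?thesis
        using assms(1,2) by (simp add: prod.Plus x_def y_def z_def)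
    qed
    moreover have "1 * (\<Prod>i\<in>A <+> C. x i u + z i 0 * y i u) = f u" for u
    proof -
      have "(\<Prod>i\<in>A <+> C. x i u + z i 0 * y i u) = (\<Prod>i\<in>A <+> C. x i u)"
        by (intro prod.cong) (auto simp: z_def)
      then show ?thesis using assms(1,2) by (simp add: prod.Plus x_def f_def)
    qed
    ultimately show ?thesis by (simp only: J_def)
  qed
  then have "J = (\<lambda>t. J 0)" by blast
  then have "(J has_vector_derivative 0) (at 0)"
    by (metis has_vector_derivative_const)
  ultimately have "(\<Sum>i\<in>A <+> C. d i * (\<integral>u. 1 * (y i u * (\<Prod>j\<in>(A <+> C) - {i}. x j u)) \<partial>\<mu>)) = 0"
    by (rule vector_derivative_unique_at)
  moreover have "(A <+> C) - {Inl a} = (A - {a}) <+> C" "(A <+> C) - {Inr b} = A <+> (C - {b})" for a b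
    by auto
  ultimately have "(\<Sum>a\<in>A. \<i> * (\<integral>u. (l a w * h u w) * ((\<Prod>i\<in>A - {a}. l i u) * (\<Prod>b\<in>C. cnj (m b u))) \<partial>\<mu>)) +
    (\<Sum>b\<in>C. - \<i> * (\<integral>u. (cnj (m b w) * cnj (h u w)) * ((\<Prod>a\<in>A. l a u) * (\<Prod>i\<in>C - {b}. cnj (m i u))) \<partial>\<mu>)) = 0"
    using assms(1,2) by (simp add: sum.Plus prod.Plus x_def y_def d_def)
  then have "\<i> * ((\<Sum>a\<in>A. l a w * (\<integral>u. h u w * ((\<Prod>i\<in>A - {a}. l i u) * (\<Prod>b\<in>C. cnj (m b u))) \<partial>\<mu>)) -
    (\<Sum>b\<in>C. cnj (m b w) * (\<integral>u. cnj (h u w) * ((\<Prod>a\<in>A. l a u) * (\<Prod>i\<in>C - {b}. cnj (m i u))) \<partial>\<mu>))) = 0"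
    by (simp add: mult.assoc sum_distrib_left right_diff_distrib sum_negf)
  then show ?thesis by simp
qed

lemma integral_h_linear:
  assumes "bounded_measurable F"
  shows "(\<integral>u. h u (x + y) * F u \<partial>\<mu>) = (\<integral>u. h u x * F u \<partial>\<mu>) + (\<integral>u. h u y * F u \<partial>\<mu>)"
    "(\<integral>u. h u (s c x) * F u \<partial>\<mu>) = cnj c * (\<integral>u. h u x * F u \<partial>\<mu>)"
    "(\<integral>u. cnj (h u (x + y)) * F u \<partial>\<mu>) = (\<integral>u. cnj (h u x) * F u \<partial>\<mu>) + (\<integral>u. cnj (h u y) * F u \<partial>\<mu>)"
    "(\<integral>u. cnj (h u (s c x)) * F u \<partial>\<mu>) = c * (\<integral>u. cnj (h u x) * F u \<partial>\<mu>)"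
proof -
  have "integrable \<mu> (\<lambda>u. h u x * F u)" "integrable \<mu> (\<lambda>u. cnj (h u x) * F u)" for x
    using assms by (auto intro!: bounded_measurable_integrable bounded_measurable_mult bounded_measurable_cnj bounded_measurable_h)
  then show "(\<integral>u. h u (x + y) * F u \<partial>\<mu>) = (\<integral>u. h u x * F u \<partial>\<mu>) + (\<integral>u. h u y * F u \<partial>\<mu>)"
    "(\<integral>u. h u (s c x) * F u \<partial>\<mu>) = cnj c * (\<integral>u. h u x * F u \<partial>\<mu>)"
    "(\<integral>u. cnj (h u (x + y)) * F u \<partial>\<mu>) = (\<integral>u. cnj (h u x) * F u \<partial>\<mu>) + (\<integral>u. cnj (h u y) * F u \<partial>\<mu>)"
    "(\<integral>u. cnj (h u (s c x)) * F u \<partial>\<mu>) = c * (\<integral>u. cnj (h u x) * F u \<partial>\<mu>)"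
    by (simp_all add: hD ring_distribs mult.assoc)
qed

text \<open>Invariance under the complexified Lie algebra of the unitary group: the derivation induced by
  the rank one endomorphism \<open>u \<mapsto> h u w v\<close> has integral zero.\<close>

lemma infinitesimal_invariance:
  assumes fin: "finite A" "finite C"
    and l: "\<And>a. a \<in> A \<Longrightarrow> complex_functional s (l a)" and m: "\<And>b. b \<in> C \<Longrightarrow> complex_functional s (m b)"
  shows "(\<Sum>a\<in>A. l a v * (\<integral>u. h u w * ((\<Prod>i\<in>A - {a}. l i u) * (\<Prod>b\<in>C. cnj (m b u))) \<partial>\<mu>)) =
    (\<Sum>b\<in>C. cnj (m b w) * (\<integral>u. cnj (h u v) * ((\<Prod>a\<in>A. l a u) * (\<Prod>i\<in>C - {b}. cnj (m i u))) \<partial>\<mu>))"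
proof -
  define F where "F a u = (\<Prod>i\<in>A - {a}. l i u) * (\<Prod>b\<in>C. cnj (m b u))" for a u
  define G where "G b u = (\<Prod>a\<in>A. l a u) * (\<Prod>i\<in>C - {b}. cnj (m i u))" for b u
  have F: "bounded_measurable (F a)" and G: "bounded_measurable (G b)" for a b
    unfolding F_def G_def by (auto intro!: bounded_measurable_intros bounded_measurable_functional[OF l] bounded_measurable_functional[OF m])
  define S where "S v w = (\<Sum>a\<in>A. l a v * (\<integral>u. h u w * F a u \<partial>\<mu>)) -
    (\<Sum>b\<in>C. cnj (m b w) * (\<integral>u. cnj (h u v) * G b u \<partial>\<mu>))" for v w
  have "S v w = 0"
  \<comment> \<open>\<open>S\<close> is linear in \<open>v\<close> and conjugate linear in
    \<open>w\<close>, so the diagonal case, which is about reflections, is enough.\<close>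
  proof (rule sesquilinear_eq_zero[where s = s])
    show "complex_functional s (\<lambda>v. S v w)" for w
      unfolding complex_functional_iff[OF vector_space_axioms] S_def
      by (simp add: complex_functionalD(1,2)[OF l] integral_h_linear(3,4)[OF G])
        (simp add: sum.distrib sum_distrib_left algebra_simps)
    show "complex_functional s (\<lambda>w. cnj (S v w))" for v
      unfolding complex_functional_iff[OF vector_space_axioms] S_def
      by (simp add: complex_functionalD(1,2)[OF m] integral_h_linear(1,2)[OF F])
        (simp add: sum.distrib sum_distrib_left algebra_simps)
    show "S w w = 0" for w
    proof (cases "w = 0")
      case True
      then show ?thesis by (simp add: S_def complex_functionalD(3)[OF l] hD)
    next
      case False
      \<comment> \<open>Reflections are taken along unit vectors. The factor is real, so rescaling
        multiplies \<open>S w w\<close> by \<open>c * c\<close>.\<close>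
      define c where "c = complex_of_real (1 / hnorm h w)"
      have "Re (h w w) > 0" using hermitian False by (simp add: hermitian_structure_def)
      then have n0: "hnorm h w \<noteq> 0" by (simp add: hnorm_def)
      then have c: "c \<noteq> 0" "cnj c = c" by (simp_all add: c_def)
      have cw: "h (s c w) (s c w) = 1"
        using n0 h_diag(1)[of w] by (simp add: c_def hD power2_eq_square)
      have "S (s c w) (s c w) = (\<Sum>a\<in>A. c * c * (l a w * (\<integral>u. h u w * F a u \<partial>\<mu>))) -
          (\<Sum>b\<in>C. c * c * (cnj (m b w) * (\<integral>u. cnj (h u w) * G b u \<partial>\<mu>)))"
        unfolding S_def by (intro arg_cong2[where f = "(-)"] sum.cong refl,
          simp_all only: complex_functionalD(2)[OF l] complex_functionalD(2)[OF m] c(2) complex_cnj_mult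
            integral_h_linear(2)[OF F] integral_h_linear(4)[OF G], simp_all only: mult_ac)
      then have "S (s c w) (s c w) = c * c * S w w"
        by (simp only: S_def sum_distrib_left right_diff_distrib)
      moreover have "S (s c w) (s c w) = 0"
        unfolding S_def F_def G_def using infinitesimal_reflection[OF fin l m cw] by simp
      ultimately show ?thesis using c(1) by simp
    qed
  qed
  then show ?thesis by (simp add: S_def F_def G_def)
qed

section \<open>Recursion and bounds for the moments\<close>

definition moment :: "('i \<Rightarrow> 'e \<Rightarrow> complex) \<Rightarrow> 'i set \<Rightarrow> ('j \<Rightarrow> 'e \<Rightarrow> complex) \<Rightarrow> 'j set \<Rightarrow> complex" where
  "moment l A m C = (\<integral>u. (\<Prod>a\<in>A. l a u) * (\<Prod>b\<in>C. cnj (m b u)) \<partial>\<mu>)"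

text \<open>In the infinitesimal invariance take for \<open>w\<close> the vector representing
  \<open>l a0\<close>, replace the factor \<open>l a0\<close> by \<open>\<lambda>u. h u e\<close>,
  put \<open>v = e\<close> and sum over the orthonormal basis. On the left, \<open>a = a0\<close>
  contributes \<open>h e e = 1\<close> for each \<open>e\<close>, hence \<open>card B\<close> copies
  of the moment, and every other \<open>a\<close> contributes one copy, because summing
  \<open>h u e * l a e\<close> restores \<open>l a u\<close>. On the right the sum of
  \<open>h u e * cnj (h u e)\<close> is \<open>h u u\<close>, which is 1 on the sphere.\<close>

lemma moment_recursion:
  assumes fin: "finite A" "finite C"
    and l: "\<And>a. a \<in> A \<Longrightarrow> complex_functional s (l a)" and m: "\<And>b. b \<in> C \<Longrightarrow> complex_functional s (m b)"
    and a0: "a0 \<in> A"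
  shows "of_nat (card A + card B - 1) * moment l A m C =
    (\<Sum>b\<in>C. dual_inner (l a0) (m b) * moment l (A - {a0}) m (C - {b}))"
proof -
  define \<nu> where "\<nu> = l a0"
  have \<nu>: "complex_functional s \<nu>" using l a0 by (simp add: \<nu>_def)
  \<comment> \<open>The factor \<open>l a0\<close> leaves the product and comes back as
    \<open>h u w\<close>, that is, as \<open>\<nu> u\<close> in \<open>key\<close>.\<close>
  define l' where "l' e = l(a0 := (\<lambda>u. h u e))" for e
  define P where "P u = (\<Prod>i\<in>A - {a0}. l i u)" for u
  define Q where "Q X u = (\<Prod>i\<in>X. cnj (m i u))" for X u
  have l': "complex_functional s (l' e a)" if "a \<in> A" for e a
  proof -
    have "complex_functional s (\<lambda>u. h u e)"
      using h_form unfolding hermitian_form_def by blast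
    then show ?thesis using l[OF that] by (simp add: l'_def)
  qed
  have Q: "bounded_measurable (Q X)" if "X \<subseteq> C" for X
    unfolding Q_def using that by (auto intro!: bounded_measurable_intros bounded_measurable_functional[OF m])
  have P: "bounded_measurable P"
    unfolding P_def by (auto intro!: bounded_measurable_intros bounded_measurable_functional[OF l])
  have key: "(\<Sum>a\<in>A. l' e a e * (\<integral>u. \<nu> u * ((\<Prod>i\<in>A - {a}. l' e i u) * Q C u) \<partial>\<mu>)) =
      (\<Sum>b\<in>C. dual_inner \<nu> (m b) * (\<integral>u. cnj (h u e) * (h u e * (P u * Q (C - {b}) u)) \<partial>\<mu>))" for e
  proof -
    have "(\<Prod>a\<in>A. l' e a u) = h u e * P u" for u
      unfolding prod.remove[OF fin(1) a0] P_def by (auto simp: l'_def intro!: prod.cong)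
    then show ?thesis
      using infinitesimal_invariance[where l = "l' e" and m = m and v = e and w = "riesz \<nu>", OF fin l' m]
      by (simp add: Q_def h_riesz[OF \<nu>] functional_riesz[OF m] mult.assoc)
  qed
  have P_eq: "(\<Prod>i\<in>A - {a0}. l' e i u) = P u" for e u
    unfolding P_def by (intro prod.cong) (auto simp: l'_def)
  have rest: "l a u * (\<Prod>i\<in>A - {a} - {a0}. l i u) = P u" if "a \<in> A - {a0}" for a u
  proof -
    have "A - {a0} - {a} = A - {a} - {a0}" by auto
    then show ?thesis
      using prod.remove[of "A - {a0}" a "\<lambda>i. l i u"] that fin(1) unfolding P_def by simp
  qed
  have P_eq': "(\<Prod>i\<in>A - {a}. l' e i u) = h u e * (\<Prod>i\<in>A - {a} - {a0}. l i u)" if "a \<in> A - {a0}" for a e u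
    using that a0 fin(1) prod.remove[of "A - {a}" a0 "\<lambda>i. l' e i u"] by (auto simp: l'_def intro!: prod.cong)
  have M: "moment l A m C = (\<integral>u. \<nu> u * (P u * Q C u) \<partial>\<mu>)"
    unfolding moment_def prod.remove[OF fin(1) a0] P_def Q_def \<nu>_def by (simp add: mult.assoc)
  have "(\<Sum>e\<in>B. \<Sum>a\<in>A. l' e a e * (\<integral>u. \<nu> u * ((\<Prod>i\<in>A - {a}. l' e i u) * Q C u) \<partial>\<mu>)) =
      (\<Sum>a\<in>A. \<Sum>e\<in>B. l' e a e * (\<integral>u. \<nu> u * ((\<Prod>i\<in>A - {a}. l' e i u) * Q C u) \<partial>\<mu>))"
    by (rule sum.swap)
  also have "\<dots> = (\<Sum>e\<in>B. l' e a0 e * (\<integral>u. \<nu> u * ((\<Prod>i\<in>A - {a0}. l' e i u) * Q C u) \<partial>\<mu>)) +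
      (\<Sum>a\<in>A - {a0}. \<Sum>e\<in>B. l' e a e * (\<integral>u. \<nu> u * ((\<Prod>i\<in>A - {a}. l' e i u) * Q C u) \<partial>\<mu>))"
    by (rule sum.remove[OF fin(1) a0])
  also have "(\<Sum>e\<in>B. l' e a0 e * (\<integral>u. \<nu> u * ((\<Prod>i\<in>A - {a0}. l' e i u) * Q C u) \<partial>\<mu>)) = of_nat (card B) * moment l A m C"
    by (simp add: P_eq M) (simp add: l'_def h_basis)
  also have "(\<Sum>a\<in>A - {a0}. \<Sum>e\<in>B. l' e a e * (\<integral>u. \<nu> u * ((\<Prod>i\<in>A - {a}. l' e i u) * Q C u) \<partial>\<mu>)) =
      (\<Sum>a\<in>A - {a0}. moment l A m C)"
  proof (intro sum.cong refl)
    fix a assume a: "a \<in> A - {a0}"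
    define R where "R u = (\<Prod>i\<in>A - {a} - {a0}. l i u)" for u
    have R: "bounded_measurable R"
      unfolding R_def by (auto intro!: bounded_measurable_intros bounded_measurable_functional[OF l])
    have l'_eq: "l' e a = l a" for e
      using a by (simp add: l'_def)
    have int: "integrable \<mu> (\<lambda>u. l a e * (\<nu> u * ((h u e * R u) * Q C u)))" for e
      by (intro bounded_measurable_integrable bounded_measurable_mult bounded_measurable_const
          bounded_measurable_functional[OF \<nu>] bounded_measurable_h R Q) auto
    have "(\<Sum>e\<in>B. l' e a e * (\<integral>u. \<nu> u * ((\<Prod>i\<in>A - {a}. l' e i u) * Q C u) \<partial>\<mu>)) =
        (\<Sum>e\<in>B. \<integral>u. l a e * (\<nu> u * ((h u e * R u) * Q C u)) \<partial>\<mu>)"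
      using a by (simp add: P_eq'[OF a] l'_eq R_def)
    also have "\<dots> = (\<integral>u. (\<Sum>e\<in>B. l a e * (\<nu> u * ((h u e * R u) * Q C u))) \<partial>\<mu>)"
      using int by (simp add: Bochner_Integration.integral_sum)
    also have "\<dots> = (\<integral>u. \<nu> u * (P u * Q C u) \<partial>\<mu>)"
    proof (intro Bochner_Integration.integral_cong refl)
      fix u
      have "(\<Sum>e\<in>B. l a e * (\<nu> u * ((h u e * R u) * Q C u))) = \<nu> u * (((\<Sum>e\<in>B. h u e * l a e) * R u) * Q C u)"
        by (simp add: sum_distrib_left sum_distrib_right mult_ac)
      also have "(\<Sum>e\<in>B. h u e * l a e) * R u = P u"
        using functional_expansion[of "l a" u] l a rest[OF a, of u] by (simp add: R_def)
      finally show "(\<Sum>e\<in>B. l a e * (\<nu> u * ((h u e * R u) * Q C u))) = \<nu> u * (P u * Q C u)" .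
    qed
    finally show "(\<Sum>e\<in>B. l' e a e * (\<integral>u. \<nu> u * ((\<Prod>i\<in>A - {a}. l' e i u) * Q C u) \<partial>\<mu>)) = moment l A m C"
      by (simp only: M)
  qed
  also have "of_nat (card B) * moment l A m C + (\<Sum>a\<in>A - {a0}. moment l A m C) = of_nat (card A + card B - 1) * moment l A m C"
  proof -
    have "card A = Suc (card (A - {a0}))" using fin(1) a0 by (metis card.remove)
    then show ?thesis by (simp add: algebra_simps)
  qed
  finally have "of_nat (card A + card B - 1) * moment l A m C =
      (\<Sum>e\<in>B. \<Sum>b\<in>C. dual_inner \<nu> (m b) * (\<integral>u. cnj (h u e) * (h u e * (P u * Q (C - {b}) u)) \<partial>\<mu>))"
    by (simp only: key)
  also have "\<dots> = (\<Sum>b\<in>C. \<Sum>e\<in>B. dual_inner \<nu> (m b) * (\<integral>u. cnj (h u e) * (h u e * (P u * Q (C - {b}) u)) \<partial>\<mu>))"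
    by (rule sum.swap)
  also have "\<dots> = (\<Sum>b\<in>C. dual_inner (l a0) (m b) * moment l (A - {a0}) m (C - {b}))"
  proof (intro sum.cong refl)
    fix b
    have int: "integrable \<mu> (\<lambda>u. cnj (h u e) * (h u e * (P u * Q (C - {b}) u)))" for e
      by (intro bounded_measurable_integrable bounded_measurable_mult bounded_measurable_cnj bounded_measurable_h P Q) auto
    have "(\<Sum>e\<in>B. \<integral>u. cnj (h u e) * (h u e * (P u * Q (C - {b}) u)) \<partial>\<mu>) =
        (\<integral>u. (\<Sum>e\<in>B. cnj (h u e) * (h u e * (P u * Q (C - {b}) u))) \<partial>\<mu>)"
      using int by (simp add: Bochner_Integration.integral_sum)
    also have "\<dots> = (\<integral>u. P u * Q (C - {b}) u \<partial>\<mu>)"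
    proof (intro Bochner_Integration.integral_cong refl)
      fix u assume "u \<in> space \<mu>"
      then have "h u u = 1" using h_diag(1)[of u] by (simp add: space_eq)
      have "(\<Sum>e\<in>B. cnj (h u e) * (h u e * (P u * Q (C - {b}) u))) = (\<Sum>e\<in>B. h u e * cnj (h u e)) * (P u * Q (C - {b}) u)"
        by (simp add: sum_distrib_left sum_distrib_right mult_ac)
      then show "(\<Sum>e\<in>B. cnj (h u e) * (h u e * (P u * Q (C - {b}) u))) = P u * Q (C - {b}) u"
        by (simp add: h_basis_sum \<open>h u u = 1\<close>)
    qed
    finally show "(\<Sum>e\<in>B. dual_inner \<nu> (m b) * (\<integral>u. cnj (h u e) * (h u e * (P u * Q (C - {b}) u)) \<partial>\<mu>)) =
        dual_inner (l a0) (m b) * moment l (A - {a0}) m (C - {b})"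
      by (simp add: sum_distrib_left[symmetric] moment_def P_def Q_def \<nu>_def)
  qed
  finally show ?thesis .
qed

lemma moment_commute: "moment l A m C = cnj (moment m C l A)"
proof -
  have "cnj (moment m C l A) = (\<integral>u. cnj ((\<Prod>a\<in>C. m a u) * (\<Prod>b\<in>A. cnj (l b u))) \<partial>\<mu>)"
    unfolding moment_def by (rule Bochner_Integration.integral_cnj[symmetric])
  then show ?thesis by (simp add: moment_def mult.commute)
qed

text \<open>Each of the \<open>p + 1\<close> terms of the recursion is bounded by Cauchy-Schwarz for
  \<open>dual_inner\<close> and the induction hypothesis. The norms of \<open>l a0\<close> and
  \<open>m b\<close> complete the two products, so all terms have the same bound.\<close>

lemma cmod_moment_le:
  assumes "finite A" "finite C" "card A = p" "card C = p"
    and l: "\<And>a. a \<in> A \<Longrightarrow> complex_functional s (l a)" and m: "\<And>b. b \<in> C \<Longrightarrow> complex_functional s (m b)"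
  shows "cmod (moment l A m C) \<le> fact p * fact (card B - 1) / fact (p + card B - 1) *
    ((\<Prod>a\<in>A. dual_norm h (l a)) * (\<Prod>b\<in>C. dual_norm h (m b)))"
  using assms
proof (induction p arbitrary: A C)
  case 0
  then have "A = {}" "C = {}" by auto
  then show ?case by (simp add: moment_def prob_space)
next
  case (Suc p)
  define N where "N X = (\<Prod>x\<in>X. dual_norm h (l x))" for X
  define N' where "N' X = (\<Prod>x\<in>X. dual_norm h (m x))" for X
  define r where "r = card B"
  have r: "0 < r" using card_B_pos by (simp add: r_def)
  define K where "K p = (fact p * fact (r - 1) / fact (p + r - 1) :: real)" for p
  obtain a0 where a0: "a0 \<in> A" using Suc.prems(3) by fastforce
  have "real (Suc p + r - 1) * cmod (moment l A m C) = cmod (of_nat (card A + card B - 1) * moment l A m C)"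
    by (simp only: norm_mult norm_of_nat Suc.prems(3) r_def)
  also have "\<dots> = cmod (\<Sum>b\<in>C. dual_inner (l a0) (m b) * moment l (A - {a0}) m (C - {b}))"
    using moment_recursion[OF Suc.prems(1,2,5,6) a0] by simp
  also have "\<dots> \<le> (\<Sum>b\<in>C. cmod (dual_inner (l a0) (m b) * moment l (A - {a0}) m (C - {b})))"
    by (rule norm_sum)
  also have "\<dots> \<le> (\<Sum>b\<in>C. K p * (N A * N' C))"
  proof (rule sum_mono)
    fix b assume b: "b \<in> C"
    have "cmod (dual_inner (l a0) (m b) * moment l (A - {a0}) m (C - {b})) \<le>
        (dual_norm h (l a0) * dual_norm h (m b)) * (K p * (N (A - {a0}) * N' (C - {b})))"
      unfolding norm_mult
    proof (rule mult_mono)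
      show "cmod (dual_inner (l a0) (m b)) \<le> dual_norm h (l a0) * dual_norm h (m b)"
        using Suc.prems(5,6) a0 b by (intro cmod_dual_inner_le) auto
      show "cmod (moment l (A - {a0}) m (C - {b})) \<le> K p * (N (A - {a0}) * N' (C - {b}))"
        unfolding K_def r_def N_def N'_def using Suc.prems a0 b by (intro Suc.IH) auto
      show "0 \<le> dual_norm h (l a0) * dual_norm h (m b)"
        using Suc.prems(5,6) a0 b by (auto intro!: mult_nonneg_nonneg dual_norm_nonneg)
    qed simp
    also have "\<dots> = K p * ((dual_norm h (l a0) * N (A - {a0})) * (dual_norm h (m b) * N' (C - {b})))"
      by (simp only: mult_ac)
    also have "\<dots> = K p * (N A * N' C)"
      unfolding N_def N'_def prod.remove[OF Suc.prems(1) a0] prod.remove[OF Suc.prems(2) b] ..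
    finally show "cmod (dual_inner (l a0) (m b) * moment l (A - {a0}) m (C - {b})) \<le> K p * (N A * N' C)" .
  qed
  also have "\<dots> = real (Suc p) * K p * (N A * N' C)"
    using Suc.prems(4) by simp
  \<comment> \<open>The numerator gains the number \<open>p + 1\<close> of terms, the denominator
    the factor \<open>p + r\<close> of the recursion.\<close>
  also have "real (Suc p) * K p = real (Suc p + r - 1) * K (Suc p)"
  proof -
    define X where "X = real (Suc p + r - 1)"
    have X: "X > 0" "fact (Suc p + r - 1) = X * fact (p + r - 1)"
      using r by (auto simp: X_def gr0_conv_Suc)
    then show ?thesis
      unfolding X_def[symmetric] K_def by (simp add: fact_Suc)
  qed
  finally have "real (Suc p + r - 1) * cmod (moment l A m C) \<le> real (Suc p + r - 1) * (K (Suc p) * (N A * N' C))"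
    by (simp only: mult.assoc)
  then have "cmod (moment l A m C) \<le> K (Suc p) * (N A * N' C)"
    using r by (subst (asm) mult_le_cancel_left_pos) auto
  then show ?case by (simp only: K_def r_def N_def N'_def)
qed

text \<open>The squared norm of an annihilation operator; it is what remains in \<open>moment_ge\<close> after commuting
  the creation operator, multiplication by a linear form, with its adjoint.\<close>

lemma annihilation_norm_nonneg:
  assumes fin: "finite A" and l: "\<And>a. a \<in> A \<Longrightarrow> complex_functional s (l a)"
  shows "0 \<le> Re (\<Sum>b\<in>A. \<Sum>a\<in>A. c b * cnj (c a) * moment l (A - {a}) l (A - {b}))"
proof -
  \<comment> \<open>The sum of the \<open>G b\<close> is the conjugate of the annihilation operator
    applied to the product of the \<open>l i\<close>; the double sum is the integral of its squared
    modulus.\<close>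
  define G where "G b u = c b * (\<Prod>i\<in>A - {b}. cnj (l i u))" for b u
  have G: "bounded_measurable (G b)" for b
    unfolding G_def by (auto intro!: bounded_measurable_intros bounded_measurable_functional[OF l])
  have int: "integrable \<mu> (\<lambda>u. G b u * cnj (G a u))" for a b
    by (intro bounded_measurable_integrable bounded_measurable_mult bounded_measurable_cnj G)
  have "c b * cnj (c a) * moment l (A - {a}) l (A - {b}) = (\<integral>u. G b u * cnj (G a u) \<partial>\<mu>)" for a b
    unfolding moment_def G_def by (subst integral_mult_right_zero[symmetric]) (simp add: mult_ac)
  then have "(\<Sum>b\<in>A. \<Sum>a\<in>A. c b * cnj (c a) * moment l (A - {a}) l (A - {b})) =
      (\<integral>u. (\<Sum>b\<in>A. \<Sum>a\<in>A. G b u * cnj (G a u)) \<partial>\<mu>)"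
    using int by (simp add: Bochner_Integration.integral_sum)
  also have "\<dots> = (\<integral>u. of_real ((cmod (\<Sum>b\<in>A. G b u))\<^sup>2) \<partial>\<mu>)"
    by (intro Bochner_Integration.integral_cong refl)
      (simp only: complex_norm_square sum_product cnj_sum)
  also have "\<dots> = of_real (\<integral>u. (cmod (\<Sum>b\<in>A. G b u))\<^sup>2 \<partial>\<mu>)"
    by (rule integral_complex_of_real)
  finally show ?thesis by simp
qed

text \<open>In the recursion at \<open>a0\<close> the term \<open>b = a0\<close> is covered by the
  induction hypothesis and already gives the bound. The sum \<open>S\<close> of the other terms is
  nonnegative: \<open>a0\<close> now occurs only in the conjugate factor, and a second use of the
  recursion removes it there, leaving the squared norm of
  \<open>annihilation_norm_nonneg\<close>.\<close>

lemma moment_ge: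
  assumes "finite A" and l: "\<And>a. a \<in> A \<Longrightarrow> complex_functional s (l a)"
  shows "fact (card B - 1) / fact (card A + card B - 1) * (\<Prod>a\<in>A. (dual_norm h (l a))\<^sup>2) \<le> Re (moment l A l A)"
  using assms
proof (induction A rule: finite_induct)
  case empty
  then show ?case by (simp add: moment_def prob_space)
next
  case (insert a0 A)
  define r where "r = card B"
  define p where "p = card A"
  obtain q where q: "r = Suc q" using card_B_pos gr0_conv_Suc by (auto simp: r_def)
  define A' where "A' = insert a0 A"
  have A': "finite A'" "card A' = Suc p" "A' - {a0} = A"
    using insert.hyps by (auto simp: A'_def p_def)
  have l: "complex_functional s (l a)" if "a \<in> A'" for a
    using insert.prems that by (simp add: A'_def)
  define c where "c b = dual_inner (l a0) (l b)" for b
  define N where "N = (\<Prod>a\<in>A. (dual_norm h (l a))\<^sup>2)"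
  define S where "S = (\<Sum>b\<in>A. c b * moment l A l (A' - {b}))"
  have "of_nat (card A' + card B - 1) * moment l A' l A' = (\<Sum>b\<in>A'. c b * moment l A l (A' - {b}))"
    using moment_recursion[where l = l and m = l and ?a0.0 = a0, OF A'(1,1) l l] A'(3) by (simp add: c_def A'_def)
  also have "\<dots> = c a0 * moment l A l A + S"
    using insert.hyps A'(3) by (simp add: A'_def S_def)
  also have "c a0 = of_real ((dual_norm h (l a0))\<^sup>2)"
    unfolding c_def by (rule dual_inner_self) (simp add: l A'_def)
  finally have "of_real (real (p + r)) * moment l A' l A' =
      of_real ((dual_norm h (l a0))\<^sup>2) * moment l A l A + S"
    using A'(2) by (simp add: r_def)
  then have "Re (of_real (real (p + r)) * moment l A' l A') =
      Re (of_real ((dual_norm h (l a0))\<^sup>2) * moment l A l A + S)"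
    by (rule arg_cong)
  then have main: "real (p + r) * Re (moment l A' l A') = (dual_norm h (l a0))\<^sup>2 * Re (moment l A l A) + Re S"
    by (simp only: Re_complex_of_real plus_complex.sel times_complex.sel Im_complex_of_real mult_zero_left diff_zero)
  have "0 \<le> Re S"
  \<comment> \<open>The second recursion is divided by \<open>p + r - 1\<close>, which vanishes for
    \<open>p = 0\<close> and \<open>r = 1\<close>; for empty \<open>A\<close> the sum
    \<open>S\<close> is empty.\<close>
  proof (cases "A = {}")
    case True
    then show ?thesis by (simp add: S_def)
  next
    case False
    \<comment> \<open>Conjugating the moments brings \<open>a0\<close> to the side on which the
      recursion acts.\<close>
    have "of_real (real (p + r - 1)) * S = (\<Sum>b\<in>A. c b * cnj (of_nat (p + r - 1) * moment l (A' - {b}) l A))"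
      unfolding S_def sum_distrib_left by (intro sum.cong refl) (simp add: moment_commute[of l A] mult_ac)
    also have "\<dots> = (\<Sum>b\<in>A. c b * cnj (\<Sum>a\<in>A. c a * moment l (A - {b}) l (A - {a})))"
    proof (intro sum.cong refl)
      fix b assume b: "b \<in> A"
      have "card (A' - {b}) = p" "A' - {b} - {a0} = A - {b}" "a0 \<in> A' - {b}"
        using b A' insert.hyps by (auto simp: A'_def)
      then show "c b * cnj (of_nat (p + r - 1) * moment l (A' - {b}) l A) =
          c b * cnj (\<Sum>a\<in>A. c a * moment l (A - {b}) l (A - {a}))"
        using moment_recursion[where A = "A' - {b}" and C = A and l = l and m = l and ?a0.0 = a0] A'(1) insert.hyps l
        by (auto simp: c_def r_def A'_def)
    qed
    also have "\<dots> = (\<Sum>b\<in>A. \<Sum>a\<in>A. c b * cnj (c a) * moment l (A - {a}) l (A - {b}))"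
      by (simp add: sum_distrib_left mult.assoc moment_commute[symmetric])
    finally have "0 \<le> Re (of_real (real (p + r - 1)) * S)"
      using annihilation_norm_nonneg[OF insert.hyps(1), of l c] insert.prems by simp
    then have "0 \<le> real (p + r - 1) * Re S"
      by (simp only: Re_complex_of_real times_complex.sel Im_complex_of_real mult_zero_left diff_zero)
    moreover have "0 < real (p + r - 1)"
    proof -
      have "0 < p" using False insert.hyps(1) by (simp add: p_def card_gt_0_iff)
      then show ?thesis using q by simp
    qed
    ultimately show ?thesis by (simp add: zero_le_mult_iff)
  qed
  then have "(dual_norm h (l a0))\<^sup>2 * Re (moment l A l A) \<le> real (p + r) * Re (moment l A' l A')"
    using main by simp
  moreover have "(dual_norm h (l a0))\<^sup>2 * (fact (r - 1) / fact (p + r - 1) * N) \<le> (dual_norm h (l a0))\<^sup>2 * Re (moment l A l A)"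
    unfolding p_def r_def N_def using insert.prems by (intro mult_left_mono insert.IH) auto
  ultimately have "(dual_norm h (l a0))\<^sup>2 * (fact (r - 1) / fact (p + r - 1) * N) \<le> real (p + r) * Re (moment l A' l A')"
    by linarith
  moreover define X where "X = real (p + r)"
  ultimately have le: "(dual_norm h (l a0))\<^sup>2 * (fact (r - 1) / fact (p + r - 1) * N) \<le> Re (moment l A' l A') * X"
    by (simp add: mult.commute del: of_nat_add)
  have X: "X > 0" "fact (Suc p + r - 1) = X * fact (p + r - 1)"
    by (simp_all add: X_def q)
  have "fact (r - 1) / fact (Suc p + r - 1) * ((dual_norm h (l a0))\<^sup>2 * N) =
      (dual_norm h (l a0))\<^sup>2 * (fact (r - 1) / fact (p + r - 1) * N) / X"
    unfolding X(2) by (simp add: mult_ac)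
  also have "\<dots> \<le> Re (moment l A' l A')"
    using le X(1) by (simp only: pos_divide_le_eq)
  finally have "fact (r - 1) / fact (Suc p + r - 1) * ((dual_norm h (l a0))\<^sup>2 * N) \<le> Re (moment l A' l A')" .
  then show ?case
    using insert.hyps by (simp add: A'_def N_def p_def r_def)
qed

section \<open>Integrals of products of squared moduli\<close>

definition norm_moment :: "('e \<Rightarrow> complex) list \<Rightarrow> real" where
  "norm_moment ls = (\<integral>u. (\<Prod>l\<leftarrow>ls. (cmod (l u))\<^sup>2) \<partial>\<mu>)"

lemma norm_moment_eq: "moment ((!) ls) {..<length ls} ((!) ls) {..<length ls} = of_real (norm_moment ls)"
proof -
  have "(\<Prod>i<length ls. (ls ! i) u) * (\<Prod>i<length ls. cnj ((ls ! i) u)) = of_real (\<Prod>l\<leftarrow>ls. (cmod (l u))\<^sup>2)" for u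
  proof -
    have "(\<Prod>l\<leftarrow>ls. (cmod (l u))\<^sup>2) = (\<Prod>i<length ls. (cmod ((ls ! i) u))\<^sup>2)"
      by (simp add: prod.list_conv_set_nth lessThan_atLeast0)
    then show ?thesis
      by (simp only: of_real_prod complex_norm_square prod.distrib)
  qed
  then show ?thesis
    unfolding moment_def norm_moment_def by simp
qed

lemma norm_moment_bounds:
  assumes "\<And>l. l \<in> set ls \<Longrightarrow> complex_functional s l"
  shows "fact (card B - 1) / fact (length ls + card B - 1) * (\<Prod>l\<leftarrow>ls. (dual_norm h l)\<^sup>2) \<le> norm_moment ls"
    and "norm_moment ls \<le> fact (length ls) * fact (card B - 1) / fact (length ls + card B - 1) * (\<Prod>l\<leftarrow>ls. (dual_norm h l)\<^sup>2)"
proof -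
  have *: "(\<Prod>l\<leftarrow>ls. (dual_norm h l)\<^sup>2) = (\<Prod>i<length ls. (dual_norm h (ls ! i))\<^sup>2)"
    by (simp add: prod.list_conv_set_nth lessThan_atLeast0)
  have **: "(\<Prod>l\<leftarrow>ls. (dual_norm h l)\<^sup>2) = (\<Prod>i<length ls. dual_norm h (ls ! i)) * (\<Prod>i<length ls. dual_norm h (ls ! i))"
    unfolding * by (simp only: power2_eq_square prod.distrib)
  have l: "complex_functional s (ls ! i)" if "i \<in> {..<length ls}" for i
    using that assms by simp
  show "fact (card B - 1) / fact (length ls + card B - 1) * (\<Prod>l\<leftarrow>ls. (dual_norm h l)\<^sup>2) \<le> norm_moment ls"
    using moment_ge[of "{..<length ls}" "(!) ls"] l unfolding norm_moment_eq * by simp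
  have "norm_moment ls \<le> cmod (moment ((!) ls) {..<length ls} ((!) ls) {..<length ls})"
    unfolding norm_moment_eq by simp
  also have "\<dots> \<le> fact (length ls) * fact (card B - 1) / fact (length ls + card B - 1) *
      ((\<Prod>i<length ls. dual_norm h (ls ! i)) * (\<Prod>i<length ls. dual_norm h (ls ! i)))"
    by (rule cmod_moment_le) (use l in auto)
  finally show "norm_moment ls \<le> fact (length ls) * fact (card B - 1) / fact (length ls + card B - 1) * (\<Prod>l\<leftarrow>ls. (dual_norm h l)\<^sup>2)"
    by (simp only: **)
qed

lemma integrable_norm_moment:
  assumes "\<And>l. l \<in> set ls \<Longrightarrow> complex_functional s l"
  shows "integrable \<mu> (\<lambda>u. \<Prod>l\<leftarrow>ls. (cmod (l u))\<^sup>2)"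
proof -
  have "bounded_measurable (\<lambda>u. (\<Prod>i<length ls. (ls ! i) u))"
    by (rule bounded_measurable_prod) (simp add: assms bounded_measurable_functional)
  then have "integrable \<mu> (\<lambda>u. Re ((\<Prod>i<length ls. (ls ! i) u) * cnj (\<Prod>i<length ls. (ls ! i) u)))"
    by (intro integrable_Re bounded_measurable_integrable bounded_measurable_mult bounded_measurable_cnj)
  moreover have "Re ((\<Prod>i<length ls. (ls ! i) u) * cnj (\<Prod>i<length ls. (ls ! i) u)) = (\<Prod>l\<leftarrow>ls. (cmod (l u))\<^sup>2)" for u
  proof -
    have "(\<Prod>l\<leftarrow>ls. (cmod (l u))\<^sup>2) = (\<Prod>i<length ls. (cmod ((ls ! i) u))\<^sup>2)"
      by (simp add: prod.list_conv_set_nth lessThan_atLeast0)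
    also have "\<dots> = (cmod (\<Prod>i<length ls. (ls ! i) u))\<^sup>2"
      by (simp add: prod_norm[symmetric] prod_power_distrib)
    finally show ?thesis
      by (simp only: complex_norm_square[symmetric] Re_complex_of_real)
  qed
  ultimately show ?thesis by simp
qed

end

section \<open>The inequalities for hermitian tensors\<close>

lemma h_trace_eq: "h_trace B \<theta> = form_of_hermitian (\<lambda>\<xi> \<eta>. \<Sum>e\<in>B. \<theta> \<xi> e \<eta> e)"
  by (simp add: h_trace_def contract_def form_of_hermitian_def fun_eq_iff right_diff_distrib sum_distrib_left sum_subtractf)

lemma hermitian_tensor_form_left:
  "hermitian_tensor sT sE \<theta> \<Longrightarrow> hermitian_form sT (\<lambda>\<xi> \<eta>. \<theta> \<xi> u \<eta> u)"
  unfolding hermitian_tensor_def hermitian_form_def by blast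

lemma hermitian_tensor_form_right:
  "hermitian_tensor sT sE \<theta> \<Longrightarrow> hermitian_form sE (\<lambda>u v. \<theta> \<xi> u \<xi> v)"
  unfolding hermitian_tensor_def hermitian_form_def by blast

lemma griffiths_semipositive_form_left:
  "hermitian_tensor sT sE \<theta> \<Longrightarrow> griffiths_semipositive \<theta> \<Longrightarrow> semipositive_form sT (\<lambda>\<xi> \<eta>. \<theta> \<xi> u \<eta> u)"
  using hermitian_tensor_form_left[of sT sE \<theta> u]
  by (auto simp: semipositive_form_def griffiths_semipositive_def complex_nonneg_Reals_iff)

lemma griffiths_semipositive_form_right:
  "hermitian_tensor sT sE \<theta> \<Longrightarrow> griffiths_semipositive \<theta> \<Longrightarrow> semipositive_form sE (\<lambda>u v. \<theta> \<xi> u \<xi> v)"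
  using hermitian_tensor_form_right[of sT sE \<theta> \<xi>]
  by (auto simp: semipositive_form_def griffiths_semipositive_def complex_nonneg_Reals_iff)

lemma semipositive_form_sum:
  assumes "vector_space s" "\<And>x. x \<in> X \<Longrightarrow> semipositive_form s (H x)"
  shows "semipositive_form s (\<lambda>u v. \<Sum>x\<in>X. H x u v)"
proof -
  have zero: "semipositive_form s (\<lambda>u v. 0)"
    by (simp add: semipositive_form_def hermitian_form_def complex_functional_iff[OF assms(1)])
  show ?thesis
    using assms(2)
  proof (induction X rule: infinite_finite_induct)
    case (insert x X)
    then show ?case
      using hermitian_form_add[of s "H x" "\<lambda>u v. \<Sum>x\<in>X. H x u v"] by (auto simp: semipositive_form_def)
  qed (simp_all add: zero)
qed

text \<open>Testing the definition on a single simple tensor determines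
  \<open>\<theta> \<xi> u \<xi> u\<close>; for fixed \<open>u\<close>, polarisation in \<xi> then
  determines the whole form.\<close>

lemma strongly_semipositive_contract:
  assumes \<theta>: "hermitian_tensor sT sE \<theta>" "strongly_semipositive sT sE \<theta>"
  shows "\<exists>F. (\<forall>x\<in>set F. complex_functional sT (fst x) \<and> complex_functional sE (snd x)) \<and>
    (\<forall>u. contract \<theta> u = (\<lambda>v. \<Sum>x\<leftarrow>F. of_real ((cmod (snd x u))\<^sup>2) * i_wedge_conj (fst x) v))"
proof -
  obtain F where F: "\<And>x. x \<in> set F \<Longrightarrow> complex_functional sT (fst x) \<and> complex_functional sE (snd x)"
    and eq: "\<And>\<tau>. (\<Sum>(\<xi>, u)\<leftarrow>\<tau>. \<Sum>(\<eta>, v)\<leftarrow>\<tau>. \<theta> \<xi> u \<eta> v) =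
      of_real (\<Sum>(\<alpha>, \<psi>)\<leftarrow>F. (cmod (\<Sum>(\<xi>, u)\<leftarrow>\<tau>. \<alpha> \<xi> * \<psi> u))\<^sup>2)"
    using \<theta>(2) unfolding strongly_semipositive_def by fastforce
  have "contract \<theta> u = (\<lambda>v. \<Sum>x\<leftarrow>F. of_real ((cmod (snd x u))\<^sup>2) * i_wedge_conj (fst x) v)" for u
  proof -
    define K where "K \<xi> \<eta> = (\<Sum>x\<leftarrow>F. of_real ((cmod (snd x u))\<^sup>2) * (fst x \<xi> * cnj (fst x \<eta>)))" for \<xi> \<eta>
    have herm: "hermitian_form sT (\<lambda>\<xi> \<eta>. \<theta> \<xi> u \<eta> u)"
      by (rule hermitian_tensor_form_left[OF \<theta>(1)])
    then have vs: "vector_space sT"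
      unfolding hermitian_form_def Vector_Spaces.linear_def by blast
    have "\<theta> \<xi> u \<eta> u = K \<xi> \<eta>" for \<xi> \<eta>
    proof (rule hermitian_form_eqI[OF herm])
      show "hermitian_form sT K"
        unfolding K_def
        by (rule hermitian_form_sum_list[OF vs]) (intro hermitian_form_rank_one, use F in auto)
      show "\<theta> \<xi> u \<xi> u = K \<xi> \<xi>" for \<xi>
      proof -
        have "\<theta> \<xi> u \<xi> u = of_real (\<Sum>x\<leftarrow>F. (cmod (snd x u * fst x \<xi>))\<^sup>2)"
          using eq[of "[(\<xi>, u)]"] by (simp add: case_prod_unfold mult.commute)
        also have "\<dots> = K \<xi> \<xi>"
          unfolding K_def
          by (induction F) (simp_all add: norm_mult power_mult_distrib complex_norm_square[symmetric])
        finally show ?thesis .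
      qed
    qed
    then have "contract \<theta> u = form_of_hermitian K"
      unfolding contract_def by simp
    then show ?thesis
      unfolding K_def form_of_hermitian_sum .
  qed
  with F show ?thesis by blast
qed

lemma prod_of_real: "prod_list (map (\<lambda>x. of_real (g x)) xs) = (of_real (prod_list (map g xs)) :: complex)"
  by (induction xs) auto

lemma integral_sum_list:
  fixes f :: "'b \<Rightarrow> 'a \<Rightarrow> 'c::{banach, second_countable_topology}"
  assumes "\<And>x. x \<in> set xs \<Longrightarrow> integrable M (f x)"
  shows "(\<integral>u. (\<Sum>x\<leftarrow>xs. f x u) \<partial>M) = (\<Sum>x\<leftarrow>xs. \<integral>u. f x u \<partial>M)" "integrable M (\<lambda>u. \<Sum>x\<leftarrow>xs. f x u)"
  using assms by (induction xs) auto

context invariant_sphere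
begin

text \<open>The integral and the bound expand into the same elementary forms \<open>W xs\<close>,
  indexed by the same choices \<open>xs\<close>. So it suffices to compare coefficients: the moment
  of the linear forms \<open>ls @ map snd xs\<close> against the product of their squared
  norms.\<close>

lemma strong_inequalities:
  fixes sT :: "complex \<Rightarrow> 't \<Rightarrow> 't::ab_group_add"
  assumes ls: "length ls = k" "\<And>l. l \<in> set ls \<Longrightarrow> complex_functional s l"
    and \<theta>s: "length \<theta>s = q" "\<And>\<theta>. \<theta> \<in> set \<theta>s \<Longrightarrow> hermitian_tensor sT s \<theta> \<and> strongly_semipositive sT s \<theta>"
  shows "strong_ge sT q (sphere_integral \<mu> ls \<theta>s)
      (bound_form (fact (card B - 1) / fact (k + q + card B - 1)) h ls (map (h_trace B) \<theta>s))"
    and "strong_ge sT q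
      (bound_form (fact (k + q) * fact (card B - 1) / fact (k + q + card B - 1)) h ls (map (h_trace B) \<theta>s))
      (sphere_integral \<mu> ls \<theta>s)"
proof -
  have "\<forall>\<theta>\<in>set \<theta>s. \<exists>F. (\<forall>x\<in>set F. complex_functional sT (fst x) \<and> complex_functional s (snd x)) \<and>
      (\<forall>u. contract \<theta> u = (\<lambda>v. \<Sum>x\<leftarrow>F. of_real ((cmod (snd x u))\<^sup>2) * i_wedge_conj (fst x) v))"
    by (intro ballI strongly_semipositive_contract) (use \<theta>s(2) in blast)+
  from bchoice[OF this] obtain f where f: "\<And>\<theta> x. \<theta> \<in> set \<theta>s \<Longrightarrow> x \<in> set (f \<theta>) \<Longrightarrow> complex_functional sT (fst x) \<and> complex_functional s (snd x)"
    "\<And>\<theta> u. \<theta> \<in> set \<theta>s \<Longrightarrow> contract \<theta> u = (\<lambda>v. \<Sum>x\<leftarrow>f \<theta>. of_real ((cmod (snd x u))\<^sup>2) * i_wedge_conj (fst x) v)"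
    by blast
  define L where "L = product_lists (map f \<theta>s)"
  have L: "length xs = q" "\<And>x. x \<in> set xs \<Longrightarrow> complex_functional sT (fst x) \<and> complex_functional s (snd x)"
    if "xs \<in> set L" for xs
  proof -
    show len: "length xs = q"
      using length_in_product_lists[OF that[unfolded L_def]] \<theta>s(1) by simp
    fix x assume "x \<in> set xs"
    then obtain i where "i < q" "x = xs ! i" using len by (auto simp: in_set_conv_nth)
    then have "x \<in> set (f (\<theta>s ! i))" "\<theta>s ! i \<in> set \<theta>s"
      using in_product_listsD[OF that[unfolded L_def], of i] \<theta>s(1) by auto
    then show "complex_functional sT (fst x) \<and> complex_functional s (snd x)"
      using f(1) by blast
  qed
  define W where "W xs = wedge_list (map i_wedge_conj (map fst xs))" for xs :: "(('t \<Rightarrow> complex) \<times> ('e \<Rightarrow> complex)) list"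
  define P where "P = (\<Prod>l\<leftarrow>ls. (dual_norm h l)\<^sup>2)"
  define Q where "Q xs = (\<Prod>x\<leftarrow>xs. (dual_norm h (snd x))\<^sup>2)" for xs :: "(('t \<Rightarrow> complex) \<times> ('e \<Rightarrow> complex)) list"
  have integral: "sphere_integral \<mu> ls \<theta>s v = (\<Sum>xs\<leftarrow>L. of_real (norm_moment (ls @ map snd xs)) * W xs v)" for v
  proof -
    have "wedge_list (map (\<lambda>\<theta>. contract \<theta> u) \<theta>s) v =
        (\<Sum>xs\<leftarrow>L. of_real (\<Prod>x\<leftarrow>xs. (cmod (snd x u))\<^sup>2) * W xs v)" for u
    proof -
      have m: "map (\<lambda>\<theta>. contract \<theta> u) \<theta>s =
          map (\<lambda>F v. \<Sum>x\<leftarrow>F. of_real ((cmod (snd x u))\<^sup>2) * i_wedge_conj (fst x) v) (map f \<theta>s)"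
        using f(2) by simp
      show ?thesis
        unfolding L_def W_def m wedge_list_expand by (simp add: prod_of_real o_def del: of_real_power)
    qed
    then have "sphere_integral \<mu> ls \<theta>s v = (\<integral>u. (\<Sum>xs\<leftarrow>L. of_real (\<Prod>l\<leftarrow>ls @ map snd xs. (cmod (l u))\<^sup>2) * W xs v) \<partial>\<mu>)"
      unfolding sphere_integral_def
      by (intro Bochner_Integration.integral_cong refl)
        (simp add: sum_list_const_mult[symmetric] mult.assoc o_def)
    also have "\<dots> = (\<Sum>xs\<leftarrow>L. \<integral>u. of_real (\<Prod>l\<leftarrow>ls @ map snd xs. (cmod (l u))\<^sup>2) * W xs v \<partial>\<mu>)"
      using ls(2) L(2) by (intro integral_sum_list integrable_mult_left integrable_of_real integrable_norm_moment) auto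
    also have "\<dots> = (\<Sum>xs\<leftarrow>L. of_real (norm_moment (ls @ map snd xs)) * W xs v)"
    proof -
      have "(\<integral>u. of_real (\<Prod>l\<leftarrow>ls @ map snd xs. (cmod (l u))\<^sup>2) * W xs v \<partial>\<mu>) = of_real (norm_moment (ls @ map snd xs)) * W xs v" for xs
        unfolding norm_moment_def integral_mult_left_zero integral_complex_of_real ..
      then show ?thesis by (simp only:)
    qed
    finally show ?thesis .
  qed
  have bound: "bound_form c h ls (map (h_trace B) \<theta>s) v = (\<Sum>xs\<leftarrow>L. of_real (c * (P * Q xs)) * W xs v)" for c v
  proof -
    \<comment> \<open>Only the factor |\<psi>(e)|^2 depends on \<open>e\<close>, and its sum over
      the orthonormal basis is the squared dual norm.\<close>
    have "h_trace B \<theta> = (\<lambda>v. \<Sum>x\<leftarrow>f \<theta>. of_real ((dual_norm h (snd x))\<^sup>2) * i_wedge_conj (fst x) v)" if "\<theta> \<in> set \<theta>s" for \<theta>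
    proof
      fix v
      have "h_trace B \<theta> v = (\<Sum>e\<in>B. \<Sum>x\<leftarrow>f \<theta>. of_real ((cmod (snd x e))\<^sup>2) * i_wedge_conj (fst x) v)"
        by (simp add: h_trace_def f(2)[OF that])
      also have "\<dots> = (\<Sum>x\<leftarrow>f \<theta>. \<Sum>e\<in>B. of_real ((cmod (snd x e))\<^sup>2) * i_wedge_conj (fst x) v)"
        by (simp add: sum_list_sum_nth sum.swap[of _ B])
      also have "\<dots> = (\<Sum>x\<leftarrow>f \<theta>. of_real ((dual_norm h (snd x))\<^sup>2) * i_wedge_conj (fst x) v)"
        using f(1)[OF that] dual_norm_square
        by (intro arg_cong[where f = sum_list] map_cong refl) (simp add: sum_distrib_right)
      finally show "h_trace B \<theta> v = (\<Sum>x\<leftarrow>f \<theta>. of_real ((dual_norm h (snd x))\<^sup>2) * i_wedge_conj (fst x) v)" .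
    qed
    then have m: "map (h_trace B) \<theta>s =
        map (\<lambda>F v. \<Sum>x\<leftarrow>F. of_real ((dual_norm h (snd x))\<^sup>2) * i_wedge_conj (fst x) v) (map f \<theta>s)"
      by simp
    have "wedge_list (map (h_trace B) \<theta>s) v = (\<Sum>xs\<leftarrow>L. of_real (Q xs) * W xs v)"
      unfolding L_def W_def Q_def m wedge_list_expand by (simp add: prod_of_real o_def del: of_real_power)
    then show ?thesis
      by (simp add: bound_form_def P_def sum_list_const_mult[symmetric] mult.assoc)
  qed
  have diff: "strong_ge sT q a b"
    if "\<And>v. a v = (\<Sum>xs\<leftarrow>L. of_real (c xs) * W xs v)" "\<And>v. b v = (\<Sum>xs\<leftarrow>L. of_real (d xs) * W xs v)"
      "\<And>xs. xs \<in> set L \<Longrightarrow> d xs \<le> c xs" for a b c d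
    unfolding strong_ge_def
  \<comment> \<open>The coefficient differences, paired with the functionals on T, are the list that
    \<open>strong_ge\<close> asks for.\<close>
  proof (intro exI[of _ "map (\<lambda>xs. (c xs - d xs, map fst xs)) L"] conjI allI ballI)
    show "case y of (c, \<beta>s) \<Rightarrow> 0 \<le> c \<and> length \<beta>s = q \<and> (\<forall>\<beta>\<in>set \<beta>s. complex_functional sT \<beta>)"
      if "y \<in> set (map (\<lambda>xs. (c xs - d xs, map fst xs)) L)" for y
      using that \<open>\<And>xs. xs \<in> set L \<Longrightarrow> d xs \<le> c xs\<close> L by auto
    show "a v - b v = (\<Sum>(c, \<beta>s)\<leftarrow>map (\<lambda>xs. (c xs - d xs, map fst xs)) L. of_real c * wedge_list (map i_wedge_conj \<beta>s) v)" for v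
      unfolding that(1,2) sum_list_subtractf[symmetric] by (simp add: W_def o_def left_diff_distrib)
  qed
  have func: "complex_functional s l" if "xs \<in> set L" "l \<in> set (ls @ map snd xs)" for l xs
    using that L(2) ls(2) by auto
  have bounds: "fact (card B - 1) / fact (k + q + card B - 1) * (P * Q xs) \<le> norm_moment (ls @ map snd xs)"
    "norm_moment (ls @ map snd xs) \<le> fact (k + q) * fact (card B - 1) / fact (k + q + card B - 1) * (P * Q xs)"
    if "xs \<in> set L" for xs
    using norm_moment_bounds[of "ls @ map snd xs", OF func[OF that]] L(1)[OF that] ls(1) by (simp_all add: P_def Q_def o_def)
  show "strong_ge sT q (sphere_integral \<mu> ls \<theta>s)
      (bound_form (fact (card B - 1) / fact (k + q + card B - 1)) h ls (map (h_trace B) \<theta>s))"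
    by (rule diff[OF integral bound bounds(1)])
  show "strong_ge sT q
      (bound_form (fact (k + q) * fact (card B - 1) / fact (k + q + card B - 1)) h ls (map (h_trace B) \<theta>s))
      (sphere_integral \<mu> ls \<theta>s)"
    by (rule diff[OF bound integral bounds(2)])
qed

section \<open>The weak inequality\<close>

text \<open>In a Cholesky decomposition along a basis the remainder vanishes on the basis, hence
  everywhere.\<close>

lemma semipositive_form_sum_of_squares:
  assumes "semipositive_form s H"
  shows "\<exists>ms. (\<forall>m\<in>set ms. complex_functional s m) \<and> (\<forall>u. Re (H u u) = (\<Sum>m\<leftarrow>ms. (cmod (m u))\<^sup>2))"
proof -
  obtain es where es: "set es = B" using finite_Basis finite_list by blast
  obtain ms R where ms: "\<And>m. m \<in> set ms \<Longrightarrow> complex_functional s m" "semipositive_form s R"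
    "\<And>u v. H u v = (\<Sum>m\<leftarrow>ms. m u * cnj (m v)) + R u v" "\<And>e v. e \<in> set es \<Longrightarrow> R e v = 0"
    by (rule semipositive_cholesky[OF assms, of es]) blast
  have "R u v = 0" for u v
  proof -
    have "R u v = (\<Sum>e\<in>B. h u e * R e v)"
      using ms(2) unfolding semipositive_form_def hermitian_form_def
      by (intro functional_expansion) blast
    then show ?thesis using ms(4) es by simp
  qed
  then have "Re (H u u) = (\<Sum>m\<leftarrow>ms. (cmod (m u))\<^sup>2)" for u
    unfolding ms(3) by (simp, induction ms) (simp_all add: complex_mult_cnj cmod_power2)
  with ms(1) show ?thesis by blast
qed

text \<open>Once each \<open>K j\<close> is written as a sum of squares, the product expands into
  the moments already bounded. The resulting products of squared norms fold back into traces, since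
  the squared norm of a functional is its sum of squares over \<open>B\<close>.\<close>

lemma integral_prod_semipositive_le:
  assumes ls: "\<And>l. l \<in> set ls \<Longrightarrow> complex_functional s l"
    and K: "\<And>j. j < q \<Longrightarrow> semipositive_form s (K j)"
  shows "integrable \<mu> (\<lambda>u. (\<Prod>l\<leftarrow>ls. (cmod (l u))\<^sup>2) * (\<Prod>j<q. Re (K j u u)))"
    and "(\<integral>u. (\<Prod>l\<leftarrow>ls. (cmod (l u))\<^sup>2) * (\<Prod>j<q. Re (K j u u)) \<partial>\<mu>) \<le>
      fact (length ls + q) * fact (card B - 1) / fact (length ls + q + card B - 1) *
      ((\<Prod>l\<leftarrow>ls. (dual_norm h l)\<^sup>2) * (\<Prod>j<q. \<Sum>e\<in>B. Re (K j e e)))"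
proof -
  have "\<forall>j\<in>{..<q}. \<exists>ms. (\<forall>m\<in>set ms. complex_functional s m) \<and> (\<forall>u. Re (K j u u) = (\<Sum>m\<leftarrow>ms. (cmod (m u))\<^sup>2))"
    by (intro ballI semipositive_form_sum_of_squares K) simp
  from bchoice[OF this] obtain ms where "\<forall>j\<in>{..<q}. (\<forall>m\<in>set (ms j). complex_functional s m) \<and>
      (\<forall>u. Re (K j u u) = (\<Sum>m\<leftarrow>ms j. (cmod (m u))\<^sup>2))"
    by blast
  then have ms: "\<And>j m. j < q \<Longrightarrow> m \<in> set (ms j) \<Longrightarrow> complex_functional s m"
    "\<And>j u. j < q \<Longrightarrow> Re (K j u u) = (\<Sum>m\<leftarrow>ms j. (cmod (m u))\<^sup>2)"
    by auto
  define L where "L = product_lists (map ms [0..<q])"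
  have L: "length xs = q" "\<And>x. x \<in> set xs \<Longrightarrow> complex_functional s x" if "xs \<in> set L" for xs
  proof -
    show len: "length xs = q"
      using length_in_product_lists[OF that[unfolded L_def]] by simp
    fix x assume "x \<in> set xs"
    then obtain i where "i < q" "x = xs ! i" using len by (auto simp: in_set_conv_nth)
    then show "complex_functional s x"
      using in_product_listsD[OF that[unfolded L_def], of i] ms(1)[of i] by simp
  qed
  define P where "P = (\<Prod>l\<leftarrow>ls. (dual_norm h l)\<^sup>2)"
  have func: "complex_functional s l" if "xs \<in> set L" "l \<in> set (ls @ xs)" for l xs
    using that L(2) ls by auto
  have prod_eq: "(\<Prod>j<q. \<Sum>m\<leftarrow>ms j. g m) = (\<Sum>xs\<leftarrow>L. \<Prod>m\<leftarrow>xs. g m)" for g :: "('e \<Rightarrow> complex) \<Rightarrow> real"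
    unfolding L_def prod_list_expand[symmetric] by (simp add: prod.list_conv_set_nth lessThan_atLeast0)
  have "(\<Prod>j<q. Re (K j u u)) = (\<Sum>xs\<leftarrow>L. \<Prod>m\<leftarrow>xs. (cmod (m u))\<^sup>2)" for u
    using ms(2) prod_eq[of "\<lambda>m. (cmod (m u))\<^sup>2"] by simp
  then have eq: "(\<Prod>l\<leftarrow>ls. (cmod (l u))\<^sup>2) * (\<Prod>j<q. Re (K j u u)) = (\<Sum>xs\<leftarrow>L. \<Prod>l\<leftarrow>ls @ xs. (cmod (l u))\<^sup>2)" for u
    by (simp add: sum_list_const_mult[symmetric])
  have int: "integrable \<mu> (\<lambda>u. \<Prod>l\<leftarrow>ls @ xs. (cmod (l u))\<^sup>2)" if "xs \<in> set L" for xs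
    by (rule integrable_norm_moment[OF func[OF that]])
  show "integrable \<mu> (\<lambda>u. (\<Prod>l\<leftarrow>ls. (cmod (l u))\<^sup>2) * (\<Prod>j<q. Re (K j u u)))"
    unfolding eq by (rule integral_sum_list(2)[OF int])
  have "(\<integral>u. (\<Prod>l\<leftarrow>ls. (cmod (l u))\<^sup>2) * (\<Prod>j<q. Re (K j u u)) \<partial>\<mu>) = (\<Sum>xs\<leftarrow>L. norm_moment (ls @ xs))"
    unfolding eq norm_moment_def by (rule integral_sum_list(1)[OF int])
  also have "\<dots> \<le> (\<Sum>xs\<leftarrow>L. fact (length ls + q) * fact (card B - 1) / fact (length ls + q + card B - 1) *
      (P * (\<Prod>m\<leftarrow>xs. (dual_norm h m)\<^sup>2)))"
  proof (rule sum_list_mono)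
    fix xs assume xs: "xs \<in> set L"
    show "norm_moment (ls @ xs) \<le> fact (length ls + q) * fact (card B - 1) / fact (length ls + q + card B - 1) *
        (P * (\<Prod>m\<leftarrow>xs. (dual_norm h m)\<^sup>2))"
      using norm_moment_bounds(2)[of "ls @ xs", OF func[OF xs]] L(1)[OF xs] by (simp add: P_def)
  qed
  also have "\<dots> = fact (length ls + q) * fact (card B - 1) / fact (length ls + q + card B - 1) *
      (P * (\<Prod>j<q. \<Sum>m\<leftarrow>ms j. (dual_norm h m)\<^sup>2))"
    unfolding prod_eq by (simp only: sum_list_const_mult)
  also have "(\<Prod>j<q. \<Sum>m\<leftarrow>ms j. (dual_norm h m)\<^sup>2) = (\<Prod>j<q. \<Sum>e\<in>B. Re (K j e e))"
  proof (intro prod.cong refl)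
    fix j assume "j \<in> {..<q}"
    then have j: "j < q" by simp
    have "(\<Sum>m\<leftarrow>ms j. (dual_norm h m)\<^sup>2) = (\<Sum>m\<leftarrow>ms j. \<Sum>e\<in>B. (cmod (m e))\<^sup>2)"
      using ms(1)[OF j] dual_norm_square by (intro arg_cong[where f = sum_list] map_cong refl) auto
    also have "\<dots> = (\<Sum>e\<in>B. \<Sum>m\<leftarrow>ms j. (cmod (m e))\<^sup>2)"
      by (simp add: sum_list_sum_nth sum.swap[of _ B])
    finally show "(\<Sum>m\<leftarrow>ms j. (dual_norm h m)\<^sup>2) = (\<Sum>e\<in>B. Re (K j e e))"
      by (simp add: ms(2)[OF j])
  qed
  finally show "(\<integral>u. (\<Prod>l\<leftarrow>ls. (cmod (l u))\<^sup>2) * (\<Prod>j<q. Re (K j u u)) \<partial>\<mu>) \<le>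
      fact (length ls + q) * fact (card B - 1) / fact (length ls + q + card B - 1) *
      ((\<Prod>l\<leftarrow>ls. (dual_norm h l)\<^sup>2) * (\<Prod>j<q. \<Sum>e\<in>B. Re (K j e e)))"
    by (simp only: P_def)
qed

lemma weak_inequality:
  fixes sT :: "complex \<Rightarrow> 't \<Rightarrow> 't::ab_group_add"
  assumes ls: "length ls = k" "\<And>l. l \<in> set ls \<Longrightarrow> complex_functional s l"
    and \<theta>: "hermitian_tensor sT s \<theta>" "griffiths_semipositive \<theta>"
  shows "weak_ge sT q
      (bound_form (fact (k + q) * fact (card B - 1) / fact (k + q + card B - 1)) h ls (replicate q (h_trace B \<theta>)))
      (sphere_integral \<mu> ls (replicate q \<theta>))"
  unfolding weak_ge_def
proof (intro allI impI)
  fix S es assume es: "length es = q \<and> distinct es \<and> \<not> module.dependent sT (set es) \<and> module.span sT (set es) = S"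
  define H where "H u \<xi> \<eta> = \<theta> \<xi> u \<eta> u" for u \<xi> \<eta>
  define H0 where "H0 \<xi> \<eta> = (\<Sum>e\<in>B. \<theta> \<xi> e \<eta> e)" for \<xi> \<eta>
  have H: "semipositive_form sT (H u)" for u
    using griffiths_semipositive_form_left[OF \<theta>] unfolding H_def .
  have vs: "vector_space sT"
    using \<theta>(1) unfolding hermitian_tensor_def Vector_Spaces.linear_def by blast
  have H0: "semipositive_form sT H0"
    unfolding H0_def using griffiths_semipositive_form_left[OF \<theta>] by (intro semipositive_form_sum[OF vs])
  obtain fs c where fs: "length fs = length es"
    \<comment> \<open>The basis is orthogonal for the trace \<open>H0\<close>, not for the single
      \<open>H u\<close>: Hadamard's inequality then bounds the integrand from above and is an
      equality for the bound.\<close>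
    "\<And>j. j < length es \<Longrightarrow> es ! j = fs ! j + (\<Sum>k<j. sT (c k j) (fs ! k))"
    "\<And>i j. i < length es \<Longrightarrow> j < length es \<Longrightarrow> i \<noteq> j \<Longrightarrow> H0 (fs ! i) (fs ! j) = 0"
    using semipositive_gram_schmidt[OF H0] by blast
  have len: "length es = q" "length fs = q" using es fs(1) by auto
  define N where "N = 2 ^ q * real (length (filter distinct (product_lists (replicate q [0..<q]))))"
  have N: "0 \<le> N" by (simp add: N_def)
  note frame = wedge_power_real_frame[OF _ len fs(2)[unfolded len], folded N_def]
  have "\<exists>D. wedge_list (replicate q (form_of_hermitian (H u))) (real_frame sT es) = of_real (N * D) \<and>
      D \<le> (\<Prod>j<q. Re (H u (fs ! j) (fs ! j)))" for u
  proof -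
    obtain D where "wedge_list (replicate q (form_of_hermitian (H u))) (real_frame sT es) = of_real (N * D)"
      "D \<le> (\<Prod>j<q. Re (H u (fs ! j) (fs ! j)))"
      by (rule frame[OF H[of u]]) blast
    then show ?thesis by (intro exI[of _ D] conjI)
  qed
  then obtain D where D: "\<And>u. wedge_list (replicate q (form_of_hermitian (H u))) (real_frame sT es) = of_real (N * D u)"
    "\<And>u. D u \<le> (\<Prod>j<q. Re (H u (fs ! j) (fs ! j)))"
    using choice[of "\<lambda>u D. wedge_list (replicate q (form_of_hermitian (H u))) (real_frame sT es) = of_real (N * D) \<and>
      D \<le> (\<Prod>j<q. Re (H u (fs ! j) (fs ! j)))"] by blast
  have orth: "H0 (fs ! i) (fs ! j) = 0" if "i < q" "j < q" "i \<noteq> j" for i j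
    using fs(3) len that by simp
  obtain D0 where D0: "wedge_list (replicate q (form_of_hermitian H0)) (real_frame sT es) = of_real (N * D0)"
    and D0_eq: "D0 = (\<Prod>j<q. Re (H0 (fs ! j) (fs ! j)))"
  proof (rule frame[OF H0])
    fix D
    assume 1: "wedge_list (replicate q (form_of_hermitian H0)) (real_frame sT es) = of_real (N * D)"
      and 2: "(\<And>i j. i < q \<Longrightarrow> j < q \<Longrightarrow> i \<noteq> j \<Longrightarrow> H0 (fs ! i) (fs ! j) = 0) \<Longrightarrow>
        D = (\<Prod>j<q. Re (H0 (fs ! j) (fs ! j)))"
    show thesis by (rule that[OF 1 2[OF orth]])
  qed
  define K where "K j u v = \<theta> (fs ! j) u (fs ! j) v" for j u v
  have K: "semipositive_form s (K j)" for j
    unfolding K_def by (rule griffiths_semipositive_form_right[OF \<theta>])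
  define C where "C = (fact (k + q) * fact (card B - 1) / fact (k + q + card B - 1) :: real)"
  define P where "P = (\<Prod>l\<leftarrow>ls. (dual_norm h l)\<^sup>2)"
  define G where "G u = (\<Prod>l\<leftarrow>ls. (cmod (l u))\<^sup>2)" for u
  have G: "0 \<le> G u" for u
    unfolding G_def by (induction ls) auto
  have KI: "integrable \<mu> (\<lambda>u. G u * (\<Prod>j<q. Re (K j u u)))"
    "(\<integral>u. G u * (\<Prod>j<q. Re (K j u u)) \<partial>\<mu>) \<le> C * (P * (\<Prod>j<q. \<Sum>e\<in>B. Re (K j e e)))"
    unfolding G_def C_def P_def ls(1)[symmetric] by - (rule integral_prod_semipositive_le(1)[where K = K and q = q, OF ls(2) K], assumption, rule integral_prod_semipositive_le(2)[where K = K and q = q, OF ls(2) K], assumption)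
  have "sphere_integral \<mu> ls (replicate q \<theta>) (real_frame sT es) = (\<integral>u. of_real (G u * (N * D u)) \<partial>\<mu>)"
    using D(1) unfolding sphere_integral_def contract_def H_def G_def by (simp add: map_replicate_const)
  also have "\<dots> = of_real (\<integral>u. G u * (N * D u) \<partial>\<mu>)"
    by (rule integral_complex_of_real)
  finally have integral: "sphere_integral \<mu> ls (replicate q \<theta>) (real_frame sT es) = of_real (\<integral>u. G u * (N * D u) \<partial>\<mu>)" .
  have "(\<integral>u. G u * (N * D u) \<partial>\<mu>) \<le> (\<integral>u. N * (G u * (\<Prod>j<q. Re (K j u u))) \<partial>\<mu>)"
  \<comment> \<open>This rule asks only for integrability and nonnegativity of the majorant. The
    function \<open>D\<close> comes from a choice at each \<open>u\<close>, and no measurability of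
    it is established.\<close>
  proof (rule integral_mono')
    show "integrable \<mu> (\<lambda>u. N * (G u * (\<Prod>j<q. Re (K j u u))))"
      by (rule integrable_mult_right[OF KI(1)])
    fix u
    have "D u \<le> (\<Prod>j<q. Re (K j u u))" using D(2)[of u] by (simp add: H_def K_def)
    then show "G u * (N * D u) \<le> N * (G u * (\<Prod>j<q. Re (K j u u)))"
      using N G[of u] by (simp add: mult_left_mono mult.left_commute)
    show "0 \<le> N * (G u * (\<Prod>j<q. Re (K j u u)))"
      using N G semipositive_form_diag(2)[OF K] by (intro mult_nonneg_nonneg prod_nonneg) auto
  qed
  also have "\<dots> = N * (\<integral>u. G u * (\<Prod>j<q. Re (K j u u)) \<partial>\<mu>)"
    by simp
  also have "\<dots> \<le> N * (C * (P * (\<Prod>j<q. \<Sum>e\<in>B. Re (K j e e))))"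
    using KI(2) N by (rule mult_left_mono)
  \<comment> \<open>The factors are \<open>Re (H0 (fs ! j) (fs ! j))\<close>, and their product is
    \<open>D0\<close> by orthogonality.\<close>
  also have "(\<Prod>j<q. \<Sum>e\<in>B. Re (K j e e)) = D0"
    by (simp add: D0_eq H0_def K_def)
  finally have "(\<integral>u. G u * (N * D u) \<partial>\<mu>) \<le> C * P * (N * D0)"
    by (simp add: mult_ac)
  moreover have "bound_form C h ls (replicate q (h_trace B \<theta>)) (real_frame sT es) = of_real (C * P * (N * D0))"
  proof -
    have "h_trace B \<theta> = form_of_hermitian H0"
      unfolding h_trace_eq H0_def[abs_def] ..
    then show ?thesis using D0 by (simp add: bound_form_def P_def)
  qed
  ultimately show "bound_form (fact (k + q) * fact (card B - 1) / fact (k + q + card B - 1)) h ls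
        (replicate q (h_trace B \<theta>)) (real_frame sT es) -
      sphere_integral \<mu> ls (replicate q \<theta>) (real_frame sT es) \<in> \<real>\<^sub>\<ge>\<^sub>0"
    unfolding integral C_def[symmetric] by (simp del: of_real_mult flip: of_real_diff)
qed

end

section \<open>Both parts in terms of \<open>p\<close>, \<open>k\<close> and
  \<open>r\<close>\<close>

lemma orthonormal_basis_card:
  assumes "complex_space s r" "orthonormal_basis s h B"
  shows "card B = r"
proof -
  obtain C where C: "finite_dimensional_vector_space s C" "card C = r"
    using assms(1) by (auto simp: complex_space_def)
  interpret C: finite_dimensional_vector_space s C by (rule C)
  interpret B: finite_dimensional_vector_space s B
    using assms(2) by (simp add: orthonormal_basis_def)
  show ?thesis
    using C.dim_UNIV C(2) B.dim_UNIV by (simp add: B.dimension_def C.dimension_def)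
qed

lemma tensor_inequalities:
  fixes sT :: "complex \<Rightarrow> 't \<Rightarrow> 't::ab_group_add" and sE :: "complex \<Rightarrow> 'e \<Rightarrow> 'e::ab_group_add"
  assumes "complex_space sE r" "hermitian_structure sE h"
    "unitary_invariant_probability sE h \<mu>" "orthonormal_basis sE h B" "k \<le> p"
    and ls: "length ls = k" "\<forall>l\<in>set ls. complex_functional sE l"
  shows "length \<theta>s = p - k \<Longrightarrow> \<forall>\<theta>\<in>set \<theta>s. hermitian_tensor sT sE \<theta> \<and> strongly_semipositive sT sE \<theta> \<Longrightarrow>
      strong_ge sT (p - k) (sphere_integral \<mu> ls \<theta>s)
        (bound_form (fact (r - 1) / fact (p + r - 1)) h ls (map (h_trace B) \<theta>s)) \<and>
      strong_ge sT (p - k)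
        (bound_form (fact p * fact (r - 1) / fact (p + r - 1)) h ls (map (h_trace B) \<theta>s))
        (sphere_integral \<mu> ls \<theta>s)"
    and "hermitian_tensor sT sE \<theta> \<Longrightarrow> griffiths_semipositive \<theta> \<Longrightarrow>
      weak_ge sT (p - k)
        (bound_form (fact p * fact (r - 1) / fact (p + r - 1)) h ls (replicate (p - k) (h_trace B \<theta>)))
        (sphere_integral \<mu> ls (replicate (p - k) \<theta>))"
proof -
  interpret invariant_sphere sE h \<mu> B
    using assms by unfold_locales
  have r: "card B = r" by (rule orthonormal_basis_card[OF assms(1,4)])
  have p: "k + (p - k) = p" using assms(5) by simp
  show "length \<theta>s = p - k \<Longrightarrow> \<forall>\<theta>\<in>set \<theta>s. hermitian_tensor sT sE \<theta> \<and> strongly_semipositive sT sE \<theta> \<Longrightarrow>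
      strong_ge sT (p - k) (sphere_integral \<mu> ls \<theta>s)
        (bound_form (fact (r - 1) / fact (p + r - 1)) h ls (map (h_trace B) \<theta>s)) \<and>
      strong_ge sT (p - k)
        (bound_form (fact p * fact (r - 1) / fact (p + r - 1)) h ls (map (h_trace B) \<theta>s))
        (sphere_integral \<mu> ls \<theta>s)"
    using strong_inequalities[of ls k \<theta>s "p - k" sT] ls unfolding r p by blast
  show "hermitian_tensor sT sE \<theta> \<Longrightarrow> griffiths_semipositive \<theta> \<Longrightarrow>
      weak_ge sT (p - k)
        (bound_form (fact p * fact (r - 1) / fact (p + r - 1)) h ls (replicate (p - k) (h_trace B \<theta>)))
        (sphere_integral \<mu> ls (replicate (p - k) \<theta>))"
    using weak_inequality[of ls k sT \<theta> "p - k"] ls unfolding r p by blast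
qed

section \<open>Symmetry of second derivatives\<close>

text \<open>Two applications of the mean value theorem: along \<xi> to the difference of the values
  at heights \<open>t\<close> and \<open>0\<close> in the direction \<eta>, then along \<eta> to
  \<open>g1\<close>.\<close>

lemma second_difference:
  fixes g :: "'a::real_normed_vector \<Rightarrow> real"
  assumes t: "0 < t"
    and U: "\<And>a b. 0 \<le> a \<Longrightarrow> a \<le> t \<Longrightarrow> 0 \<le> b \<Longrightarrow> b \<le> t \<Longrightarrow> z + a *\<^sub>R \<xi> + b *\<^sub>R \<eta> \<in> U"
    and 1: "\<And>w. w \<in> U \<Longrightarrow> ((\<lambda>x. g (w + x *\<^sub>R \<xi>)) has_real_derivative g1 w) (at 0)"
    and 2: "\<And>w. w \<in> U \<Longrightarrow> ((\<lambda>x. g1 (w + x *\<^sub>R \<eta>)) has_real_derivative g2 w) (at 0)"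
  obtains a b where "0 < a" "a < t" "0 < b" "b < t"
    "g (z + t *\<^sub>R \<xi> + t *\<^sub>R \<eta>) - g (z + t *\<^sub>R \<xi>) - g (z + t *\<^sub>R \<eta>) + g z = t * (t * g2 (z + a *\<^sub>R \<xi> + b *\<^sub>R \<eta>))"
proof -
  have D1: "((\<lambda>x. g (z + x *\<^sub>R \<xi> + b *\<^sub>R \<eta>)) has_real_derivative g1 (z + x *\<^sub>R \<xi> + b *\<^sub>R \<eta>)) (at x)"
    if "0 \<le> x" "x \<le> t" "0 \<le> b" "b \<le> t" for x b
  proof -
    have "(\<lambda>y. g (z + (y + x) *\<^sub>R \<xi> + b *\<^sub>R \<eta>)) = (\<lambda>y. g ((z + x *\<^sub>R \<xi> + b *\<^sub>R \<eta>) + y *\<^sub>R \<xi>))"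
      by (simp add: algebra_simps)
    then show ?thesis
      using 1[OF U[OF that]] DERIV_shift[of "\<lambda>x. g (z + x *\<^sub>R \<xi> + b *\<^sub>R \<eta>)" _ 0 x] by simp
  qed
  have D2: "((\<lambda>y. g1 (z + a *\<^sub>R \<xi> + y *\<^sub>R \<eta>)) has_real_derivative g2 (z + a *\<^sub>R \<xi> + y *\<^sub>R \<eta>)) (at y)"
    if "0 \<le> a" "a \<le> t" "0 \<le> y" "y \<le> t" for a y
  proof -
    have "(\<lambda>x. g1 (z + a *\<^sub>R \<xi> + (x + y) *\<^sub>R \<eta>)) = (\<lambda>x. g1 ((z + a *\<^sub>R \<xi> + y *\<^sub>R \<eta>) + x *\<^sub>R \<eta>))"
      by (simp add: algebra_simps)
    then show ?thesis
      using 2[OF U[OF that]] DERIV_shift[of "\<lambda>y. g1 (z + a *\<^sub>R \<xi> + y *\<^sub>R \<eta>)" _ 0 y] by simp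
  qed
  have "\<exists>a>0. a < t \<and> (g (z + t *\<^sub>R \<xi> + t *\<^sub>R \<eta>) - g (z + t *\<^sub>R \<xi> + 0 *\<^sub>R \<eta>)) -
      (g (z + 0 *\<^sub>R \<xi> + t *\<^sub>R \<eta>) - g (z + 0 *\<^sub>R \<xi> + 0 *\<^sub>R \<eta>)) =
      (t - 0) * (g1 (z + a *\<^sub>R \<xi> + t *\<^sub>R \<eta>) - g1 (z + a *\<^sub>R \<xi> + 0 *\<^sub>R \<eta>))"
    by (rule MVT2[OF t]) (intro DERIV_diff D1, use t in auto)
  then obtain a where a: "0 < a" "a < t" "g (z + t *\<^sub>R \<xi> + t *\<^sub>R \<eta>) - g (z + t *\<^sub>R \<xi>) - g (z + t *\<^sub>R \<eta>) + g z =
      t * (g1 (z + a *\<^sub>R \<xi> + t *\<^sub>R \<eta>) - g1 (z + a *\<^sub>R \<xi> + 0 *\<^sub>R \<eta>))"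
    by (auto simp: algebra_simps)
  have "\<exists>b>0. b < t \<and> g1 (z + a *\<^sub>R \<xi> + t *\<^sub>R \<eta>) - g1 (z + a *\<^sub>R \<xi> + 0 *\<^sub>R \<eta>) =
      (t - 0) * g2 (z + a *\<^sub>R \<xi> + b *\<^sub>R \<eta>)"
    by (rule MVT2[OF t]) (rule D2, use a in auto)
  then obtain b where "0 < b" "b < t" "g1 (z + a *\<^sub>R \<xi> + t *\<^sub>R \<eta>) - g1 (z + a *\<^sub>R \<xi> + 0 *\<^sub>R \<eta>) =
      t * g2 (z + a *\<^sub>R \<xi> + b *\<^sub>R \<eta>)"
    by auto
  with a show thesis by (intro that[of a b]) auto
qed

text \<open>The same second difference is \<open>t * t\<close> times either mixed derivative at
  points near \<open>z\<close>. By continuity both values at \<open>z\<close> lie within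
  \<open>e\<close> of this common value, which contradicts \<open>e\<close> being half their
  distance.\<close>

lemma second_derivative_symmetric_real:
  fixes g :: "'a::real_normed_vector \<Rightarrow> real"
  assumes "open U" "z \<in> U"
    and 1: "\<And>w. w \<in> U \<Longrightarrow> ((\<lambda>x. g (w + x *\<^sub>R \<xi>)) has_real_derivative g1 w) (at 0)"
    and 12: "\<And>w. w \<in> U \<Longrightarrow> ((\<lambda>x. g1 (w + x *\<^sub>R \<eta>)) has_real_derivative g12 w) (at 0)"
    and 2: "\<And>w. w \<in> U \<Longrightarrow> ((\<lambda>x. g (w + x *\<^sub>R \<eta>)) has_real_derivative g2 w) (at 0)"
    and 21: "\<And>w. w \<in> U \<Longrightarrow> ((\<lambda>x. g2 (w + x *\<^sub>R \<xi>)) has_real_derivative g21 w) (at 0)"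
    and cont: "continuous_on U g12" "continuous_on U g21"
  shows "g12 z = g21 z"
proof (rule ccontr)
  assume ne: "g12 z \<noteq> g21 z"
  define e where "e = \<bar>g12 z - g21 z\<bar> / 2"
  have e: "e > 0" using ne by (simp add: e_def)
  have near_z: "\<exists>d>0. \<forall>w. dist w z < d \<longrightarrow> dist (f w) (f z) < e" if "continuous_on U f" for f :: "'a \<Rightarrow> real"
  proof -
    have "isCont f z"
      using assms(1,2) that by (simp add: continuous_on_eq_continuous_at)
    then show ?thesis
      using e unfolding continuous_at_eps_delta by blast
  qed
  obtain d1 where d1: "d1 > 0" "\<And>w. dist w z < d1 \<Longrightarrow> dist (g12 w) (g12 z) < e"
    using near_z[OF cont(1)] by blast
  obtain d2 where d2: "d2 > 0" "\<And>w. dist w z < d2 \<Longrightarrow> dist (g21 w) (g21 z) < e"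
    using near_z[OF cont(2)] by blast
  obtain d3 where d3: "d3 > 0" "ball z d3 \<subseteq> U"
    using assms(1,2) open_contains_ball by blast
  define d where "d = min d3 (min d1 d2)"
  \<comment> \<open>With this \<open>N\<close> the parallelogram spanned by \<open>t\<close> times
    the two directions stays within \<open>d / 2\<close> of \<open>z\<close>; the \<open>+ 1\<close>
    covers the case of zero directions.\<close>
  define N where "N = norm \<xi> + norm \<eta> + 1"
  define t where "t = d / (2 * N)"
  have n: "N > 0" by (simp add: N_def add_nonneg_pos)
  have dpos: "d > 0" using d1 d2 d3 by (simp add: d_def)
  then have t: "t > 0" using n by (simp add: t_def)
  have near: "dist (z + a *\<^sub>R \<xi> + b *\<^sub>R \<eta>) z < d" if "0 \<le> a" "a \<le> t" "0 \<le> b" "b \<le> t" for a b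
  proof -
    have "dist (z + a *\<^sub>R \<xi> + b *\<^sub>R \<eta>) z = norm (a *\<^sub>R \<xi> + b *\<^sub>R \<eta>)"
      by (simp add: dist_norm add.assoc)
    also have "\<dots> \<le> a * norm \<xi> + b * norm \<eta>"
      using that by (intro norm_triangle_le) simp
    also have "\<dots> \<le> t * norm \<xi> + t * norm \<eta>"
      using that by (intro add_mono mult_right_mono) auto
    also have "\<dots> \<le> t * N"
      using t by (simp add: N_def algebra_simps)
    also have "\<dots> = d / 2" using n by (simp add: t_def)
    also have "\<dots> < d" using dpos by simp
    finally show ?thesis .
  qed
  have U1: "z + a *\<^sub>R \<xi> + b *\<^sub>R \<eta> \<in> U" and U2: "z + a *\<^sub>R \<eta> + b *\<^sub>R \<xi> \<in> U"
    if "0 \<le> a" "a \<le> t" "0 \<le> b" "b \<le> t" for a b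
    using near[of a b] near[of b a] that d3 by (auto simp: d_def dist_commute algebra_simps)
  obtain a b where ab: "0 < a" "a < t" "0 < b" "b < t"
    "g (z + t *\<^sub>R \<xi> + t *\<^sub>R \<eta>) - g (z + t *\<^sub>R \<xi>) - g (z + t *\<^sub>R \<eta>) + g z = t * (t * g12 (z + a *\<^sub>R \<xi> + b *\<^sub>R \<eta>))"
    using second_difference[OF t U1 1 12] by blast
  obtain a' b' where ab': "0 < a'" "a' < t" "0 < b'" "b' < t"
    "g (z + t *\<^sub>R \<eta> + t *\<^sub>R \<xi>) - g (z + t *\<^sub>R \<eta>) - g (z + t *\<^sub>R \<xi>) + g z = t * (t * g21 (z + a' *\<^sub>R \<eta> + b' *\<^sub>R \<xi>))"
    using second_difference[OF t U2 2 21] by blast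
  have "g (z + t *\<^sub>R \<eta> + t *\<^sub>R \<xi>) = g (z + t *\<^sub>R \<xi> + t *\<^sub>R \<eta>)"
    by (intro arg_cong[where f = g]) simp
  then have "t * (t * g12 (z + a *\<^sub>R \<xi> + b *\<^sub>R \<eta>)) = t * (t * g21 (z + a' *\<^sub>R \<eta> + b' *\<^sub>R \<xi>))"
    using ab(5) ab'(5) by linarith
  then have "g12 (z + a *\<^sub>R \<xi> + b *\<^sub>R \<eta>) = g21 (z + a' *\<^sub>R \<eta> + b' *\<^sub>R \<xi>)"
    using t by simp
  moreover have "dist (g12 (z + a *\<^sub>R \<xi> + b *\<^sub>R \<eta>)) (g12 z) < e"
    using near[of a b] ab by (intro d1(2)) (simp add: d_def)
  moreover have "dist (g21 (z + a' *\<^sub>R \<eta> + b' *\<^sub>R \<xi>)) (g21 z) < e"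
    using near[of b' a'] ab' by (intro d2(2)) (simp add: d_def algebra_simps)
  ultimately show False
    by (simp add: dist_real_def e_def abs_if split: if_splits)
qed

lemma smooth_on_differentiable: "smooth_on U f \<Longrightarrow> z \<in> U \<Longrightarrow> f differentiable (at z)"
  unfolding smooth_on_def by (metis Ck_on.simps(2))

lemma smooth_on_derivative: "smooth_on U f \<Longrightarrow> smooth_on U (\<lambda>z. frechet_derivative f (at z) \<xi>)"
  unfolding smooth_on_def by (metis Ck_on.simps(2))

lemma smooth_on_continuous: "smooth_on U f \<Longrightarrow> continuous_on U f"
  unfolding smooth_on_def by (metis Ck_on.simps(1))

lemma smooth_on_const: "smooth_on U (\<lambda>_. c)"
proof -
  have "Ck_on k U (\<lambda>_. c)" for k
    by (induction k arbitrary: c) (auto intro: continuous_on_const)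
  then show ?thesis by (simp add: smooth_on_def)
qed

text \<open>With \<open>L\<close> the real or the imaginary part, this brings complex functions
  within reach of the mean value theorem.\<close>

lemma bounded_linear_directional_derivative:
  assumes "f differentiable (at w)" "bounded_linear L"
  shows "((\<lambda>x. L (f (w + x *\<^sub>R \<xi>))) has_real_derivative L (frechet_derivative f (at w) \<xi>)) (at 0)"
proof -
  interpret bounded_linear L by fact
  have "(f has_derivative frechet_derivative f (at w)) (at w)"
    using assms(1) by (simp add: frechet_derivative_works)
  then have 1: "(f has_derivative frechet_derivative f (at w)) (at (w + 0 *\<^sub>R \<xi>))"
    by simp
  interpret D: linear "frechet_derivative f (at w)"
    by (rule linear_frechet_derivative[OF assms(1)])
  have "((\<lambda>x. w + x *\<^sub>R \<xi>) has_derivative (\<lambda>x. x *\<^sub>R \<xi>)) (at (0::real))"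
    by (auto intro!: derivative_eq_intros)
  from has_derivative_compose[OF this 1] have "((\<lambda>x. f (w + x *\<^sub>R \<xi>)) has_derivative (\<lambda>x. frechet_derivative f (at w) (x *\<^sub>R \<xi>))) (at 0)" .
  from has_derivative[OF this] show ?thesis
    by (simp add: has_field_derivative_def D.scaleR scaleR mult_commute_abs)
qed

lemma second_derivative_symmetric:
  fixes f :: "'a::real_normed_vector \<Rightarrow> complex"
  assumes U: "open U" "z \<in> U" and f: "smooth_on U f"
  shows "frechet_derivative (\<lambda>w. frechet_derivative f (at w) \<xi>) (at z) \<eta> =
    frechet_derivative (\<lambda>w. frechet_derivative f (at w) \<eta>) (at z) \<xi>"
proof -
  have "L (frechet_derivative (\<lambda>w. frechet_derivative f (at w) \<xi>) (at z) \<eta>) =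
      L (frechet_derivative (\<lambda>w. frechet_derivative f (at w) \<eta>) (at z) \<xi>)"
    if L: "bounded_linear L" for L :: "complex \<Rightarrow> real"
  proof -
    have D1: "((\<lambda>x. L (f (w + x *\<^sub>R \<xi>))) has_real_derivative L (frechet_derivative f (at w) \<xi>)) (at 0)" if "w \<in> U" for w \<xi>
      by (intro bounded_linear_directional_derivative L smooth_on_differentiable[OF f that])
    have D2: "((\<lambda>x. L (frechet_derivative f (at (w + x *\<^sub>R \<eta>)) \<xi>)) has_real_derivative
        L (frechet_derivative (\<lambda>w. frechet_derivative f (at w) \<xi>) (at w) \<eta>)) (at 0)" if "w \<in> U" for w \<xi> \<eta>
      by (intro bounded_linear_directional_derivative L smooth_on_differentiable[OF smooth_on_derivative[OF f] that])
    have D3: "continuous_on U (\<lambda>w. L (frechet_derivative (\<lambda>w. frechet_derivative f (at w) \<xi>) (at w) \<eta>))" for \<xi> \<eta>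
      by (intro bounded_linear.continuous_on[OF L] smooth_on_continuous smooth_on_derivative f)
    show ?thesis
      by (rule second_derivative_symmetric_real[OF U D1 D2 D1 D2 D3 D3])
  qed
  from this[OF bounded_linear_Re] this[OF bounded_linear_Im] show ?thesis
    by (rule complex_eqI)
qed

section \<open>The Chern curvature\<close>

locale chern =
  fixes U :: "(complex^'n) set" and H :: "complex^'n \<Rightarrow> complex^'r \<Rightarrow> complex^'r \<Rightarrow> complex"
    and A :: "('n::finite, 'r::finite) connection_form" and z
  assumes U: "open U" "z \<in> U"
    and metric: "\<And>w. w \<in> U \<Longrightarrow> hermitian_structure (*s) (H w)"
    and smooth: "\<And>u v. smooth_on U (\<lambda>w. H w u v)"
    and connection: "chern_connection U H A"
begin

abbreviation "Hz \<equiv> H z"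

lemma metric_form: "w \<in> U \<Longrightarrow> hermitian_form (*s) (H w)"
  using metric by (simp add: hermitian_structure_def)

lemmas HzD = hermitian_formD(1-10)[OF metric_form[OF U(2)]]

lemma A_complex: "A w \<xi> (u + v) = A w \<xi> u + A w \<xi> v" "A w \<xi> (c *s u) = c *s A w \<xi> u" if "w \<in> U"
proof -
  interpret Vector_Spaces.linear "(*s)" "(*s)" "A w \<xi>"
    using connection that by (auto simp: chern_connection_def)
  show "A w \<xi> (u + v) = A w \<xi> u + A w \<xi> v" "A w \<xi> (c *s u) = c *s A w \<xi> u"
    by (simp_all add: add scale)
qed

lemma A_real: "A w (\<xi> + \<eta>) u = A w \<xi> u + A w \<eta> u" "A w (c *\<^sub>R \<xi>) u = c *\<^sub>R A w \<xi> u" if "w \<in> U"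
proof -
  interpret linear "\<lambda>\<xi>. A w \<xi> u"
    using connection that by (auto simp: chern_connection_def)
  show "A w (\<xi> + \<eta>) u = A w \<xi> u + A w \<eta> u" "A w (c *\<^sub>R \<xi>) u = c *\<^sub>R A w \<xi> u"
    by (simp_all add: add scaleR)
qed

lemma A_smooth: "smooth_on U (\<lambda>w. A w \<xi> u)"
  using connection by (auto simp: chern_connection_def)

lemma A_differentiable: "(\<lambda>w. A w \<xi> u) differentiable (at z)"
  by (rule smooth_on_differentiable[OF A_smooth U(2)])

lemma metric_derivative:
  assumes "smooth_on U s" "smooth_on U t" "w \<in> U"
  shows "frechet_derivative (\<lambda>w. H w (s w) (t w)) (at w) \<xi> =
    H w (frechet_derivative s (at w) \<xi> + A w \<xi> (s w)) (t w) + H w (s w) (frechet_derivative t (at w) \<xi> + A w \<xi> (t w))"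
  using connection assms by (auto simp: chern_connection_def nabla0_def)

text \<open>On constant sections the condition on the (0,1)-part says that the (0,1)-part of
  \<open>A\<close> vanishes.\<close>

lemma A_i: "A w (\<i> *s \<xi>) u = \<i> *s A w \<xi> u" if w: "w \<in> U"
proof -
  have "(1 / 2) *s (nabla0 A (\<lambda>_. u) w \<xi> + \<i> *s nabla0 A (\<lambda>_. u) w (\<i> *s \<xi>)) =
      (1 / 2) *s (frechet_derivative (\<lambda>_. u) (at w) \<xi> + \<i> *s frechet_derivative (\<lambda>_. u) (at w) (\<i> *s \<xi>))"
    using connection w smooth_on_const unfolding chern_connection_def by blast
  then have "(1 / 2) *s (A w \<xi> u + \<i> *s A w (\<i> *s \<xi>) u) = 0"
    by (simp add: nabla0_def)
  then have 0: "A w \<xi> u + \<i> *s A w (\<i> *s \<xi>) u = 0"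
    by (subst (asm) vector_mul_eq_0) simp
  have "\<i> *s (A w \<xi> u + \<i> *s A w (\<i> *s \<xi>) u) = \<i> *s A w \<xi> u - A w (\<i> *s \<xi>) u"
    by (simp add: vector_add_ldistrib vector_smult_assoc)
  with 0 show ?thesis by simp
qed

definition DA :: "complex^'n \<Rightarrow> complex^'n \<Rightarrow> complex^'r \<Rightarrow> complex^'r" where
  "DA \<xi> \<eta> u = frechet_derivative (\<lambda>w. A w \<eta> u) (at z) \<xi>"

lemma derivative_eqI:
  assumes "f differentiable (at z)" "\<And>w. w \<in> U \<Longrightarrow> f w = g w" "(g has_derivative g') (at z)"
  shows "frechet_derivative f (at z) \<xi> = g' \<xi>"
  using frechet_derivative_transform_within_open[OF assms(1) U assms(2)] frechet_derivative_at[OF assms(3)]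
  by metis

lemma A_has_derivative: "((\<lambda>w. A w \<eta> u) has_derivative (\<lambda>\<xi>. DA \<xi> \<eta> u)) (at z)"
  using A_differentiable unfolding DA_def frechet_derivative_works by simp

lemma bounded_linear_scalar: "bounded_linear (\<lambda>x. c *s x :: complex^'r)"
  by (rule linear_conv_bounded_linear[THEN iffD1])
    (auto intro!: linearI simp: Finite_Cartesian_Product.vec_eq_iff)

text \<open>These identities for \<open>A\<close> hold throughout \<open>U\<close> and can be
  differentiated at \<open>z\<close>. In the direction of differentiation, treated in
  \<open>DA_left\<close>, there is only real linearity.\<close>

lemma DA_right:
  "DA \<xi> (\<eta> + \<zeta>) u = DA \<xi> \<eta> u + DA \<xi> \<zeta> u" "DA \<xi> (c *\<^sub>R \<eta>) u = c *\<^sub>R DA \<xi> \<eta> u"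
  "DA \<xi> (\<i> *s \<eta>) u = \<i> *s DA \<xi> \<eta> u"
  "DA \<xi> \<eta> (u + v) = DA \<xi> \<eta> u + DA \<xi> \<eta> v" "DA \<xi> \<eta> (b *s u) = b *s DA \<xi> \<eta> u"
proof -
  show "DA \<xi> (\<eta> + \<zeta>) u = DA \<xi> \<eta> u + DA \<xi> \<zeta> u"
    unfolding DA_def[of \<xi> "\<eta> + \<zeta>"]
    by (rule derivative_eqI[OF A_differentiable A_real(1) has_derivative_add[OF A_has_derivative A_has_derivative]])
  show "DA \<xi> (c *\<^sub>R \<eta>) u = c *\<^sub>R DA \<xi> \<eta> u"
    unfolding DA_def[of \<xi> "c *\<^sub>R \<eta>"]
    by (rule derivative_eqI[OF A_differentiable A_real(2) has_derivative_scaleR_right[OF A_has_derivative]])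
  show "DA \<xi> (\<i> *s \<eta>) u = \<i> *s DA \<xi> \<eta> u"
    unfolding DA_def[of \<xi> "\<i> *s \<eta>"]
    by (rule derivative_eqI[OF A_differentiable A_i bounded_linear.has_derivative[OF bounded_linear_scalar A_has_derivative]])
  show "DA \<xi> \<eta> (u + v) = DA \<xi> \<eta> u + DA \<xi> \<eta> v"
    unfolding DA_def[of \<xi> \<eta> "u + v"]
    by (rule derivative_eqI[OF A_differentiable A_complex(1) has_derivative_add[OF A_has_derivative A_has_derivative]])
  show "DA \<xi> \<eta> (b *s u) = b *s DA \<xi> \<eta> u"
    unfolding DA_def[of \<xi> \<eta> "b *s u"]
    by (rule derivative_eqI[OF A_differentiable A_complex(2) bounded_linear.has_derivative[OF bounded_linear_scalar A_has_derivative]])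
qed

lemma DA_left: "DA (\<xi> + \<zeta>) \<eta> u = DA \<xi> \<eta> u + DA \<zeta> \<eta> u" "DA (c *\<^sub>R \<xi>) \<eta> u = c *\<^sub>R DA \<xi> \<eta> u"
proof -
  interpret linear "frechet_derivative (\<lambda>w. A w \<eta> u) (at z)"
    by (rule linear_frechet_derivative[OF A_differentiable])
  show "DA (\<xi> + \<zeta>) \<eta> u = DA \<xi> \<eta> u + DA \<zeta> \<eta> u" "DA (c *\<^sub>R \<xi>) \<eta> u = c *\<^sub>R DA \<xi> \<eta> u"
    by (simp_all add: DA_def add scaleR)
qed

text \<open>The 2-form \<open>dA + A \<and> A\<close>, that is, the square of the connection without
  the factor \<open>\<i> / (2 * pi)\<close>.\<close>

definition F :: "complex^'n \<Rightarrow> complex^'n \<Rightarrow> complex^'r \<Rightarrow> complex^'r" where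
  "F \<xi> \<eta> u = DA \<xi> \<eta> u - DA \<eta> \<xi> u + A z \<xi> (A z \<eta> u) - A z \<eta> (A z \<xi> u)"

lemma curvature_eq: "curvature A z \<xi> \<eta> u = (\<i> / (2 * of_real pi)) *s F \<xi> \<eta> u"
proof -
  have "nabla0 A (\<lambda>_. u) = (\<lambda>w \<xi>. A w \<xi> u)"
    by (simp add: nabla0_def fun_eq_iff)
  then show ?thesis by (simp add: curvature_def nabla1_def F_def DA_def)
qed

lemma Az: "A z \<xi> (u + v) = A z \<xi> u + A z \<xi> v" "A z \<xi> (c *s u) = c *s A z \<xi> u"
  "A z (\<xi> + \<eta>) u = A z \<xi> u + A z \<eta> u" "A z (a *\<^sub>R \<xi>) u = a *\<^sub>R A z \<xi> u" "A z (\<i> *s \<xi>) u = \<i> *s A z \<xi> u"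
  using A_complex[OF U(2)] A_real[OF U(2)] A_i[OF U(2)] by auto

lemma scaleR_eq_smult: "a *\<^sub>R (x :: complex^'m) = of_real a *s x"
  by (simp add: Finite_Cartesian_Product.vec_eq_iff vector_scaleR_component scaleR_conv_of_real[where 'a = complex])

lemma F_linear:
  "F (\<xi> + \<zeta>) \<eta> u = F \<xi> \<eta> u + F \<zeta> \<eta> u" "F (a *\<^sub>R \<xi>) \<eta> u = a *\<^sub>R F \<xi> \<eta> u"
  "F \<xi> \<eta> (u + v) = F \<xi> \<eta> u + F \<xi> \<eta> v" "F \<xi> \<eta> (c *s u) = c *s F \<xi> \<eta> u"
  "F \<eta> \<xi> u = - F \<xi> \<eta> u"
proof -
  show "F (\<xi> + \<zeta>) \<eta> u = F \<xi> \<eta> u + F \<zeta> \<eta> u"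
    by (simp add: F_def DA_left(1) DA_right(1) Az(1,3))
  have "A z \<eta> (a *\<^sub>R v) = a *\<^sub>R A z \<eta> v" for v
    by (simp only: scaleR_eq_smult Az(2))
  then show "F (a *\<^sub>R \<xi>) \<eta> u = a *\<^sub>R F \<xi> \<eta> u"
    by (simp add: F_def DA_left(2) DA_right(2) Az(4) algebra_simps)
  show "F \<xi> \<eta> (u + v) = F \<xi> \<eta> u + F \<xi> \<eta> v"
    by (simp add: F_def DA_right(4) Az(1))
  show "F \<xi> \<eta> (c *s u) = c *s F \<xi> \<eta> u"
    by (simp add: F_def DA_right(5) Az(2) vector_add_ldistrib vector_ssub_ldistrib)
  show "F \<eta> \<xi> u = - F \<xi> \<eta> u"
    by (simp add: F_def)
qed

text \<open>The compatibility with the metric is differentiated twice on constant sections and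
  antisymmetrised in \<xi>, \<eta>. The left side cancels by symmetry of second derivatives, and on
  the right the mixed terms with \<open>A\<close> in both arguments cancel.\<close>

lemma F_skew: "Hz (F \<xi> \<eta> u) v + Hz u (F \<xi> \<eta> v) = 0"
proof -
  have D2: "frechet_derivative (\<lambda>w. frechet_derivative (\<lambda>w. H w u v) (at w) \<eta>) (at z) \<xi> =
      Hz (DA \<xi> \<eta> u + A z \<xi> (A z \<eta> u)) v + Hz (A z \<eta> u) (A z \<xi> v) +
      (Hz (A z \<xi> u) (A z \<eta> v) + Hz u (DA \<xi> \<eta> v + A z \<xi> (A z \<eta> v)))" for \<xi> \<eta>
  proof -
    have left: "(\<lambda>w. H w (A w \<eta> u) v) differentiable (at z)"
    proof -
      \<comment> \<open>The metric is known to be smooth on fixed vectors only, so the moving vector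
        \<open>A w \<eta> u\<close> is expanded in the standard basis.\<close>
      have expand: "H w x v = (\<Sum>i\<in>UNIV. x $ i * H w (axis i 1) v)" if "w \<in> U" for w x
        by (subst basis_expansion[of x, symmetric])
          (simp add: hermitian_formD(2,5)[OF metric_form[OF that]])
      have "(\<lambda>w. A w \<eta> u $ i) differentiable (at z)" for i
        using A_has_derivative[of \<eta> u] bounded_linear.has_derivative[OF bounded_linear_vec_nth[of i]]
        unfolding differentiable_def by blast
      then have "(\<lambda>w. \<Sum>i\<in>UNIV. A w \<eta> u $ i * H w (axis i 1) v) differentiable (at z)"
        using smooth_on_differentiable[OF smooth U(2)] by (intro differentiable_sum differentiable_mult) auto
      then obtain D where "((\<lambda>w. \<Sum>i\<in>UNIV. A w \<eta> u $ i * H w (axis i 1) v) has_derivative D) (at z)"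
        unfolding differentiable_def by blast
      then have "((\<lambda>w. H w (A w \<eta> u) v) has_derivative D) (at z)"
        by (rule has_derivative_transform_within_open[OF _ U]) (simp add: expand)
      then show ?thesis unfolding differentiable_def by blast
    qed
    have first: "frechet_derivative (\<lambda>w. H w u v) (at w) \<eta> = H w (A w \<eta> u) v + H w u (A w \<eta> v)" if "w \<in> U" for w
      using metric_derivative[OF smooth_on_const smooth_on_const that, of u v \<eta>] by simp
    have total: "(\<lambda>w. frechet_derivative (\<lambda>w. H w u v) (at w) \<eta>) differentiable (at z)"
      by (rule smooth_on_differentiable[OF smooth_on_derivative[OF smooth] U(2)])
    then have sum: "((\<lambda>w. frechet_derivative (\<lambda>w. H w u v) (at w) \<eta>) has_derivative
        frechet_derivative (\<lambda>w. frechet_derivative (\<lambda>w. H w u v) (at w) \<eta>) (at z)) (at z)"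
      by (simp add: frechet_derivative_works)
    have L: "((\<lambda>w. H w (A w \<eta> u) v) has_derivative frechet_derivative (\<lambda>w. H w (A w \<eta> u) v) (at z)) (at z)"
      using left by (simp add: frechet_derivative_works)
    \<comment> \<open>The second summand is differentiable as the difference of the smooth total and
      the first summand.\<close>
    have "((\<lambda>w. H w u (A w \<eta> v)) has_derivative
        (\<lambda>\<xi>. frechet_derivative (\<lambda>w. frechet_derivative (\<lambda>w. H w u v) (at w) \<eta>) (at z) \<xi> -
          frechet_derivative (\<lambda>w. H w (A w \<eta> u) v) (at z) \<xi>)) (at z)"
      by (rule has_derivative_transform_within_open[OF has_derivative_diff[OF sum L] U]) (simp add: first)
    from fun_cong[OF frechet_derivative_at[OF this], of \<xi>]
    have "frechet_derivative (\<lambda>w. frechet_derivative (\<lambda>w. H w u v) (at w) \<eta>) (at z) \<xi> =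
        frechet_derivative (\<lambda>w. H w (A w \<eta> u) v) (at z) \<xi> + frechet_derivative (\<lambda>w. H w u (A w \<eta> v)) (at z) \<xi>"
      by (simp add: algebra_simps)
    then show ?thesis
      using metric_derivative[OF A_smooth smooth_on_const U(2), of \<eta> u v \<xi>]
        metric_derivative[OF smooth_on_const A_smooth U(2), of u \<eta> v \<xi>]
      by (simp add: DA_def)
  qed
  have "frechet_derivative (\<lambda>w. frechet_derivative (\<lambda>w. H w u v) (at w) \<eta>) (at z) \<xi> =
      frechet_derivative (\<lambda>w. frechet_derivative (\<lambda>w. H w u v) (at w) \<xi>) (at z) \<eta>"
    by (rule second_derivative_symmetric[OF U smooth])
  moreover have "a - a' + b - b' + (e - e' + f - f') = 0"
    if "a + b + c + (d + (e + f)) = a' + b' + d + (c + (e' + f'))" for a b c d e f a' b' e' f' :: complex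
  proof -
    have "a - a' + b - b' + (e - e' + f - f') = (a + b + c + (d + (e + f))) - (a' + b' + d + (c + (e' + f')))"
      by (simp add: algebra_simps)
    then show ?thesis unfolding that by simp
  qed
  ultimately show ?thesis
    unfolding D2 F_def HzD(1,4,6,9) by blast
qed

text \<open>The connection form has type (1,0), so the curvature has no (0,2) part; being skew-hermitian,
  it has no (2,0) part either.\<close>

lemma F_type: "F (\<i> *s \<xi>) (\<i> *s \<eta>) u = F \<xi> \<eta> u" "F (\<i> *s \<xi>) \<eta> u = - F \<xi> (\<i> *s \<eta>) u"
proof -
  define P where "P u = F \<xi> \<eta> u - F (\<i> *s \<xi>) (\<i> *s \<eta>) u" for u
  define Q where "Q u = F (\<i> *s \<xi>) \<eta> u + F \<xi> (\<i> *s \<eta>) u" for u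
  \<comment> \<open>This is the vanishing of the (0,2) part; it uses that \<open>A\<close> and
    \<open>DA\<close> are complex linear in the argument of the form.\<close>
  have PQ: "P u = (- \<i>) *s Q u" for u
    by (simp add: P_def Q_def F_def DA_right(3) Az(2,5) Finite_Cartesian_Product.vec_eq_iff algebra_simps)
  have skewP: "Hz (P u) v + Hz u (P v) = 0" for u v
  proof -
    have "Hz (P u) v + Hz u (P v) = (Hz (F \<xi> \<eta> u) v + Hz u (F \<xi> \<eta> v)) -
        (Hz (F (\<i> *s \<xi>) (\<i> *s \<eta>) u) v + Hz u (F (\<i> *s \<xi>) (\<i> *s \<eta>) v))"
      by (simp add: P_def HzD(4,9))
    then show ?thesis by (simp add: F_skew)
  qed
  have skewQ: "Hz (Q u) v + Hz u (Q v) = 0" for u v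
  proof -
    have "Hz (Q u) v + Hz u (Q v) = (Hz (F (\<i> *s \<xi>) \<eta> u) v + Hz u (F (\<i> *s \<xi>) \<eta> v)) +
        (Hz (F \<xi> (\<i> *s \<eta>) u) v + Hz u (F \<xi> (\<i> *s \<eta>) v))"
      by (simp add: Q_def HzD(1,6))
    then show ?thesis by (simp add: F_skew)
  qed
  \<comment> \<open>Both \<open>Q\<close> and \<open>- \<i>\<close> times \<open>Q\<close> are skew,
    so \<open>Q\<close> is self-adjoint as well as skew, and then
    \<open>Hz (Q u) (Q u) = 0\<close>.\<close>
  have Q0: "Q u = 0" for u
  proof -
    have "- \<i> * Hz (Q u) (Q u) + \<i> * Hz u (Q (Q u)) = 0"
      using skewP[of u "Q u"] unfolding PQ HzD(2,7) by simp
    then have "Hz u (Q (Q u)) = Hz (Q u) (Q u)" by simp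
    then have "Hz (Q u) (Q u) = 0" using skewQ[of u "Q u"] by simp
    then show ?thesis using metric[OF U(2)] unfolding hermitian_structure_def by force
  qed
  show "F (\<i> *s \<xi>) (\<i> *s \<eta>) u = F \<xi> \<eta> u"
    using PQ[of u] Q0[of u] by (simp add: P_def)
  show "F (\<i> *s \<xi>) \<eta> u = - F \<xi> (\<i> *s \<eta>) u"
    using Q0[of u] by (simp add: Q_def eq_neg_iff_add_eq_0)
qed

section \<open>The curvature as a hermitian tensor, and its trace\<close>

abbreviation "\<Theta> \<equiv> curvature A z"

abbreviation "\<theta> \<equiv> tensor_of_curvature Hz \<Theta>"

text \<open>The last identity is self-adjointness: the factor \<open>\<i>\<close> turns the
  skew-hermitian \<open>F\<close> into a hermitian endomorphism.\<close>

lemma curvature_linear: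
  "\<Theta> (\<xi> + \<zeta>) \<eta> u = \<Theta> \<xi> \<eta> u + \<Theta> \<zeta> \<eta> u" "\<Theta> (of_real a *s \<xi>) \<eta> u = of_real a *s \<Theta> \<xi> \<eta> u"
  "\<Theta> \<xi> \<eta> (u + v) = \<Theta> \<xi> \<eta> u + \<Theta> \<xi> \<eta> v" "\<Theta> \<xi> \<eta> (c *s u) = c *s \<Theta> \<xi> \<eta> u"
  "\<Theta> \<eta> \<xi> u = - \<Theta> \<xi> \<eta> u"
  "\<Theta> (\<i> *s \<xi>) (\<i> *s \<eta>) u = \<Theta> \<xi> \<eta> u" "\<Theta> (\<i> *s \<xi>) \<eta> u = - \<Theta> \<xi> (\<i> *s \<eta>) u"
  "Hz (\<Theta> \<xi> \<eta> u) v = Hz u (\<Theta> \<xi> \<eta> v)"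
proof -
  show "Hz (\<Theta> \<xi> \<eta> u) v = Hz u (\<Theta> \<xi> \<eta> v)"
    using F_skew[of \<xi> \<eta> u v] by (simp add: curvature_eq HzD add_eq_0_iff)
  show "\<Theta> \<eta> \<xi> u = - \<Theta> \<xi> \<eta> u"
    using F_linear(5)[of \<eta> \<xi> u] by (simp add: curvature_eq Finite_Cartesian_Product.vec_eq_iff)
  show "\<Theta> (\<i> *s \<xi>) \<eta> u = - \<Theta> \<xi> (\<i> *s \<eta>) u"
    by (simp add: curvature_eq F_type(2) Finite_Cartesian_Product.vec_eq_iff)
  show "\<Theta> (\<i> *s \<xi>) (\<i> *s \<eta>) u = \<Theta> \<xi> \<eta> u"
    by (simp add: curvature_eq F_type(1))
  have "F (of_real a *s \<xi>) \<eta> u = of_real a *s F \<xi> \<eta> u"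
    using F_linear(2)[of a \<xi> \<eta> u] by (simp only: scaleR_eq_smult)
  then show "\<Theta> (of_real a *s \<xi>) \<eta> u = of_real a *s \<Theta> \<xi> \<eta> u"
    by (simp add: curvature_eq Finite_Cartesian_Product.vec_eq_iff)
qed (simp_all add: curvature_eq F_linear(1,3,4) Finite_Cartesian_Product.vec_eq_iff ring_distribs)

text \<open>By type (1,1), \<open>\<Theta> \<xi> (\<i> *s \<eta>)\<close> is symmetric in \<xi>,
  \<eta>, while \<open>\<Theta> \<xi> \<eta>\<close> is antisymmetric. As both are self-adjoint on
  the fibre, conjugation changes only the sign of the second term of \<open>\<theta>\<close>, and so
  does the exchange of \<xi> and \<eta>.\<close>

lemma tensor_hermitian: "\<theta> \<eta> v \<xi> u = cnj (\<theta> \<xi> u \<eta> v)"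
proof -
  have c: "cnj (Hz x y) = Hz y x" for x y
    using hermitian_formD(11)[OF metric_form[OF U(2)], of y x] by simp
  have "\<Theta> \<eta> (\<i> *s \<xi>) v = \<Theta> \<xi> (\<i> *s \<eta>) v" "\<Theta> \<eta> \<xi> v = - \<Theta> \<xi> \<eta> v"
    using curvature_linear(5)[of \<eta> "\<i> *s \<xi>" v] curvature_linear(7)[of \<xi> \<eta> v] curvature_linear(5)[of \<eta> \<xi> v] by simp_all
  moreover have "Hz (- x) y = - Hz x y" for x y
    using HzD(4)[of 0 x y] by (simp add: HzD(3))
  ultimately show ?thesis
    unfolding tensor_of_curvature_def by (simp add: c curvature_linear(8))
qed

lemma tensor_is_hermitian_tensor: "hermitian_tensor (*s) (*s) \<theta>"
  unfolding hermitian_tensor_def complex_functional_iff[OF vec.vector_space_axioms]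
proof (intro conjI allI)
  show add: "\<theta> (\<xi> + \<zeta>) u \<eta> v = \<theta> \<xi> u \<eta> v + \<theta> \<zeta> u \<eta> v" for \<xi> \<zeta> u \<eta> v
    by (simp add: tensor_of_curvature_def curvature_linear(1) HzD(1) field_simps)
  show "\<theta> (c *s \<xi>) u \<eta> v = c * \<theta> \<xi> u \<eta> v" for c \<xi> u \<eta> v
  proof -
    have re: "\<theta> (of_real a *s \<xi>) u \<eta> v = of_real a * \<theta> \<xi> u \<eta> v" for a \<xi>
      by (simp add: tensor_of_curvature_def curvature_linear(2) HzD(2) algebra_simps)
    have "Hz (- x) y = - Hz x y" for x y
      using HzD(4)[of 0 x y] by (simp add: HzD(3))
    \<comment> \<open>Replacing \<xi> by \<open>\<i> *s \<xi>\<close> exchanges the two terms of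
      \<open>\<theta>\<close> up to the factor \<open>\<i>\<close>; with real linearity this gives
      complex linearity.\<close>
    then have im: "\<theta> (\<i> *s \<xi>) u \<eta> v = \<i> * \<theta> \<xi> u \<eta> v" for \<xi>
      unfolding tensor_of_curvature_def curvature_linear(6) curvature_linear(7)[of _ \<eta>] by (simp add: algebra_simps)
    have c: "of_real (Re c) + of_real (Im c) * \<i> = c"
      by (simp add: complex_eq_iff)
    have "(of_real (Re c) + of_real (Im c) * \<i>) *s \<xi> = of_real (Re c) *s \<xi> + of_real (Im c) *s (\<i> *s \<xi>)"
      by (simp add: Finite_Cartesian_Product.vec_eq_iff ring_distribs)
    then have "c *s \<xi> = of_real (Re c) *s \<xi> + of_real (Im c) *s (\<i> *s \<xi>)"
      by (simp only: c)
    then have "\<theta> (c *s \<xi>) u \<eta> v = (of_real (Re c) + of_real (Im c) * \<i>) * \<theta> \<xi> u \<eta> v"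
      by (simp only: add re im ring_distribs mult.assoc)
    then show ?thesis
      by (simp only: c)
  qed
  show "\<theta> \<xi> (u + u') \<eta> v = \<theta> \<xi> u \<eta> v + \<theta> \<xi> u' \<eta> v" for \<xi> u u' \<eta> v
    by (simp add: tensor_of_curvature_def curvature_linear(3) HzD(1) field_simps)
  show "\<theta> \<xi> (c *s u) \<eta> v = c * \<theta> \<xi> u \<eta> v" for \<xi> c u \<eta> v
    by (simp add: tensor_of_curvature_def curvature_linear(4) HzD(2) algebra_simps)
qed (rule tensor_hermitian)

text \<open>Exchanging \<xi> and \<eta> keeps the symmetric first term of \<open>\<theta>\<close>
  and reverses the second, so the difference is twice the second term.\<close>

lemma curvature_tensor: "Hz (\<Theta> \<xi> \<eta> u) v = \<i> * (\<theta> \<xi> u \<eta> v - \<theta> \<eta> u \<xi> v)"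
proof -
  have "\<Theta> \<eta> (\<i> *s \<xi>) u = \<Theta> \<xi> (\<i> *s \<eta>) u" "\<Theta> \<eta> \<xi> u = - \<Theta> \<xi> \<eta> u"
    using curvature_linear(5)[of \<eta> "\<i> *s \<xi>" u] curvature_linear(7)[of \<xi> \<eta> u] curvature_linear(5)[of \<eta> \<xi> u] by simp_all
  moreover have "Hz (- x) y = - Hz x y" for x y
    using HzD(4)[of 0 x y] by (simp add: HzD(3))
  ultimately have "\<theta> \<eta> u \<xi> v = (Hz (\<Theta> \<xi> (\<i> *s \<eta>) u) v + \<i> * Hz (\<Theta> \<xi> \<eta> u) v) / 2"
    by (simp only: tensor_of_curvature_def mult_minus_right diff_minus_eq_add)
  then show ?thesis
    by (simp add: tensor_of_curvature_def field_simps)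
qed

text \<open>Expanding the standard vectors in \<open>B\<close>, or the images of \<open>B\<close> in
  standard coordinates, leads to the same double sum.\<close>

lemma trace_orthonormal_basis:
  assumes B: "orthonormal_basis (*s) Hz B" and f: "\<And>u v. f (u + v) = f u + f v" "\<And>c u. f (c *s u) = c *s f u"
  shows "(\<Sum>e\<in>B. Hz (f e) e) = trace (matrix f)"
proof -
  interpret B: finite_dimensional_vector_space "(*s)" B
    using B by (simp add: orthonormal_basis_def)
  have f0: "f 0 = 0" using f(2)[of 0 0] by simp
  have fsum: "f (\<Sum>e\<in>X. g e) = (\<Sum>e\<in>X. f (g e))" for X and g :: "complex^'r \<Rightarrow> complex^'r"
    by (induction X rule: infinite_finite_induct) (simp_all add: f0 f(1))
  have expansion: "u = (\<Sum>e\<in>B. Hz u e *s e)" for u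
  proof -
    obtain c where c: "u = (\<Sum>e\<in>B. c e *s e)"
      using B.span_Basis vec.span_finite[OF B.finite_Basis] by blast
    have "Hz u e = c e" if "e \<in> B" for e
    proof -
      have "Hz u e = (\<Sum>f\<in>B. if f = e then c f else 0)"
        unfolding c HzD(2,5) using B that by (intro sum.cong) (auto simp: orthonormal_basis_def)
      then show ?thesis using that B.finite_Basis by simp
    qed
    then have "(\<Sum>e\<in>B. Hz u e *s e) = (\<Sum>e\<in>B. c e *s e)"
      by (intro sum.cong) auto
    with c show ?thesis by simp
  qed
  have "trace (matrix f) = (\<Sum>i\<in>UNIV. f (axis i 1) $ i)"
    by (simp add: trace_def matrix_def)
  also have "\<dots> = (\<Sum>i\<in>UNIV. \<Sum>e\<in>B. Hz (axis i 1) e * f e $ i)"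
  proof (intro sum.cong refl)
    fix i :: 'r
    have "f (axis i 1) = (\<Sum>e\<in>B. Hz (axis i 1) e *s f e)"
      by (subst expansion) (simp only: fsum f(2))
    then show "f (axis i 1) $ i = (\<Sum>e\<in>B. Hz (axis i 1) e * f e $ i)"
      by simp
  qed
  also have "\<dots> = (\<Sum>e\<in>B. \<Sum>i\<in>UNIV. Hz (axis i 1) e * f e $ i)"
    by (rule sum.swap)
  also have "\<dots> = (\<Sum>e\<in>B. Hz (f e) e)"
  proof (intro sum.cong refl)
    fix e
    have "Hz (f e) e = Hz (\<Sum>i\<in>UNIV. f e $ i *s axis i 1) e"
      by (simp only: basis_expansion)
    then show "(\<Sum>i\<in>UNIV. Hz (axis i 1) e * f e $ i) = Hz (f e) e"
      by (simp add: HzD(2,5) mult.commute)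
  qed
  finally show ?thesis by simp
qed

lemma trace_tensor:
  assumes B: "orthonormal_basis (*s) Hz B"
  shows "h_trace B \<theta> = first_chern_form \<Theta>"
proof
  fix v
  have "h_trace B \<theta> v = (\<Sum>e\<in>B. Hz (\<Theta> (v 0) (v 1) e) e)"
    by (simp add: h_trace_def contract_def form_of_hermitian_def curvature_tensor)
  also have "\<dots> = first_chern_form \<Theta> v"
    unfolding first_chern_form_def by (rule trace_orthonormal_basis[OF B curvature_linear(3,4)])
  finally show "h_trace B \<theta> v = first_chern_form \<Theta> v" .
qed

lemma curvature_inequalities:
  assumes "unitary_invariant_probability (*s) Hz \<mu>" "k \<le> p" "length ls = k" "\<forall>l\<in>set ls. complex_functional (*s) l"
  shows "strongly_semipositive (*s) (*s) \<theta> \<Longrightarrow>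
      strong_ge (*s) (p - k) (sphere_integral \<mu> ls (replicate (p - k) \<theta>))
        (bound_form (fact (CARD('r) - 1) / fact (p + CARD('r) - 1)) Hz ls (replicate (p - k) (first_chern_form \<Theta>))) \<and>
      strong_ge (*s) (p - k)
        (bound_form (fact p * fact (CARD('r) - 1) / fact (p + CARD('r) - 1)) Hz ls (replicate (p - k) (first_chern_form \<Theta>)))
        (sphere_integral \<mu> ls (replicate (p - k) \<theta>))"
    and "griffiths_semipositive \<theta> \<Longrightarrow>
      weak_ge (*s) (p - k)
        (bound_form (fact p * fact (CARD('r) - 1) / fact (p + CARD('r) - 1)) Hz ls (replicate (p - k) (first_chern_form \<Theta>)))
        (sphere_integral \<mu> ls (replicate (p - k) \<theta>))"
proof -
  have fin: "finite_dimensional_vector_space (*s) (cart_basis :: (complex^'r) set)"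
    by (rule vec.finite_dimensional_vector_space_axioms)
  then have dim: "complex_space ((*s) :: complex \<Rightarrow> complex^'r \<Rightarrow> _) CARD('r)"
    unfolding complex_space_def using card_cart_basis[where 'a = complex and 'i = 'r] by blast
  \<comment> \<open>The inequalities mention no basis: any orthonormal one will do, since its trace
    is the Chern form.\<close>
  obtain B where B: "orthonormal_basis (*s) Hz B"
    using exists_orthonormal_basis[OF fin metric[OF U(2)]] .
  note P = tensor_inequalities[OF dim metric[OF U(2)] assms(1) B assms(2-4)]
  show "strongly_semipositive (*s) (*s) \<theta> \<Longrightarrow>
      strong_ge (*s) (p - k) (sphere_integral \<mu> ls (replicate (p - k) \<theta>))
        (bound_form (fact (CARD('r) - 1) / fact (p + CARD('r) - 1)) Hz ls (replicate (p - k) (first_chern_form \<Theta>))) \<and>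
      strong_ge (*s) (p - k)
        (bound_form (fact p * fact (CARD('r) - 1) / fact (p + CARD('r) - 1)) Hz ls (replicate (p - k) (first_chern_form \<Theta>)))
        (sphere_integral \<mu> ls (replicate (p - k) \<theta>))"
    using P(1)[of "replicate (p - k) \<theta>" "(*s)"] tensor_is_hermitian_tensor trace_tensor[OF B] by simp
  show "griffiths_semipositive \<theta> \<Longrightarrow>
      weak_ge (*s) (p - k)
        (bound_form (fact p * fact (CARD('r) - 1) / fact (p + CARD('r) - 1)) Hz ls (replicate (p - k) (first_chern_form \<Theta>)))
        (sphere_integral \<mu> ls (replicate (p - k) \<theta>))"
    using P(2)[of "(*s)" \<theta>] tensor_is_hermitian_tensor trace_tensor[OF B] by simp
qed

end

section \<open>From the bundle to a local coordinate and frame\<close>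

text \<open>The point to check is that the coordinate domain is open: a chart is a homeomorphism
  onto an open set, so it maps the open overlap \<open>U \<inter> V\<close> to an open set.\<close>

lemma chern_of_bundle:
  assumes vb: "holomorphic_vector_bundle X \<A> E \<pi> \<T>" and h: "hermitian_metric \<A> \<T> h"
    and "(U, \<phi>) \<in> \<A>" "(V, \<tau>) \<in> \<T>" "x \<in> U \<inter> V"
    and A: "chern_connection (\<phi> ` (U \<inter> V)) (local_metric h U \<phi> \<tau>) A"
  shows "chern (\<phi> ` (U \<inter> V)) (local_metric h U \<phi> \<tau>) A (\<phi> x)"
proof
  note vb' = vb[unfolded holomorphic_vector_bundle_def]
  have triv: "\<forall>(V, \<tau>)\<in>\<T>. openin X V \<and> (\<forall>x\<in>V. bij_betw (\<tau> x) UNIV {e \<in> E. \<pi> e = x})"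
    by (rule vb'[THEN conjunct2, THEN conjunct2, THEN conjunct2, THEN conjunct1])
  have "\<forall>(U, \<phi>)\<in>\<A>. openin X U \<and> open (\<phi> ` U) \<and> homeomorphic_map (subtopology X U) (top_of_set (\<phi> ` U)) \<phi>"
    by (rule vb'[THEN conjunct1, unfolded complex_manifold_def, THEN conjunct2, THEN conjunct2, THEN conjunct2, THEN conjunct1])
  from bspec[OF this assms(3)]
  have 1: "openin X U" "open (\<phi> ` U)" "homeomorphic_map (subtopology X U) (top_of_set (\<phi> ` U)) \<phi>"
    by auto
  have "openin X V"
    using bspec[OF triv assms(4)] by simp
  then have "openin (subtopology X U) (U \<inter> V)"
    using openin_subtopology_Int2 by blast
  then have "openin (top_of_set (\<phi> ` U)) (\<phi> ` (U \<inter> V))"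
    using homeomorphic_imp_open_map[OF 1(3)] by (simp add: open_map_def)
  then show "open (\<phi> ` (U \<inter> V))"
    using openin_open_eq[OF 1(2)] by blast
  show "\<phi> x \<in> \<phi> ` (U \<inter> V)" using assms(5) by blast
  have metric: "(\<forall>z\<in>\<phi> ` (U \<inter> V). hermitian_structure (*s) (local_metric h U \<phi> \<tau> z)) \<and>
      (\<forall>u v. smooth_on (\<phi> ` (U \<inter> V)) (\<lambda>z. local_metric h U \<phi> \<tau> z u v))"
    using bspec[OF bspec[OF h[unfolded hermitian_metric_def] assms(3), unfolded prod.case] assms(4)] by simp
  then show "hermitian_structure (*s) (local_metric h U \<phi> \<tau> w)" if "w \<in> \<phi> ` (U \<inter> V)" for w
    using that by blast
  show "smooth_on (\<phi> ` (U \<inter> V)) (\<lambda>w. local_metric h U \<phi> \<tau> w u v)" for u v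
    using metric by blast
qed (rule A)

theorem proposition5p13:
  shows
    "(\<forall>(sT :: complex \<Rightarrow> 't \<Rightarrow> 't::ab_group_add) (sE :: complex \<Rightarrow> 'e \<Rightarrow> 'e::ab_group_add)
        n r h \<mu> B k p.
        complex_space sT n \<and> complex_space sE r \<and> hermitian_structure sE h \<and>
        unitary_invariant_probability sE h \<mu> \<and> orthonormal_basis sE h B \<and> k \<le> p \<longrightarrow>
        (\<forall>ls \<theta>s.
           length ls = k \<and> (\<forall>l\<in>set ls. complex_functional sE l) \<and>
           length \<theta>s = p - k \<and>
           (\<forall>\<theta>\<in>set \<theta>s. hermitian_tensor sT sE \<theta> \<and> strongly_semipositive sT sE \<theta>) \<longrightarrow>
           strong_ge sT (p - k)
             (sphere_integral \<mu> ls \<theta>s)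
             (bound_form (fact (r - 1) / fact (p + r - 1)) h ls (map (h_trace B) \<theta>s)) \<and>
           strong_ge sT (p - k)
             (bound_form (fact p * fact (r - 1) / fact (p + r - 1)) h ls (map (h_trace B) \<theta>s))
             (sphere_integral \<mu> ls \<theta>s)) \<and>
        (\<forall>ls \<theta>.
           length ls = k \<and> (\<forall>l\<in>set ls. complex_functional sE l) \<and>
           hermitian_tensor sT sE \<theta> \<and> griffiths_semipositive \<theta> \<longrightarrow>
           weak_ge sT (p - k)
             (bound_form (fact p * fact (r - 1) / fact (p + r - 1)) h ls
                (replicate (p - k) (h_trace B \<theta>)))
             (sphere_integral \<mu> ls (replicate (p - k) \<theta>)))) \<and>
     (\<forall>(X :: 'x topology) (\<A> :: ('x set \<times> ('x \<Rightarrow> complex^'n)) set) (E :: 'b set) \<pi>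
        (\<T> :: ('x set \<times> ('x \<Rightarrow> complex^'r \<Rightarrow> 'b)) set) h U \<phi> V \<tau> A x \<mu> B k p ls.
        holomorphic_vector_bundle X \<A> E \<pi> \<T> \<and> hermitian_metric \<A> \<T> h \<and>
        (U, \<phi>) \<in> \<A> \<and> (V, \<tau>) \<in> \<T> \<and> x \<in> U \<inter> V \<and>
        chern_connection (\<phi> ` (U \<inter> V)) (local_metric h U \<phi> \<tau>) A \<longrightarrow>
        (let hx = local_metric h U \<phi> \<tau> (\<phi> x);
             \<Theta> = curvature A (\<phi> x);
             \<theta> = tensor_of_curvature hx \<Theta>;
             c\<^sub>1 = first_chern_form \<Theta>;
             r = CARD('r)
         in hermitian_tensor (*s) (*s) \<theta> \<and>
            (\<forall>\<xi> \<eta> u v. hx (\<Theta> \<xi> \<eta> u) v = \<i> * (\<theta> \<xi> u \<eta> v - \<theta> \<eta> u \<xi> v)) \<and>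
            (orthonormal_basis (*s) hx B \<longrightarrow> h_trace B \<theta> = c\<^sub>1) \<and>
            (unitary_invariant_probability (*s) hx \<mu> \<and> k \<le> p \<and>
             length ls = k \<and> (\<forall>l\<in>set ls. complex_functional (*s) l) \<longrightarrow>
             (strongly_semipositive (*s) (*s) \<theta> \<longrightarrow>
                strong_ge (*s) (p - k)
                  (sphere_integral \<mu> ls (replicate (p - k) \<theta>))
                  (bound_form (fact (r - 1) / fact (p + r - 1)) hx ls (replicate (p - k) c\<^sub>1)) \<and>
                strong_ge (*s) (p - k)
                  (bound_form (fact p * fact (r - 1) / fact (p + r - 1)) hx ls
                     (replicate (p - k) c\<^sub>1))
                  (sphere_integral \<mu> ls (replicate (p - k) \<theta>))) \<and>
             (griffiths_semipositive \<theta> \<longrightarrow>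
                weak_ge (*s) (p - k)
                  (bound_form (fact p * fact (r - 1) / fact (p + r - 1)) hx ls
                     (replicate (p - k) c\<^sub>1))
                  (sphere_integral \<mu> ls (replicate (p - k) \<theta>))))))"
proof (rule conjI, goal_cases)
  case 1
  show ?case
  proof (intro allI impI, elim conjE, goal_cases)
    case prems: (1 sT sE n r h \<mu> B k p)
    note strong = tensor_inequalities(1)[OF prems(2-6)] and weak = tensor_inequalities(2)[OF prems(2-6)]
    show ?case
    proof (rule conjI, goal_cases)
      case 1
      show ?case
      proof (intro allI impI, elim conjE, goal_cases)
        case (1 ls \<theta>s)
        then show ?case by (intro strong)
      qed
    next
      case 2
      show ?case
      proof (intro allI impI, elim conjE, goal_cases)
        case (1 ls \<theta>)
        then show ?case by (intro weak)
      qed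
    qed
  qed
next
  case 2
  show ?case
    unfolding Let_def
  proof (intro allI impI, elim conjE, goal_cases)
    case prems: (1 X \<A> E \<pi> \<T> h U \<phi> V \<tau> A x \<mu> B k p ls)
    interpret chern "\<phi> ` (U \<inter> V)" "local_metric h U \<phi> \<tau>" A "\<phi> x"
      by (rule chern_of_bundle[OF prems])
    show ?case
    proof (intro conjI allI impI, goal_cases)
      case 1
      show ?case by (rule tensor_is_hermitian_tensor)
    next
      case 2
      show ?case by (rule curvature_tensor)
    next
      case 3
      then show ?case by (rule trace_tensor)
    next
      case 4
      then show ?case using curvature_inequalities(1) by (elim conjE) simp
    next
      case 5
      then show ?case using curvature_inequalities(1) by (elim conjE) simp
    next
      case 6
      then show ?case using curvature_inequalities(2) by (elim conjE) simp
    qed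
  qed
qed

end
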